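(* Let $((A,\mu),(A^*,\gamma))$ be a Lie bialgebroid such that $A\oplus A^*$, with the Courant algebroid structure $\mu+\gamma$, is an irreducible Courant algebroid. Let $N:A\to A$ be a vector bundle endomorphism. If $\mathcal N=\begin{pmatrix}N&0\\0&-{}^tN\end{pmatrix}$ is a Nijenhuis tensor for $A\oplus A^*$, then $N$ is proportional to a cps structure on $A$, and ${}^tN$ is proportional to a cps structure on $A^*$.
   Context: Let $A$ be a (smooth, real, finite rank) vector bundle over a manifold $M$, and equip $E=A\oplus A^*$ with the canonical symmetric bilinear form $\langle X+\xi,Y+\eta\rangle=\xi(Y)+\eta(X)$. $\mathcal A=\bigoplus_k\mathcal A^k$ is the graded algebra of functions on the graded manifold $T^*[2]A[1]$, with its canonical Poisson bracket $\{\cdot,\cdot\}$ of degree $-2$ (the big bracket). For a local basis $(e_\alpha)$ of $\Gamma A$ with dual basis $(\epsilon^\alpha)$, local coordinates are $(x^i,\tau^\alpha,p_i,\theta_\alpha)$ of degrees $0,1,2,1$, with non-vanishing brackets $\{x^i,p_j\}=\delta^i_j$, $\{\tau^\alpha,\theta_\beta\}=\delta^\alpha_\beta$. $\mathcal A^0=C^\infty(M)$; $\mathcal A^1=\Gamma(A\oplus A^* )$, with $X=X^\alpha e_\alpha$ identified with $X^\alpha\theta_\alpha$ and $\xi=\xi_\alpha\epsilon^\alpha$ with $\xi_\alpha\tau^\alpha$; $\{u,v\}=\langle u,v\rangle$ for sections of $E$. A Lie algebroid structure on $A$ is given by $\mu\in\mathcal A^3$, locally a combination with coefficients in $C^\infty(M)$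 of terms $\tau^\alpha p_i$ and $\tau^\alpha\tau^\beta\theta_\gamma$, with $\{\mu,\mu\}=0$: anchor $\rho(X)f=\{\{X,\mu\},f\}$, bracket $[X,Y]^\mu=\{\{X,\mu\},Y\}$. A Lie algebroid structure on $A^*$ is given similarly by $\gamma\in\mathcal A^3$ (terms $\theta_\alpha p_i$ and $\theta_\alpha\theta_\beta\tau^\gamma$), $\{\gamma,\gamma\}=0$, $[\xi,\eta]^\gamma=\{\{\xi,\gamma\},\eta\}$. They form a Lie bialgebroid iff moreover $\{\mu,\gamma\}=0$. Then $\mu+\gamma$ makes $A\oplus A^*$ a Courant algebroid (the double), with (Dorfman) bracket $[u,v]=\{\{u,\mu+\gamma\},v\}$ on $\Gamma(A\oplus A^* )$. The torsion of an endomorphism $P$ for a bracket $[\cdot,\cdot]$ is $(u,v)\mapsto[Pu,Pv]-P([Pu,v]+[u,Pv]-P[u,v])$. A Nijenhuis tensor for a Courant algebroid $E$ is an endomorphism $\mathcal N$ which is skew-symmetric ($\langle\mathcal Nu,v\rangle+\langle u,\mathcal Nv\rangle=0$) and has vanishing torsion for the Dorfman bracket. A Courant algebroid $E$ is irreducible if every symmetric vector bundle endomorphism $\phi$ of $E$ ($\langle\phi u,v\rangle=\langle u,\phi v\rangle$) such that $[u,\phi v]=\phi[u,v]$ and $[\phi u,v]=\phi[u,v]$ for all sections $u,v$ is proportional to $\mathrm{Id}_E$. An almost cps structure on a Lie algebroid $B$ is an endomorphism $P$ of $B$ with $P^2=\epsilon\,\mathrm{Id}_B$, $\epsilon\in\{-1,1,0\}$;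 it is a cps structure if moreover its torsion for the Lie algebroid bracket of $B$ vanishes. "Proportional to" means equal to a real constant multiple of. Here $A$ and $A^*$ carry the Lie algebroid structures $\mu$ and $\gamma$; ${}^tN:A^*\to A^*$ is the transpose of $N$. *)

theory Defs
  imports "HOL-Analysis.Analysis" "HOL-Library.Function_Algebras" "HOL-Library.Multiset"
begin

text \<open>Pointwise scalar multiplication on functions; it makes the duals below real vector spaces.\<close>

instantiation "fun" :: (type, scaleR) scaleR
begin
definition scaleR_fun :: "real \<Rightarrow> ('a \<Rightarrow> 'b) \<Rightarrow> 'a \<Rightarrow> 'b"
  where "scaleR_fun c f = (\<lambda>x. c *\<^sub>R f x)"
instance ..
end

instance "fun" :: (type, real_vector) real_vector
  by standard (auto simp: scaleR_fun_def fun_eq_iff scaleR_add_right scaleR_add_left)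


section \<open>Smooth manifolds\<close>

text \<open>
  The model space of dimension \<open>n\<close> is the library's \<^const>\<open>Euclidean_space\<close> \<open>n\<close>, whose points are
  the functions \<open>nat \<Rightarrow> real\<close> vanishing from index \<open>n\<close> on. This allows \<open>n = 0\<close>, for which a
  Lie algebroid over a point is a Lie algebra.
\<close>

definition pderivative :: "nat \<Rightarrow> ((nat \<Rightarrow> real) \<Rightarrow> real) \<Rightarrow> (nat \<Rightarrow> real) \<Rightarrow> real" where
  "pderivative i f x = deriv (\<lambda>t. f (x(i := t))) (x i)"

fun Ck_on :: "nat \<Rightarrow> nat \<Rightarrow> (nat \<Rightarrow> real) set \<Rightarrow> ((nat \<Rightarrow> real) \<Rightarrow> real) \<Rightarrow> bool" where
  "Ck_on n 0 V f \<longleftrightarrow> continuous_on V f"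
| "Ck_on n (Suc k) V f \<longleftrightarrow> continuous_on V f \<and>
     (\<forall>i<n. (\<forall>x\<in>V. (\<lambda>t. f (x(i := t))) field_differentiable at (x i)) \<and>
            Ck_on n k V (pderivative i f))"

text \<open>To be used for \<open>V\<close> open in \<^const>\<open>Euclidean_space\<close> \<open>n\<close>.\<close>

definition Cinf_on :: "nat \<Rightarrow> (nat \<Rightarrow> real) set \<Rightarrow> ((nat \<Rightarrow> real) \<Rightarrow> real) \<Rightarrow> bool" where
  "Cinf_on n V f \<longleftrightarrow> (\<forall>k. Ck_on n k V f)"

type_synonym 'm chart = "'m set \<times> ('m \<Rightarrow> nat \<Rightarrow> real)"

record 'm manifold =
  mdim :: nat
  charts :: "'m chart set"

definition is_chart :: "nat \<Rightarrow> 'm::topological_space chart \<Rightarrow> bool" where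
  "is_chart n c \<longleftrightarrow> open (fst c) \<and> openin (Euclidean_space n) (snd c ` fst c) \<and>
     (\<exists>\<psi>. homeomorphism (fst c) (snd c ` fst c) (snd c) \<psi>)"

abbreviation chart_inv :: "'m chart \<Rightarrow> (nat \<Rightarrow> real) \<Rightarrow> 'm" where
  "chart_inv c \<equiv> inv_into (fst c) (snd c)"

text \<open>The underlying set of the manifold is the whole type \<open>'m\<close>.\<close>

definition smooth_manifold :: "'m::{t2_space,second_countable_topology} manifold \<Rightarrow> bool" where
  "smooth_manifold M \<longleftrightarrow>
     (\<forall>c\<in>charts M. is_chart (mdim M) c) \<and> (\<Union>c\<in>charts M. fst c) = UNIV \<and>
     (\<forall>c\<in>charts M. \<forall>d\<in>charts M. \<forall>i<mdim M.
        Cinf_on (mdim M) (snd c ` (fst c \<inter> fst d)) (\<lambda>x. snd d (chart_inv c x) i))"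

definition smooth_on :: "'m manifold \<Rightarrow> 'm set \<Rightarrow> ('m \<Rightarrow> real) \<Rightarrow> bool" where
  "smooth_on M W f \<longleftrightarrow>
     (\<forall>c\<in>charts M. Cinf_on (mdim M) (snd c ` (fst c \<inter> W)) (f \<circ> chart_inv c))"

definition coord_deriv :: "'m chart \<Rightarrow> nat \<Rightarrow> ('m \<Rightarrow> real) \<Rightarrow> 'm \<Rightarrow> real" where
  "coord_deriv c i f p = pderivative i (f \<circ> chart_inv c) (snd c p)"


section \<open>Smooth vector bundles\<close>

text \<open>
  The fibre over \<open>p\<close> is a linear subspace \<open>fib A p\<close> of a real vector space \<open>'v\<close>. This is no
  restriction, since any family of vector spaces embeds in its direct sum: \<open>'v\<close> has no topology,
  and fibres over distinct points are not identified in any way. The smooth structure is given by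
  an atlas of local frames \<open>(W, e)\<close>, where \<open>e 0 p, \<dots>, e (r - 1) p\<close> is a basis of \<open>fib A p\<close> for all \<open>p \<in> W\<close>.
\<close>

type_synonym ('m, 'v) frame = "'m set \<times> (nat \<Rightarrow> 'm \<Rightarrow> 'v)"

record ('m, 'v) vbundle =
  base :: "'m manifold"
  fib :: "'m \<Rightarrow> 'v set"
  rank :: nat
  frames :: "('m, 'v) frame set"

definition comp :: "nat \<Rightarrow> (nat \<Rightarrow> 'm \<Rightarrow> 'v::real_vector) \<Rightarrow> nat \<Rightarrow> 'm \<Rightarrow> 'v \<Rightarrow> real" where
  "comp r e a p v = representation ((\<lambda>b. e b p) ` {..<r}) v (e a p)"

definition vector_bundle ::
  "('m::{t2_space,second_countable_topology}, 'v::real_vector) vbundle \<Rightarrow> bool" where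
  "vector_bundle A \<longleftrightarrow> smooth_manifold (base A) \<and> (\<forall>p. subspace (fib A p)) \<and>
     (\<Union>t\<in>frames A. fst t) = UNIV \<and>
     (\<forall>(W, e)\<in>frames A. open W \<and>
        (\<forall>p\<in>W. inj_on (\<lambda>a. e a p) {..<rank A} \<and> independent ((\<lambda>a. e a p) ` {..<rank A}) \<and>
               span ((\<lambda>a. e a p) ` {..<rank A}) = fib A p)) \<and>
     (\<forall>(W, e)\<in>frames A. \<forall>(W', e')\<in>frames A. \<forall>a<rank A. \<forall>b<rank A.
        smooth_on (base A) (W \<inter> W') (\<lambda>p. comp (rank A) e' a p (e b p)))"

definition sections :: "('m, 'v::real_vector) vbundle \<Rightarrow> ('m \<Rightarrow> 'v) set" where
  "sections A = {s. (\<forall>p. s p \<in> fib A p) \<and>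
     (\<forall>(W, e)\<in>frames A. \<forall>a<rank A. smooth_on (base A) W (\<lambda>p. comp (rank A) e a p (s p)))}"

text \<open>
  An endomorphism is a family of maps, of which only the restrictions to the fibres matter.
\<close>

definition endos :: "('m, 'v::real_vector) vbundle \<Rightarrow> ('m \<Rightarrow> 'v \<Rightarrow> 'v) set" where
  "endos A = {N. (\<forall>p. \<forall>u\<in>fib A p. N p u \<in> fib A p \<and> (\<forall>c. N p (c *\<^sub>R u) = c *\<^sub>R N p u) \<and>
                       (\<forall>v\<in>fib A p. N p (u + v) = N p u + N p v)) \<and>
     (\<forall>(W, e)\<in>frames A. \<forall>a<rank A. \<forall>b<rank A.
        smooth_on (base A) W (\<lambda>p. comp (rank A) e a p (N p (e b p))))}"

definition app :: "('m \<Rightarrow> 'v \<Rightarrow> 'v) \<Rightarrow> ('m \<Rightarrow> 'v) \<Rightarrow> 'm \<Rightarrow> 'v" where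
  "app N s = (\<lambda>p. N p (s p))"

definition proportional ::
  "('m, 'v::real_vector) vbundle \<Rightarrow> ('m \<Rightarrow> 'v \<Rightarrow> 'v) \<Rightarrow> ('m \<Rightarrow> 'v \<Rightarrow> 'v) \<Rightarrow> bool" where
  "proportional A N P \<longleftrightarrow> (\<exists>c::real. \<forall>p. \<forall>v\<in>fib A p. N p v = c *\<^sub>R P p v)"

text \<open>
  A linear form on a fibre is represented by its extension by \<open>0\<close> to \<open>'v\<close>; note that
  \<^const>\<open>comp\<close> also vanishes outside the span of the frame.
\<close>

definition dual_space :: "'v::real_vector set \<Rightarrow> ('v \<Rightarrow> real) set" where
  "dual_space V = {\<xi>. (\<forall>u\<in>V. (\<forall>c. \<xi> (c *\<^sub>R u) = c * \<xi> u) \<and> (\<forall>v\<in>V. \<xi> (u + v) = \<xi> u + \<xi> v)) \<and>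
                      (\<forall>v. v \<notin> V \<longrightarrow> \<xi> v = 0)}"

definition dual_frame ::
  "nat \<Rightarrow> (nat \<Rightarrow> 'm \<Rightarrow> 'v::real_vector) \<Rightarrow> nat \<Rightarrow> 'm \<Rightarrow> 'v \<Rightarrow> real" where
  "dual_frame r e a p = comp r e a p"

definition dual_bundle :: "('m, 'v::real_vector) vbundle \<Rightarrow> ('m, 'v \<Rightarrow> real) vbundle" where
  "dual_bundle A = \<lparr>base = base A, fib = (\<lambda>p. dual_space (fib A p)), rank = rank A,
     frames = (\<lambda>(W, e). (W, dual_frame (rank A) e)) ` frames A\<rparr>"

text \<open>The frame \<open>(e\<^sub>0, \<dots>, e\<^bsub>r-1\<^esub>, \<epsilon>\<^sup>0, \<dots>, \<epsilon>\<^bsup>r-1\<^esup>)\<close> of \<open>A \<oplus> A\<^sup>*\<close>.\<close>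

definition double_frame ::
  "nat \<Rightarrow> (nat \<Rightarrow> 'm \<Rightarrow> 'v::real_vector) \<Rightarrow> nat \<Rightarrow> 'm \<Rightarrow> 'v \<times> ('v \<Rightarrow> real)" where
  "double_frame r e a p = (if a < r then (e a p, 0) else (0, dual_frame r e (a - r) p))"

definition double_bundle ::
  "('m, 'v::real_vector) vbundle \<Rightarrow> ('m, 'v \<times> ('v \<Rightarrow> real)) vbundle" where
  "double_bundle A = \<lparr>base = base A, fib = (\<lambda>p. fib A p \<times> dual_space (fib A p)),
     rank = 2 * rank A, frames = (\<lambda>(W, e). (W, double_frame (rank A) e)) ` frames A\<rparr>"

definition pairing :: "'v \<times> ('v \<Rightarrow> real) \<Rightarrow> 'v \<times> ('v \<Rightarrow> real) \<Rightarrow> real" where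
  "pairing u v = snd u (fst v) + snd v (fst u)"

definition transpose_endo :: "('m, 'v::real_vector) vbundle \<Rightarrow> ('m \<Rightarrow> 'v \<Rightarrow> 'v) \<Rightarrow>
    'm \<Rightarrow> ('v \<Rightarrow> real) \<Rightarrow> ('v \<Rightarrow> real)" where
  "transpose_endo A N p \<xi> = (\<lambda>v. if v \<in> fib A p then \<xi> (N p v) else 0)"

definition double_endo :: "('m, 'v::real_vector) vbundle \<Rightarrow> ('m \<Rightarrow> 'v \<Rightarrow> 'v) \<Rightarrow>
    'm \<Rightarrow> 'v \<times> ('v \<Rightarrow> real) \<Rightarrow> 'v \<times> ('v \<Rightarrow> real)" where
  "double_endo A N p u = (N p (fst u), - transpose_endo A N p (snd u))"


section \<open>The graded Poisson algebra of functions on \<open>T\<^sup>*[2]A[1]\<close>\<close>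

text \<open>
  A coordinate system is a pair of a chart and a local frame of \<open>A\<close>, over the intersection of their
  domains. With \<open>r\<close> the rank of \<open>A\<close>, the odd coordinates are numbered uniformly as
  \<open>\<zeta>\<^sub>a = \<theta>\<^sub>a\<close> and \<open>\<zeta>\<^bsub>r+a\<^esub> = \<tau>\<^sup>a\<close> for \<open>a < r\<close>, in accordance with \<^const>\<open>double_frame\<close>.
  A local function \<open>F\<close> is given by its coefficients: \<open>F S m\<close>, a function on the base, is the
  coefficient of \<open>\<zeta>\<^bsub>a1\<^esub> \<cdots> \<zeta>\<^bsub>ak\<^esub> \<cdot> (\<Prod>i\<in>#m. p\<^sub>i)\<close>, where \<open>S = {a1 < \<dots> < ak}\<close>.
\<close>

type_synonym ('m, 'v) coords = "'m chart \<times> ('m, 'v) frame"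
type_synonym 'm gfun = "nat set \<Rightarrow> nat multiset \<Rightarrow> 'm \<Rightarrow> real"
type_synonym ('m, 'v) gfamily = "('m, 'v) coords \<Rightarrow> 'm gfun"

definition coord_systems :: "('m, 'v) vbundle \<Rightarrow> ('m, 'v) coords set" where
  "coord_systems A = charts (base A) \<times> frames A"

definition cdom :: "('m, 'v) coords \<Rightarrow> 'm set" where
  "cdom \<kappa> = fst (fst \<kappa>) \<inter> fst (snd \<kappa>)"

definition zeta :: "nat \<Rightarrow> 'm gfun" where
  "zeta a = (\<lambda>S m p. if S = {a} \<and> m = {#} then 1 else 0)"

definition mom :: "nat \<Rightarrow> 'm gfun" where
  "mom i = (\<lambda>S m p. if S = {} \<and> m = {#i#} then 1 else 0)"

definition gone :: "'m gfun" where
  "gone = (\<lambda>S m p. if S = {} \<and> m = {#} then 1 else 0)"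

definition gscale :: "('m \<Rightarrow> real) \<Rightarrow> 'm gfun \<Rightarrow> 'm gfun" where
  "gscale f F = (\<lambda>S m p. f p * F S m p)"

text \<open>The product; the sign is the one of the shuffle sorting \<open>S1\<close> followed by \<open>S - S1\<close>.\<close>

definition gmul :: "'m gfun \<Rightarrow> 'm gfun \<Rightarrow> 'm gfun" where
  "gmul F G = (\<lambda>S m p. \<Sum>S1\<in>Pow S. \<Sum>m1\<in>{m1. m1 \<subseteq># m}.
     (-1) ^ card {(a, b). a \<in> S1 \<and> b \<in> S - S1 \<and> b < a} * F S1 m1 p * G (S - S1) (m - m1) p)"

definition dmom :: "nat \<Rightarrow> 'm gfun \<Rightarrow> 'm gfun" where
  "dmom i F = (\<lambda>S m p. real (count m i + 1) * F S (add_mset i m) p)"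

definition dpos :: "'m chart \<Rightarrow> nat \<Rightarrow> 'm gfun \<Rightarrow> 'm gfun" where
  "dpos c i F = (\<lambda>S m. coord_deriv c i (F S m))"

definition dzeta_left :: "nat \<Rightarrow> 'm gfun \<Rightarrow> 'm gfun" where
  "dzeta_left a F = (\<lambda>S m p. if a \<in> S then 0 else (-1) ^ card {b\<in>S. b < a} * F (insert a S) m p)"

definition dzeta_right :: "nat \<Rightarrow> 'm gfun \<Rightarrow> 'm gfun" where
  "dzeta_right a F = (\<lambda>S m p. if a \<in> S then 0 else (-1) ^ card {b\<in>S. a < b} * F (insert a S) m p)"

text \<open>
  The unique Poisson bracket with \<open>{x\<^sup>i, p\<^sub>j} = \<delta>\<close>, \<open>{\<tau>\<^sup>a, \<theta>\<^sub>b} = \<delta>\<close> and zero on the other pairs of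
  coordinates; it satisfies \<open>{F, G} = - (-1)\<^bsup>|F||G|\<^esup> {G, F}\<close> and is a derivation in the second argument,
  \<open>{F, G H} = {F, G} H + (-1)\<^bsup>|F||G|\<^esup> G {F, H}\<close>.
\<close>

definition local_bracket ::
  "('m, 'v) vbundle \<Rightarrow> ('m, 'v) coords \<Rightarrow> 'm gfun \<Rightarrow> 'm gfun \<Rightarrow> 'm gfun" where
  "local_bracket A \<kappa> F G =
     (\<Sum>i<mdim (base A). gmul (dpos (fst \<kappa>) i F) (dmom i G) - gmul (dmom i F) (dpos (fst \<kappa>) i G)) +
     (\<Sum>a<rank A. gmul (dzeta_right (rank A + a) F) (dzeta_left a G) +
                  gmul (dzeta_right a F) (dzeta_left (rank A + a) G))"

definition big_bracket ::
  "('m, 'v) vbundle \<Rightarrow> ('m, 'v) gfamily \<Rightarrow> ('m, 'v) gfamily \<Rightarrow> ('m, 'v) gfamily" where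
  "big_bracket A F G = (\<lambda>\<kappa>. local_bracket A \<kappa> (F \<kappa>) (G \<kappa>))"

text \<open>
  Coordinate changes. The coordinates of \<open>\<kappa>\<close> are expressed in those of \<open>\<kappa>'\<close>, marked by a prime:
  \<open>\<zeta>\<^sub>b\<close> transforms as the frame of \<open>A \<oplus> A\<^sup>*\<close>, and, as
  \<open>\<tau>'\<^sup>a = \<Sum>b. T\<^sup>a\<^sub>b \<tau>\<^sup>b\<close> with \<open>e\<^sub>b = \<Sum>a. T\<^sup>a\<^sub>b e'\<^sub>a\<close>, the cotangent lift is
  \<open>p\<^sub>i = (\<Sum>j. (\<partial>x'\<^sup>j / \<partial>x\<^sup>i) p'\<^sub>j) + (\<Sum>a b. (\<partial>T\<^sup>a\<^sub>b / \<partial>x\<^sup>i) \<theta>'\<^sub>a \<tau>\<^sup>b)\<close>; here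
  \<open>\<tau>\<^sup>b = \<Sum>d. \<epsilon>\<^sup>b(e'\<^sub>d) \<tau>'\<^sup>d\<close>. This substitution preserves the brackets.
\<close>

definition zeta_change ::
  "('m, 'v::real_vector) vbundle \<Rightarrow> ('m, 'v) coords \<Rightarrow> ('m, 'v) coords \<Rightarrow> nat \<Rightarrow> 'm gfun" where
  "zeta_change A \<kappa> \<kappa>' b = (let r = rank A; E = double_frame r (snd (snd \<kappa>)); E' = double_frame r (snd (snd \<kappa>'))
     in \<Sum>a<2 * r. gscale (\<lambda>p. comp (2 * r) E' a p (E b p)) (zeta a))"

definition mom_change ::
  "('m, 'v::real_vector) vbundle \<Rightarrow> ('m, 'v) coords \<Rightarrow> ('m, 'v) coords \<Rightarrow> nat \<Rightarrow> 'm gfun" where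
  "mom_change A \<kappa> \<kappa>' i = (let r = rank A; c = fst \<kappa>; e = snd (snd \<kappa>); e' = snd (snd \<kappa>') in
     (\<Sum>j<mdim (base A). gscale (coord_deriv c i (\<lambda>q. snd (fst \<kappa>') q j)) (mom j)) +
     (\<Sum>a<r. \<Sum>b<r. \<Sum>d<r.
        gscale (\<lambda>p. coord_deriv c i (\<lambda>q. comp r e' a q (e b q)) p * comp r e b p (e' d p))
          (gmul (zeta a) (zeta (r + d)))))"

definition gprod :: "'m gfun list \<Rightarrow> 'm gfun" where
  "gprod Fs = foldr gmul Fs gone"

definition monomials :: "('m, 'v) vbundle \<Rightarrow> nat \<Rightarrow> (nat set \<times> nat multiset) set" where
  "monomials A k = {(S, m). S \<subseteq> {..<2 * rank A} \<and> set_mset m \<subseteq> {..<mdim (base A)} \<and>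
                           card S + 2 * size m = k}"

definition change_coords :: "('m, 'v::real_vector) vbundle \<Rightarrow> nat \<Rightarrow> ('m, 'v) coords \<Rightarrow>
    ('m, 'v) coords \<Rightarrow> 'm gfun \<Rightarrow> 'm gfun" where
  "change_coords A k \<kappa> \<kappa>' F = (\<Sum>(S, m)\<in>monomials A k. gscale (F S m)
     (gmul (gprod (map (zeta_change A \<kappa> \<kappa>') (sorted_list_of_set S)))
           (gprod (map (mom_change A \<kappa> \<kappa>') (sorted_list_of_multiset m)))))"

text \<open>
  \<open>\<A>\<^sup>k\<close>: the families of local functions of degree \<open>k\<close> that match under coordinate changes. The value
  of such a family at \<open>\<kappa>\<close> is only meaningful over \<open>cdom \<kappa>\<close>.
\<close>

definition gfunctions :: "('m, 'v::real_vector) vbundle \<Rightarrow> nat \<Rightarrow> ('m, 'v) gfamily set" where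
  "gfunctions A k = {F.
     (\<forall>\<kappa>\<in>coord_systems A. \<forall>S m. smooth_on (base A) (cdom \<kappa>) (F \<kappa> S m) \<and>
        ((S, m) \<notin> monomials A k \<longrightarrow> (\<forall>p\<in>cdom \<kappa>. F \<kappa> S m p = 0))) \<and>
     (\<forall>\<kappa>\<in>coord_systems A. \<forall>\<kappa>'\<in>coord_systems A. \<forall>p\<in>cdom \<kappa> \<inter> cdom \<kappa>'. \<forall>S m.
        F \<kappa>' S m p = change_coords A k \<kappa> \<kappa>' (F \<kappa>) S m p)}"

definition gzero :: "('m, 'v) vbundle \<Rightarrow> ('m, 'v) gfamily \<Rightarrow> bool" where
  "gzero A F \<longleftrightarrow> (\<forall>\<kappa>\<in>coord_systems A. \<forall>p\<in>cdom \<kappa>. \<forall>S m. F \<kappa> S m p = 0)"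

text \<open>
  The identification of \<open>\<Gamma>(A \<oplus> A\<^sup>*)\<close> with \<open>\<A>\<^sup>1\<close> and its inverse. The latter is computed in a coordinate
  system around each point, whose choice is immaterial for elements of \<open>\<A>\<^sup>1\<close>.
\<close>

definition of_section ::
  "('m, 'v::real_vector) vbundle \<Rightarrow> ('m \<Rightarrow> 'v \<times> ('v \<Rightarrow> real)) \<Rightarrow> ('m, 'v) gfamily" where
  "of_section A u = (\<lambda>\<kappa>. \<Sum>a<2 * rank A.
     gscale (\<lambda>p. comp (2 * rank A) (double_frame (rank A) (snd (snd \<kappa>))) a p (u p)) (zeta a))"

definition to_section ::
  "('m, 'v::real_vector) vbundle \<Rightarrow> ('m, 'v) gfamily \<Rightarrow> 'm \<Rightarrow> 'v \<times> ('v \<Rightarrow> real)" where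
  "to_section A F = (\<lambda>p. let \<kappa> = (SOME \<kappa>. \<kappa> \<in> coord_systems A \<and> p \<in> cdom \<kappa>) in
     \<Sum>a<2 * rank A. F \<kappa> {a} {#} p *\<^sub>R double_frame (rank A) (snd (snd \<kappa>)) a p)"

definition derived_bracket :: "('m, 'v::real_vector) vbundle \<Rightarrow> ('m, 'v) gfamily \<Rightarrow>
    ('m \<Rightarrow> 'v \<times> ('v \<Rightarrow> real)) \<Rightarrow> ('m \<Rightarrow> 'v \<times> ('v \<Rightarrow> real)) \<Rightarrow> 'm \<Rightarrow> 'v \<times> ('v \<Rightarrow> real)" where
  "derived_bracket A \<Theta> u v =
     to_section A (big_bracket A (big_bracket A (of_section A u) \<Theta>) (of_section A v))"


section \<open>Lie bialgebroids and their doubles\<close>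

definition only_monomials ::
  "('m, 'v) vbundle \<Rightarrow> (nat set \<times> nat multiset) set \<Rightarrow> ('m, 'v) gfamily \<Rightarrow> bool" where
  "only_monomials A Q F \<longleftrightarrow>
     (\<forall>\<kappa>\<in>coord_systems A. \<forall>p\<in>cdom \<kappa>. \<forall>S m. (S, m) \<notin> Q \<longrightarrow> F \<kappa> S m p = 0)"

text \<open>Terms \<open>\<tau>\<^sup>a p\<^sub>i\<close> and \<open>\<tau>\<^sup>a \<tau>\<^sup>b \<theta>\<^sub>c\<close>.\<close>

definition lie_algebroid :: "('m, 'v::real_vector) vbundle \<Rightarrow> ('m, 'v) gfamily \<Rightarrow> bool" where
  "lie_algebroid A \<mu> \<longleftrightarrow> \<mu> \<in> gfunctions A 3 \<and>
     (let r = rank A in only_monomials A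
       ({({r + a}, {#i#}) |a i. True} \<union> {({r + a, r + b, c}, {#}) |a b c. a < b \<and> c < r}) \<mu>) \<and>
     gzero A (big_bracket A \<mu> \<mu>)"

text \<open>Terms \<open>\<theta>\<^sub>a p\<^sub>i\<close> and \<open>\<theta>\<^sub>a \<theta>\<^sub>b \<tau>\<^sup>c\<close>.\<close>

definition dual_lie_algebroid :: "('m, 'v::real_vector) vbundle \<Rightarrow> ('m, 'v) gfamily \<Rightarrow> bool" where
  "dual_lie_algebroid A \<gamma> \<longleftrightarrow> \<gamma> \<in> gfunctions A 3 \<and>
     (let r = rank A in only_monomials A
       ({({a}, {#i#}) |a i. a < r} \<union> {({a, b, r + c}, {#}) |a b c. a < b \<and> b < r}) \<gamma>) \<and>
     gzero A (big_bracket A \<gamma> \<gamma>)"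

definition lie_bracket :: "('m, 'v::real_vector) vbundle \<Rightarrow> ('m, 'v) gfamily \<Rightarrow>
    ('m \<Rightarrow> 'v) \<Rightarrow> ('m \<Rightarrow> 'v) \<Rightarrow> 'm \<Rightarrow> 'v" where
  "lie_bracket A \<mu> X Y = fst \<circ> derived_bracket A \<mu> (\<lambda>p. (X p, 0)) (\<lambda>p. (Y p, 0))"

definition dual_lie_bracket :: "('m, 'v::real_vector) vbundle \<Rightarrow> ('m, 'v) gfamily \<Rightarrow>
    ('m \<Rightarrow> 'v \<Rightarrow> real) \<Rightarrow> ('m \<Rightarrow> 'v \<Rightarrow> real) \<Rightarrow> 'm \<Rightarrow> 'v \<Rightarrow> real" where
  "dual_lie_bracket A \<gamma> \<xi> \<eta> = snd \<circ> derived_bracket A \<gamma> (\<lambda>p. (0, \<xi> p)) (\<lambda>p. (0, \<eta> p))"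

definition lie_bialgebroid ::
  "('m, 'v::real_vector) vbundle \<Rightarrow> ('m, 'v) gfamily \<Rightarrow> ('m, 'v) gfamily \<Rightarrow> bool" where
  "lie_bialgebroid A \<mu> \<gamma> \<longleftrightarrow>
     lie_algebroid A \<mu> \<and> dual_lie_algebroid A \<gamma> \<and> gzero A (big_bracket A \<mu> \<gamma>)"

text \<open>Courant algebroid structures on \<open>A \<oplus> A\<^sup>*\<close>, with Dorfman bracket \<open>derived_bracket A \<Theta>\<close>.\<close>

definition courant_algebroid :: "('m, 'v::real_vector) vbundle \<Rightarrow> ('m, 'v) gfamily \<Rightarrow> bool" where
  "courant_algebroid A \<Theta> \<longleftrightarrow> \<Theta> \<in> gfunctions A 3 \<and> gzero A (big_bracket A \<Theta> \<Theta>)"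

definition irreducible_courant_algebroid ::
  "('m, 'v::real_vector) vbundle \<Rightarrow> ('m, 'v) gfamily \<Rightarrow> bool" where
  "irreducible_courant_algebroid A \<Theta> \<longleftrightarrow> courant_algebroid A \<Theta> \<and>
     (let E = double_bundle A; br = derived_bracket A \<Theta> in
      \<forall>\<phi>\<in>endos E.
        (\<forall>p. \<forall>u\<in>fib E p. \<forall>v\<in>fib E p. pairing (\<phi> p u) v = pairing u (\<phi> p v)) \<longrightarrow>
        (\<forall>u\<in>sections E. \<forall>v\<in>sections E.
           br u (app \<phi> v) = app \<phi> (br u v) \<and> br (app \<phi> u) v = app \<phi> (br u v)) \<longrightarrow>
        proportional E \<phi> (\<lambda>p v. v))"

definition torsion :: "(('m \<Rightarrow> 'v) \<Rightarrow> ('m \<Rightarrow> 'v) \<Rightarrow> 'm \<Rightarrow> 'v) \<Rightarrow> ('m \<Rightarrow> 'v \<Rightarrow> 'v) \<Rightarrow>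
    ('m \<Rightarrow> 'v) \<Rightarrow> ('m \<Rightarrow> 'v) \<Rightarrow> 'm \<Rightarrow> 'v::real_vector" where
  "torsion br P u v =
     br (app P u) (app P v) - app P (br (app P u) v + br u (app P v) - app P (br u v))"

definition nijenhuis_tensor :: "('m, 'v::real_vector) vbundle \<Rightarrow> ('m, 'v) gfamily \<Rightarrow>
    ('m \<Rightarrow> 'v \<times> ('v \<Rightarrow> real) \<Rightarrow> 'v \<times> ('v \<Rightarrow> real)) \<Rightarrow> bool" where
  "nijenhuis_tensor A \<Theta> \<N> \<longleftrightarrow> (let E = double_bundle A in
     \<N> \<in> endos E \<and>
     (\<forall>p. \<forall>u\<in>fib E p. \<forall>v\<in>fib E p. pairing (\<N> p u) v + pairing u (\<N> p v) = 0) \<and>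
     (\<forall>u\<in>sections E. \<forall>v\<in>sections E. torsion (derived_bracket A \<Theta>) \<N> u v = 0))"

definition almost_cps_structure ::
  "('m, 'v::real_vector) vbundle \<Rightarrow> ('m \<Rightarrow> 'v \<Rightarrow> 'v) \<Rightarrow> bool" where
  "almost_cps_structure B P \<longleftrightarrow> P \<in> endos B \<and>
     (\<exists>\<epsilon>\<in>{-1, 1, 0::real}. \<forall>p. \<forall>v\<in>fib B p. P p (P p v) = \<epsilon> *\<^sub>R v)"

definition cps_structure :: "('m, 'v::real_vector) vbundle \<Rightarrow>
    (('m \<Rightarrow> 'v) \<Rightarrow> ('m \<Rightarrow> 'v) \<Rightarrow> 'm \<Rightarrow> 'v) \<Rightarrow> ('m \<Rightarrow> 'v \<Rightarrow> 'v) \<Rightarrow> bool" where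
  "cps_structure B br P \<longleftrightarrow> almost_cps_structure B P \<and>
     (\<forall>u\<in>sections B. \<forall>v\<in>sections B. torsion br P u v = 0)"

end

theory Submission
  imports Defs "HOL-Computational_Algebra.Polynomial"
begin

text \<open>
  Let \<open>\<N>\<close> be a skew-symmetric endomorphism of \<open>A \<oplus> A\<^sup>*\<close> whose torsion for the Dorfman bracket vanishes. The
  core of the argument is that \<open>\<N>\<^sup>2\<close>, which is symmetric, commutes with the bracket in both arguments
  (\<open>nijenhuis_square_commutes\<close>). This follows from two identities of the Dorfman bracket,
  \<open>\<langle>[u, v], w\<rangle> + \<langle>v, [u, w]\<rangle> = \<rho>(u)\<langle>v, w\<rangle>\<close> (\<open>derived_bracket_metric\<close>) and \<open>[u, v] + [v, u] = D\<langle>u, v\<rangle>\<close>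
  (\<open>derived_bracket_symmetric_part\<close>), where \<open>\<rho>(u) f\<close> and \<open>D f\<close> depend on the function \<open>f\<close> linearly.
  Irreducibility then gives \<open>\<N>\<^sup>2 = c Id\<close> for a constant \<open>c\<close>. If \<open>\<N>\<close> has the diagonal blocks \<open>N\<close> and \<open>- \<^sup>tN\<close>,
  then \<open>N\<^sup>2 = c Id\<close> and \<open>(\<^sup>tN)\<^sup>2 = c Id\<close>, and division by \<open>sqrt \<bar>c\<bar>\<close> makes both squares \<open>Id\<close>, \<open>- Id\<close> or \<open>0\<close>
  (\<open>proportional_to_cps_structure\<close>). The torsion of \<open>N\<close> vanishes because it is the component in \<open>A\<close> of the
  torsion of \<open>\<N>\<close> on sections of \<open>A\<close>: by the shape of the terms of \<open>\<gamma>\<close>, the bracket of two sections of \<open>A\<close>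
  for \<open>\<mu> + \<gamma>\<close> and that for \<open>\<mu>\<close> have the same component in \<open>A\<close>. The same holds for \<open>A\<^sup>*\<close> with \<open>\<mu>\<close> and \<open>\<gamma>\<close>
  exchanged.

  The two identities are verified in coordinates. At a point \<open>p\<close> the derived bracket is computed in one
  coordinate system, and the big bracket gives its components explicitly (\<open>local_bracket_dorfman_comp\<close>); the
  identities are consequences of the antisymmetry of the coefficients of \<open>\<Theta>\<close> in the odd coordinates, and of
  the product rule applied to \<open>\<langle>u, v\<rangle> = \<Sum>\<^sub>a u\<^sub>a v\<^sub>a\<^sub>*\<close>, where \<open>a\<^sup>*\<close> is the index of the coordinate conjugate to
  \<open>\<zeta>\<^sub>a\<close>.

  To pass from \<open>\<langle>\<N>\<^sup>2 [u, v] - [u, \<N>\<^sup>2 v], w\<rangle> = 0\<close> for all global sections \<open>w\<close> to the vanishing of the first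
  argument, global sections with prescribed values at a point are needed (\<open>section_through_frame\<close>). They
  are obtained from a local frame and a bump function, a product of the functions \<open>exp(-1/t)\<close> of affine
  functions of the coordinates of a chart.
\<close>

section \<open>Smooth functions of several variables\<close>

lemma openin_Euclidean_space_iff:
  "openin (Euclidean_space n) V \<longleftrightarrow> (\<exists>T. open T \<and> V = T \<inter> {x. \<forall>i\<ge>n. x i = 0})"
  by (simp add: Euclidean_space_def openin_subtopology euclidean_product_topology)

lemma continuous_on_fun_upd: "continuous_on UNIV (\<lambda>t. (x::nat \<Rightarrow> real)(i := t))"
proof (rule continuous_on_coordinatewise_then_product)
  fix j show "continuous_on UNIV (\<lambda>t. (x(i := t)) j)"
    by (cases "j = i") auto
qed

lemma eventually_fun_upd_in:
  assumes "openin (Euclidean_space n) V" "x \<in> V" "i < n"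
  shows "\<forall>\<^sub>F t in nhds (x i). x(i := t) \<in> V"
proof -
  obtain T where T: "open T" "V = T \<inter> {x. \<forall>i\<ge>n. x i = 0}"
    using assms(1) by (auto simp: openin_Euclidean_space_iff)
  have "open ((\<lambda>t. x(i := t)) -` T)"
    using continuous_on_fun_upd[of x i] T(1) by (simp add: continuous_on_open_vimage)
  moreover have "x i \<in> (\<lambda>t. x(i := t)) -` T" using assms(2) T(2) by simp
  ultimately have "\<forall>\<^sub>F t in nhds (x i). t \<in> (\<lambda>t. x(i := t)) -` T"
    by (rule eventually_nhds_in_open)
  then show ?thesis
    by (rule eventually_mono) (use assms(2,3) T(2) in auto)
qed

text \<open>The partial derivative in direction \<open>i\<close>, whose value is \<open>pderivative i f x\<close>, exists.\<close>

definition pdiff :: "nat \<Rightarrow> ((nat \<Rightarrow> real) \<Rightarrow> real) \<Rightarrow> (nat \<Rightarrow> real) \<Rightarrow> bool" where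
  "pdiff i f x \<longleftrightarrow> (\<lambda>t. f (x(i := t))) field_differentiable at (x i)"

lemma pdiff_DERIV: "pdiff i f x \<Longrightarrow> ((\<lambda>t. f (x(i := t))) has_field_derivative pderivative i f x) (at (x i))"
  unfolding pdiff_def pderivative_def by (simp add: field_differentiable_derivI)

lemma pderivative_cong_pdiff:
  assumes "openin (Euclidean_space n) V" "x \<in> V" "i < n" "\<And>y. y \<in> V \<Longrightarrow> f y = g y"
  shows "pderivative i f x = pderivative i g x" "pdiff i f x \<longleftrightarrow> pdiff i g x"
proof -
  have *: "\<forall>\<^sub>F t in nhds (x i). f (x(i := t)) = g (x(i := t))"
    using eventually_fun_upd_in[OF assms(1-3)] by (rule eventually_mono) (rule assms(4))
  show "pderivative i f x = pderivative i g x"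
    unfolding pderivative_def by (rule deriv_cong_ev[OF *]) simp
  have "((\<lambda>t. f (x(i := t))) has_field_derivative D) (at (x i)) \<longleftrightarrow>
        ((\<lambda>t. g (x(i := t))) has_field_derivative D) (at (x i))" for D
    by (rule DERIV_cong_ev[OF refl * refl])
  then show "pdiff i f x \<longleftrightarrow> pdiff i g x"
    by (simp add: pdiff_def field_differentiable_def)
qed

lemma Ck_on_Suc_iff:
  "Ck_on n (Suc k) V f \<longleftrightarrow> continuous_on V f \<and>
     (\<forall>i<n. (\<forall>x\<in>V. pdiff i f x) \<and> Ck_on n k V (pderivative i f))"
  by (simp add: pdiff_def)

declare Ck_on.simps(2) [simp del]

lemma Ck_on_cong:
  assumes "openin (Euclidean_space n) V" "\<And>y. y \<in> V \<Longrightarrow> f y = g y" "Ck_on n k V f"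
  shows "Ck_on n k V g"
  using assms(2,3)
proof (induction k arbitrary: f g)
  case 0
  then show ?case using continuous_on_cong[OF refl, of V f g] by (metis Ck_on.simps(1))
next
  case (Suc k)
  have f: "continuous_on V f" "\<And>i x. i < n \<Longrightarrow> x \<in> V \<Longrightarrow> pdiff i f x"
    "\<And>i. i < n \<Longrightarrow> Ck_on n k V (pderivative i f)"
    using Suc.prems(2) by (auto simp: Ck_on_Suc_iff)
  have "continuous_on V g" using Suc.prems(1) f(1) continuous_on_cong[OF refl, of V f g] by blast
  moreover have "pdiff i g x" if "i < n" "x \<in> V" for i x
    using pderivative_cong_pdiff(2)[OF assms(1) that(2,1), of f g] Suc.prems(1) f(2)[OF that] by blast
  moreover have "Ck_on n k V (pderivative i g)" if "i < n" for i
    by (rule Suc.IH[of "pderivative i f", OF _ f(3)[OF that]])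
      (rule pderivative_cong_pdiff(1)[OF assms(1) _ that], auto intro: Suc.prems(1))
  ultimately show ?case by (simp add: Ck_on_Suc_iff)
qed

lemma Ck_on_subset: "Ck_on n k V f \<Longrightarrow> U \<subseteq> V \<Longrightarrow> Ck_on n k U f"
proof (induction k arbitrary: f)
  case 0 then show ?case by (auto intro: continuous_on_subset)
next
  case (Suc k) then show ?case unfolding Ck_on_Suc_iff by (meson continuous_on_subset subsetD)
qed

lemma Ck_on_SucD: "Ck_on n (Suc k) V f \<Longrightarrow> Ck_on n k V f"
proof (induction k arbitrary: f)
  case 0 then show ?case by (simp add: Ck_on_Suc_iff)
next
  case (Suc k)
  then show ?case by (subst Ck_on_Suc_iff) (auto simp: Ck_on_Suc_iff[of _ "Suc k"])
qed

text \<open>Being \<open>C\<^sup>k\<close> is local, which allows functions to be glued over an open cover.\<close>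

lemma Ck_on_local:
  assumes "\<And>x. x \<in> V \<Longrightarrow> \<exists>U. x \<in> U \<and> U \<subseteq> V \<and> openin (Euclidean_space n) U \<and> Ck_on n k U f"
  shows "Ck_on n k V f"
  using assms
proof (induction k arbitrary: f)
  case 0
  show ?case unfolding Ck_on.simps continuous_on_eq_continuous_within
  proof
    fix x assume x: "x \<in> V"
    obtain U where U: "x \<in> U" "U \<subseteq> V" "openin (Euclidean_space n) U" "continuous_on U f"
      using 0[OF x] by auto
    obtain T where T: "open T" "U = T \<inter> {x. \<forall>i\<ge>n. x i = 0}"
      using U(3) by (auto simp: openin_Euclidean_space_iff)
    have sub: "V \<subseteq> {x. \<forall>i\<ge>n. x i = 0}"
    proof
      fix y assume "y \<in> V"
      from 0[OF this] obtain U' where U': "y \<in> U'" "openin (Euclidean_space n) U'" by auto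
      then show "y \<in> {x. \<forall>i\<ge>n. x i = 0}" by (auto simp: openin_Euclidean_space_iff)
    qed
    have "at x within U = at x within V"
      by (rule at_within_nhd[of x T]) (use U T sub in auto)
    then show "continuous (at x within V) f"
      using U(4)[unfolded continuous_on_def, rule_format, OF U(1)] unfolding continuous_within by simp
  qed
next
  case (Suc k)
  have "Ck_on n k V f"
  proof (rule Suc.IH)
    fix x assume "x \<in> V"
    from Suc.prems[OF this] show "\<exists>U. x \<in> U \<and> U \<subseteq> V \<and> openin (Euclidean_space n) U \<and> Ck_on n k U f"
      by (auto dest!: Ck_on_SucD)
  qed
  then have "continuous_on V f" by (cases k) (simp_all add: Ck_on_Suc_iff)
  moreover have "pdiff i f x" if "i < n" "x \<in> V" for i x
    using Suc.prems[OF that(2)] that by (auto simp: Ck_on_Suc_iff)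
  moreover have "Ck_on n k V (pderivative i f)" if "i < n" for i
  proof (rule Suc.IH)
    fix x assume "x \<in> V"
    from Suc.prems[OF this] obtain U where "x \<in> U" "U \<subseteq> V" "openin (Euclidean_space n) U" "Ck_on n (Suc k) U f" by blast
    then show "\<exists>U. x \<in> U \<and> U \<subseteq> V \<and> openin (Euclidean_space n) U \<and> Ck_on n k U (pderivative i f)"
      using that by (auto simp: Ck_on_Suc_iff)
  qed
  ultimately show ?case by (simp add: Ck_on_Suc_iff)
qed

lemma pdiff_add:
  assumes "pdiff i f x" "pdiff i g x"
  shows "pdiff i (\<lambda>x. f x + g x) x" "pderivative i (\<lambda>x. f x + g x) x = pderivative i f x + pderivative i g x"
  using DERIV_add[OF pdiff_DERIV[OF assms(1)] pdiff_DERIV[OF assms(2)]]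
  by (auto simp: pdiff_def field_differentiable_def pderivative_def intro: DERIV_imp_deriv)

lemma pdiff_mult:
  assumes "pdiff i f x" "pdiff i g x"
  shows "pdiff i (\<lambda>x. f x * g x) x"
    "pderivative i (\<lambda>x. f x * g x) x = pderivative i f x * g x + f x * pderivative i g x"
  using DERIV_mult[OF pdiff_DERIV[OF assms(1)] pdiff_DERIV[OF assms(2)]]
  by (auto simp: pdiff_def field_differentiable_def pderivative_def mult.commute add.commute dest: DERIV_imp_deriv)

lemma pdiff_const: "pdiff i (\<lambda>x. c) x" "pderivative i (\<lambda>x. c) x = 0"
  by (simp_all add: pdiff_def pderivative_def)

lemma pdiff_sum:
  assumes "\<And>a. a \<in> I \<Longrightarrow> pdiff i (f a) x"
  shows "pdiff i (\<lambda>x. \<Sum>a\<in>I. f a x) x \<and> pderivative i (\<lambda>x. \<Sum>a\<in>I. f a x) x = (\<Sum>a\<in>I. pderivative i (f a) x)"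
  using assms by (induction I rule: infinite_finite_induct) (simp_all add: pdiff_const pdiff_add)

lemma Ck_on_const: "Ck_on n k V (\<lambda>x. c)"
proof (induction k arbitrary: c)
  case (Suc k)
  have "pderivative i (\<lambda>x. c) = (\<lambda>x. 0)" for i by (rule ext) (rule pdiff_const)
  with Suc show ?case by (simp add: Ck_on_Suc_iff pdiff_const)
qed simp

lemma Ck_on_add:
  assumes "openin (Euclidean_space n) V" "Ck_on n k V f" "Ck_on n k V g"
  shows "Ck_on n k V (\<lambda>x. f x + g x)"
  using assms(2,3)
proof (induction k arbitrary: f g)
  case 0 then show ?case by (simp add: continuous_on_add)
next
  case (Suc k)
  have "Ck_on n k V (pderivative i (\<lambda>x. f x + g x))" if "i < n" for i
  proof (rule Ck_on_cong[OF assms(1)])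
    show "Ck_on n k V (\<lambda>x. pderivative i f x + pderivative i g x)"
      using Suc.prems that by (intro Suc.IH) (auto simp: Ck_on_Suc_iff)
  qed (use Suc.prems that in \<open>simp add: Ck_on_Suc_iff pdiff_add\<close>)
  with Suc.prems show ?case by (auto simp: Ck_on_Suc_iff continuous_on_add pdiff_add)
qed

lemma Ck_on_mult:
  assumes "openin (Euclidean_space n) V" "Ck_on n k V f" "Ck_on n k V g"
  shows "Ck_on n k V (\<lambda>x. f x * g x)"
  using assms(2,3)
proof (induction k arbitrary: f g)
  case 0 then show ?case by (simp add: continuous_on_mult)
next
  case (Suc k)
  have "Ck_on n k V (pderivative i (\<lambda>x. f x * g x))" if "i < n" for i
  proof (rule Ck_on_cong[OF assms(1)])
    show "Ck_on n k V (\<lambda>x. pderivative i f x * g x + f x * pderivative i g x)"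
      using Suc.prems[THEN Ck_on_SucD] Suc.prems that
      by (intro Ck_on_add[OF assms(1)] Suc.IH) (auto simp: Ck_on_Suc_iff[of _ k])
  qed (use Suc.prems that in \<open>simp add: Ck_on_Suc_iff pdiff_mult\<close>)
  with Suc.prems show ?case by (auto simp: Ck_on_Suc_iff continuous_on_mult pdiff_mult)
qed

text \<open>Composition with smooth functions of one real variable, given as a sequence \<open>D\<close> in which each member
  is the derivative of the preceding one. As bump functions are built from such functions and from the coordinates, this
  instance of the chain rule suffices to show that they are smooth in every chart.\<close>

lemma Ck_on_compose_real:
  assumes V: "openin (Euclidean_space n) V"
    and D: "\<And>j t. (D j has_real_derivative D (Suc j) t) (at t)"
    and u: "Ck_on n k V u"
  shows "Ck_on n k V (\<lambda>x. D j (u x))"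
  using u
proof (induction k arbitrary: j)
  case 0
  have "continuous_on UNIV (D j)"
    by (rule DERIV_continuous_on[OF has_field_derivative_at_within[OF D]])
  then show ?case using 0 by (auto intro: continuous_on_compose2)
next
  case (Suc k)
  have DER: "((\<lambda>t. D j (u (x(i := t)))) has_field_derivative D (Suc j) (u x) * pderivative i u x) (at (x i))"
    if "i < n" "x \<in> V" for i x
  proof -
    have "pdiff i u x" using Suc.prems that by (auto simp: Ck_on_Suc_iff)
    from DERIV_chain2[OF _ pdiff_DERIV[OF this], of "D j" "D (Suc j) (u x)"] D
    show ?thesis by simp
  qed
  have "Ck_on n k V (pderivative i (\<lambda>x. D j (u x)))" if "i < n" for i
  proof (rule Ck_on_cong[OF V])
    show "Ck_on n k V (\<lambda>x. D (Suc j) (u x) * pderivative i u x)"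
      using Suc.prems[THEN Ck_on_SucD] Suc.prems that
      by (intro Ck_on_mult[OF V] Suc.IH) (auto simp: Ck_on_Suc_iff[of _ k])
  qed (use DER[THEN DERIV_imp_deriv] that in \<open>simp add: pderivative_def\<close>)
  moreover have "continuous_on V (\<lambda>x. D j (u x))"
  proof -
    have "continuous_on UNIV (D j)"
      by (rule DERIV_continuous_on[OF has_field_derivative_at_within[OF D]])
    then show ?thesis using Suc.prems by (auto simp: Ck_on_Suc_iff intro: continuous_on_compose2)
  qed
  ultimately show ?case using DER by (auto simp: Ck_on_Suc_iff pdiff_def field_differentiable_def)
qed

lemma Cinf_on_pdiff: "Cinf_on n V f \<Longrightarrow> i < n \<Longrightarrow> x \<in> V \<Longrightarrow> pdiff i f x"
  unfolding Cinf_on_def by (meson Ck_on_Suc_iff)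

lemma Cinf_on_subset: "Cinf_on n V f \<Longrightarrow> U \<subseteq> V \<Longrightarrow> Cinf_on n U f"
  by (auto simp: Cinf_on_def intro: Ck_on_subset)

lemma Cinf_on_cong:
  "openin (Euclidean_space n) V \<Longrightarrow> (\<And>y. y \<in> V \<Longrightarrow> f y = g y) \<Longrightarrow> Cinf_on n V f \<Longrightarrow> Cinf_on n V g"
  unfolding Cinf_on_def using Ck_on_cong by blast

lemma Cinf_on_local:
  "(\<And>x. x \<in> V \<Longrightarrow> \<exists>U. x \<in> U \<and> U \<subseteq> V \<and> openin (Euclidean_space n) U \<and> Cinf_on n U f) \<Longrightarrow> Cinf_on n V f"
  unfolding Cinf_on_def by (intro allI Ck_on_local) blast

lemma Cinf_on_const: "Cinf_on n V (\<lambda>x. c)"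
  by (simp add: Cinf_on_def Ck_on_const)

lemma Cinf_on_add:
  "openin (Euclidean_space n) V \<Longrightarrow> Cinf_on n V f \<Longrightarrow> Cinf_on n V g \<Longrightarrow> Cinf_on n V (\<lambda>x. f x + g x)"
  by (simp add: Cinf_on_def Ck_on_add)

lemma Cinf_on_mult:
  "openin (Euclidean_space n) V \<Longrightarrow> Cinf_on n V f \<Longrightarrow> Cinf_on n V g \<Longrightarrow> Cinf_on n V (\<lambda>x. f x * g x)"
  by (simp add: Cinf_on_def Ck_on_mult)

lemma Cinf_on_sum:
  assumes "openin (Euclidean_space n) V" "\<And>a. a \<in> I \<Longrightarrow> Cinf_on n V (f a)"
  shows "Cinf_on n V (\<lambda>x. \<Sum>a\<in>I. f a x)"
  using assms(2) by (induction I rule: infinite_finite_induct) (auto simp: Cinf_on_const intro: Cinf_on_add[OF assms(1)])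

lemma Cinf_on_prod:
  assumes "openin (Euclidean_space n) V" "\<And>a. a \<in> I \<Longrightarrow> Cinf_on n V (f a)"
  shows "Cinf_on n V (\<lambda>x. \<Prod>a\<in>I. f a x)"
  using assms(2) by (induction I rule: infinite_finite_induct) (auto simp: Cinf_on_const intro: Cinf_on_mult[OF assms(1)])


section \<open>A smooth function supported on the positive half-line\<close>

text \<open>The functions \<open>q(1/t) exp(-1/t)\<close> for \<open>t > 0\<close> and a polynomial \<open>q\<close>, extended by \<open>0\<close>. This family is
  closed under differentiation: on polynomials, the derivative acts by \<open>flat_deriv\<close>.\<close>

definition flat_fun :: "real poly \<Rightarrow> real \<Rightarrow> real" where
  "flat_fun q t = (if t > 0 then poly q (1 / t) * exp (- (1 / t)) else 0)"

definition flat_deriv :: "real poly \<Rightarrow> real poly" where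
  "flat_deriv q = [:0, 0, 1:] * (q - pderiv q)"

lemma poly_exp_tendsto_0: "((\<lambda>x. poly q x * exp (- x)) \<longlongrightarrow> (0::real)) at_top"
proof -
  have "((\<lambda>x. \<Sum>i\<le>degree q. coeff q i * (x ^ i / exp x)) \<longlongrightarrow> (\<Sum>i\<le>degree q. coeff q i * 0)) at_top"
    by (intro tendsto_intros tendsto_power_div_exp_0)
  then show ?thesis
    by (simp add: poly_altdef sum_distrib_right exp_minus divide_inverse mult.assoc)
qed

lemma flat_fun_deriv: "(flat_fun q has_real_derivative flat_fun (flat_deriv q) t) (at t)"
proof -
  consider "t > 0" | "t < 0" | "t = 0" by linarith
  then show ?thesis
  proof cases
    case 1
    have ev: "\<forall>\<^sub>F s in nhds t. poly q (1 / s) * exp (- (1 / s)) = flat_fun q s"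
      using eventually_nhds_in_open[of "{0<..}" t] 1
      by (auto elim!: eventually_mono simp: flat_fun_def)
    have "((\<lambda>s. poly q (1 / s) * exp (- (1 / s))) has_real_derivative flat_fun (flat_deriv q) t) (at t)"
      using 1
      by (auto intro!: derivative_eq_intros poly_DERIV[THEN DERIV_chain2] simp: flat_fun_def flat_deriv_def field_simps power2_eq_square)
    then show ?thesis using DERIV_cong_ev[OF refl ev refl] by blast
  next
    case 2
    have ev: "\<forall>\<^sub>F s in nhds t. 0 = flat_fun q s"
      using eventually_nhds_in_open[of "{..<0}" t] 2
      by (auto elim!: eventually_mono simp: flat_fun_def)
    have "((\<lambda>s. 0) has_real_derivative flat_fun (flat_deriv q) t) (at t)"
      using 2 by (simp add: flat_fun_def)
    then show ?thesis using DERIV_cong_ev[OF refl ev refl] by blast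
  next
    case 3
    have r: "((\<lambda>s. flat_fun q s / s) \<longlongrightarrow> 0) (at_right 0)"
    proof -
      have "((\<lambda>s. poly ([:0, 1:] * q) (inverse s) * exp (- inverse s)) \<longlongrightarrow> 0) (at_right (0::real))"
        using filterlim_compose[OF poly_exp_tendsto_0 filterlim_inverse_at_top_right] .
      moreover have "\<forall>\<^sub>F s in at_right 0. poly ([:0, 1:] * q) (inverse s) * exp (- inverse s) = flat_fun q s / s"
        by (rule eventually_mono[OF eventually_at_right_less[of 0]]) (auto simp: flat_fun_def field_simps)
      ultimately show ?thesis using tendsto_cong by fastforce
    qed
    have l: "((\<lambda>s. flat_fun q s / s) \<longlongrightarrow> 0) (at_left 0)"
    proof (rule tendsto_eventually)
      show "\<forall>\<^sub>F s in at_left 0. flat_fun q s / s = 0"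
        by (auto simp: eventually_at_left_field flat_fun_def intro: exI[of _ "-1"])
    qed
    have "((\<lambda>s. flat_fun q s / s) \<longlongrightarrow> 0) (at 0)"
      using l r by (simp add: filterlim_at_split)
    then show ?thesis
      using 3 by (simp add: has_field_derivative_iff flat_fun_def)
  qed
qed

text \<open>\<open>exp(-1/t)\<close> for \<open>t > 0\<close>, extended by \<open>0\<close>.\<close>

definition flat_exp :: "real \<Rightarrow> real" where "flat_exp = flat_fun 1"

lemma flat_exp_eq_0_iff: "flat_exp t = 0 \<longleftrightarrow> t \<le> 0"
  by (auto simp: flat_exp_def flat_fun_def)

lemma Cinf_on_flat_exp:
  assumes "openin (Euclidean_space n) V" "Cinf_on n V u"
  shows "Cinf_on n V (\<lambda>x. flat_exp (u x))"
  unfolding Cinf_on_def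
proof
  fix k
  have "Ck_on n k V (\<lambda>x. flat_fun ((flat_deriv ^^ 0) 1) (u x))"
    by (rule Ck_on_compose_real[OF assms(1)])
      (use assms(2) flat_fun_deriv in \<open>auto simp: Cinf_on_def\<close>)
  then show "Ck_on n k V (\<lambda>x. flat_exp (u x))" by (simp add: flat_exp_def)
qed


section \<open>Smooth functions on manifolds\<close>

lemma smooth_manifoldD:
  assumes "smooth_manifold M" "c \<in> charts M"
  shows "is_chart (mdim M) c" "inj_on (snd c) (fst c)" "open (fst c)"
proof -
  show c: "is_chart (mdim M) c" using assms by (simp add: smooth_manifold_def)
  then show "open (fst c)" by (simp add: is_chart_def)
  obtain \<psi> where "homeomorphism (fst c) (snd c ` fst c) (snd c) \<psi>" using c by (auto simp: is_chart_def)
  then show "inj_on (snd c) (fst c)" by (intro inj_on_inverseI[of _ \<psi>]) (simp add: homeomorphism_def)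
qed

lemma chart_image_openin:
  assumes M: "smooth_manifold M" and c: "c \<in> charts M" and U: "open U"
  shows "openin (Euclidean_space (mdim M)) (snd c ` (fst c \<inter> U))"
proof -
  obtain \<psi> where \<psi>: "homeomorphism (fst c) (snd c ` fst c) (snd c) \<psi>"
    and op: "openin (Euclidean_space (mdim M)) (snd c ` fst c)"
    using smooth_manifoldD(1)[OF M c] by (auto simp: is_chart_def)
  obtain T where T: "open T" "snd c ` fst c = T \<inter> {x. \<forall>i\<ge>mdim M. x i = 0}"
    using op by (auto simp: openin_Euclidean_space_iff)
  have "openin (top_of_set (snd c ` fst c)) (snd c ` (fst c \<inter> U))"
    by (rule homeomorphism_imp_open_map[OF \<psi>]) (use U in \<open>simp add: openin_open_Int\<close>)
  then obtain T' where "open T'" "snd c ` (fst c \<inter> U) = (snd c ` fst c) \<inter> T'"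
    by (auto simp: openin_open)
  then have "open (T \<inter> T')" "snd c ` (fst c \<inter> U) = (T \<inter> T') \<inter> {x. \<forall>i\<ge>mdim M. x i = 0}"
    using T by auto
  then show ?thesis unfolding openin_Euclidean_space_iff by blast
qed

lemma chart_inv_apply: "smooth_manifold M \<Longrightarrow> c \<in> charts M \<Longrightarrow> p \<in> fst c \<Longrightarrow> chart_inv c (snd c p) = p"
  by (rule inv_into_f_f[OF smooth_manifoldD(2)])

lemma smooth_on_cong:
  assumes "smooth_manifold M" "open W" "\<And>p. p \<in> W \<Longrightarrow> f p = g p" "smooth_on M W f"
  shows "smooth_on M W g"
  unfolding smooth_on_def
proof
  fix c assume c: "c \<in> charts M"
  show "Cinf_on (mdim M) (snd c ` (fst c \<inter> W)) (g \<circ> chart_inv c)"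
    by (rule Cinf_on_cong[OF chart_image_openin[OF assms(1) c assms(2)], of "f \<circ> chart_inv c"])
      (use assms(3,4) c chart_inv_apply[OF assms(1) c] in \<open>auto simp: smooth_on_def\<close>)
qed

lemma smooth_on_subset: "smooth_on M W f \<Longrightarrow> W' \<subseteq> W \<Longrightarrow> smooth_on M W' f"
  unfolding smooth_on_def by (blast intro: Cinf_on_subset)

lemma smooth_on_const: "smooth_on M W (\<lambda>p. k)"
  by (simp add: smooth_on_def o_def Cinf_on_const)

lemma smooth_on_add:
  assumes "smooth_manifold M" "open W" "smooth_on M W f" "smooth_on M W g"
  shows "smooth_on M W (\<lambda>p. f p + g p)"
  using assms by (simp add: smooth_on_def o_def Cinf_on_add chart_image_openin)

lemma smooth_on_mult:
  assumes "smooth_manifold M" "open W" "smooth_on M W f" "smooth_on M W g"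
  shows "smooth_on M W (\<lambda>p. f p * g p)"
  using assms by (simp add: smooth_on_def o_def Cinf_on_mult chart_image_openin)

lemma smooth_on_sum:
  assumes "smooth_manifold M" "open W" "\<And>a. a \<in> I \<Longrightarrow> smooth_on M W (f a)"
  shows "smooth_on M W (\<lambda>p. \<Sum>a\<in>I. f a p)"
  using assms by (simp add: smooth_on_def o_def Cinf_on_sum chart_image_openin)

lemma smooth_on_prod:
  assumes "smooth_manifold M" "open W" "\<And>a. a \<in> I \<Longrightarrow> smooth_on M W (f a)"
  shows "smooth_on M W (\<lambda>p. \<Prod>a\<in>I. f a p)"
  using assms by (simp add: smooth_on_def o_def Cinf_on_prod chart_image_openin)

lemma smooth_on_flat_exp:
  assumes "smooth_manifold M" "open W" "smooth_on M W f"
  shows "smooth_on M W (\<lambda>p. flat_exp (f p))"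
  using assms by (simp add: smooth_on_def o_def Cinf_on_flat_exp chart_image_openin)

lemma smooth_on_coordinate:
  assumes "smooth_manifold M" "c \<in> charts M" "i < mdim M"
  shows "smooth_on M (fst c) (\<lambda>q. snd c q i)"
  using assms by (auto simp: smooth_on_def smooth_manifold_def o_def)

lemma smooth_on_local:
  assumes M: "smooth_manifold M"
    and cov: "\<And>p. p \<in> W \<Longrightarrow> \<exists>U. open U \<and> p \<in> U \<and> U \<subseteq> W \<and> smooth_on M U f"
  shows "smooth_on M W f"
  unfolding smooth_on_def
proof
  fix c assume c: "c \<in> charts M"
  show "Cinf_on (mdim M) (snd c ` (fst c \<inter> W)) (f \<circ> chart_inv c)"
  proof (rule Cinf_on_local)
    fix x assume "x \<in> snd c ` (fst c \<inter> W)"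
    then obtain p where p: "p \<in> fst c" "p \<in> W" "x = snd c p" by auto
    obtain U where U: "open U" "p \<in> U" "U \<subseteq> W" "smooth_on M U f" using cov[OF p(2)] by blast
    show "\<exists>V. x \<in> V \<and> V \<subseteq> snd c ` (fst c \<inter> W) \<and> openin (Euclidean_space (mdim M)) V \<and>
        Cinf_on (mdim M) V (f \<circ> chart_inv c)"
      using p U c chart_image_openin[OF M c U(1)]
      by (intro exI[of _ "snd c ` (fst c \<inter> U)"]) (auto simp: smooth_on_def)
  qed
qed

lemma smooth_on_pdiff:
  assumes "smooth_on M W f" "c \<in> charts M" "p \<in> fst c \<inter> W" "i < mdim M"
  shows "pdiff i (f \<circ> chart_inv c) (snd c p)"
  by (rule Cinf_on_pdiff[of "mdim M" "snd c ` (fst c \<inter> W)"]) (use assms in \<open>auto simp: smooth_on_def\<close>)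

lemma coord_deriv_cong:
  assumes "smooth_manifold M" "c \<in> charts M" "open W" "p \<in> fst c \<inter> W" "i < mdim M" "\<And>q. q \<in> W \<Longrightarrow> f q = g q"
  shows "coord_deriv c i f p = coord_deriv c i g p"
    "pdiff i (f \<circ> chart_inv c) (snd c p) \<longleftrightarrow> pdiff i (g \<circ> chart_inv c) (snd c p)"
proof -
  have eq: "(f \<circ> chart_inv c) y = (g \<circ> chart_inv c) y" if "y \<in> snd c ` (fst c \<inter> W)" for y
    using that assms(6) chart_inv_apply[OF assms(1,2)] by auto
  have p: "snd c p \<in> snd c ` (fst c \<inter> W)" using assms(4) by auto
  note * = pderivative_cong_pdiff[OF chart_image_openin[OF assms(1-3)] p assms(5) eq]
  show "coord_deriv c i f p = coord_deriv c i g p" unfolding coord_deriv_def by (rule *(1))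
  show "pdiff i (f \<circ> chart_inv c) (snd c p) \<longleftrightarrow> pdiff i (g \<circ> chart_inv c) (snd c p)" by (rule *(2))
qed

text \<open>Only the first \<open>n\<close> coordinates are allowed to vary, as in \<^const>\<open>Euclidean_space\<close> \<open>n\<close>.\<close>

lemma box_in_open:
  assumes "open T" "(x::nat \<Rightarrow> real) \<in> T"
  obtains \<delta> where "\<delta> > 0"
    "\<And>y. (\<And>i. i < n \<Longrightarrow> \<bar>y i - x i\<bar> \<le> \<delta>) \<Longrightarrow> (\<And>i. i \<ge> n \<Longrightarrow> y i = x i) \<Longrightarrow> y \<in> T"
proof -
  have "openin (product_topology (\<lambda>i. euclidean) UNIV) T" using assms(1) by (simp add: open_fun_def)
  from product_topology_open_contains_basis[OF this assms(2)] obtain X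
    where X: "x \<in> (\<Pi>\<^sub>E i\<in>UNIV. X i)" "\<And>i. open (X i)" "(\<Pi>\<^sub>E i\<in>UNIV. X i) \<subseteq> T"
    by auto
  have "\<exists>\<delta>>0. \<forall>i<m. \<forall>t. \<bar>t - x i\<bar> \<le> \<delta> \<longrightarrow> t \<in> X i" for m
  proof (induction m)
    case 0
    then show ?case by (auto intro: exI[of _ 1])
  next
    case (Suc m)
    then obtain \<delta> where d: "\<delta> > 0" "\<forall>i<m. \<forall>t. \<bar>t - x i\<bar> \<le> \<delta> \<longrightarrow> t \<in> X i" by blast
    have "x m \<in> X m" using X(1) by (auto simp: PiE_iff)
    with X(2)[of m] obtain e where e: "e > 0" "cball (x m) e \<subseteq> X m"
      using open_contains_cball by blast
    have "t \<in> X i" if "i < Suc m" "\<bar>t - x i\<bar> \<le> min \<delta> e" for i t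
    proof (cases "i = m")
      case True
      then have "t \<in> cball (x m) e" using that by (auto simp: dist_real_def)
      then show ?thesis using e True by auto
    qed (use that d in auto)
    then show ?case using d(1) e(1) by (intro exI[of _ "min \<delta> e"]) simp
  qed
  from this[of n] obtain \<delta> where d: "\<delta> > 0" "\<forall>i<n. \<forall>t. \<bar>t - x i\<bar> \<le> \<delta> \<longrightarrow> t \<in> X i" by blast
  show thesis
  proof (rule that[OF d(1)])
    fix y assume y: "\<And>i. i < n \<Longrightarrow> \<bar>y i - x i\<bar> \<le> \<delta>" "\<And>i. i \<ge> n \<Longrightarrow> y i = x i"
    have "y i \<in> X i" for i
    proof (cases "i < n")
      case False
      then show ?thesis using y(2)[of i] X(1) by (auto simp: PiE_iff)
    qed (use d(2) y(1) in auto)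
    then show "y \<in> T" using X(3) by auto
  qed
qed

text \<open>
  The function is defined on the whole chart domain, and vanishes outside \<open>K\<close>, the preimage of a
  closed box.
  As \<open>K\<close> is compact, it is closed in the Hausdorff space \<open>M\<close>, so that the extension by \<open>0\<close> is smooth
  on \<open>M\<close>.
\<close>

lemma smooth_bump_function:
  fixes M :: "'m::{t2_space,second_countable_topology} manifold"
  assumes M: "smooth_manifold M" and c: "c \<in> charts M" and U: "open U" "U \<subseteq> fst c" "p \<in> U"
  obtains \<beta> K where "closed K" "K \<subseteq> U" "smooth_on M (fst c) \<beta>" "\<beta> p \<noteq> 0"
    "\<And>q. q \<in> fst c \<Longrightarrow> q \<notin> K \<Longrightarrow> \<beta> q = 0"
proof -
  let ?n = "mdim M"
  define x0 where "x0 = snd c p"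
  obtain \<psi> where \<psi>: "homeomorphism (fst c) (snd c ` fst c) (snd c) \<psi>"
    using smooth_manifoldD(1)[OF M c] by (auto simp: is_chart_def)
  have U': "fst c \<inter> U = U" using U by auto
  obtain T where T: "open T" "snd c ` U = T \<inter> {x. \<forall>i\<ge>?n. x i = 0}"
    using chart_image_openin[OF M c U(1)] unfolding U' openin_Euclidean_space_iff by blast
  have x0: "x0 \<in> T" "\<And>i. i \<ge> ?n \<Longrightarrow> x0 i = 0" using T U(3) by (auto simp: x0_def)
  obtain \<delta> where d: "\<delta> > 0"
    "\<And>y. (\<And>i. i < ?n \<Longrightarrow> \<bar>y i - x0 i\<bar> \<le> \<delta>) \<Longrightarrow> (\<And>i. i \<ge> ?n \<Longrightarrow> y i = x0 i) \<Longrightarrow> y \<in> T"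
    using box_in_open[OF T(1) x0(1), of ?n] by metis
  define B where "B = (\<Pi>\<^sub>E i\<in>UNIV. if i < ?n then {x0 i - \<delta>..x0 i + \<delta>} else {0})"
  have memB: "y \<in> B \<longleftrightarrow> (\<forall>i<?n. \<bar>y i - x0 i\<bar> \<le> \<delta>) \<and> (\<forall>i\<ge>?n. y i = 0)" for y
  proof -
    have "\<bar>y i - x0 i\<bar> \<le> \<delta> \<longleftrightarrow> y i \<in> {x0 i - \<delta>..x0 i + \<delta>}" for i by auto
    then show ?thesis unfolding B_def PiE_UNIV_domain Pi_iff
      by (auto simp: not_less[symmetric] simp del: not_less)
  qed
  have BU: "B \<subseteq> snd c ` U" unfolding T(2) using d(2) x0(2) by (auto simp: memB)
  have "compactin (product_topology (\<lambda>i. euclidean) UNIV) B"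
    unfolding B_def by (subst compactin_PiE) (auto simp: compactin_euclidean_iff)
  then have "compact B" by (simp add: euclidean_product_topology compactin_euclidean_iff)
  moreover have "continuous_on B \<psi>"
    by (rule continuous_on_subset[of "snd c ` fst c"]) (use \<psi> BU U(2) in \<open>auto simp: homeomorphism_def\<close>)
  ultimately have "closed (\<psi> ` B)" by (simp add: compact_continuous_image compact_imp_closed)
  have K: "q \<in> \<psi> ` B \<longleftrightarrow> snd c q \<in> B" if "q \<in> fst c" for q
  proof
    assume "q \<in> \<psi> ` B"
    then obtain y where y: "y \<in> B" "q = \<psi> y" by auto
    then have "snd c q = y" using \<psi> BU U(2) by (auto simp: homeomorphism_def)
    with y show "snd c q \<in> B" by simp
  next
    assume "snd c q \<in> B"
    then show "q \<in> \<psi> ` B" using \<psi> that by (metis homeomorphism_apply1 image_eqI)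
  qed
  \<comment> \<open>Both factors at \<open>i\<close> are nonzero iff the \<open>i\<close>-th coordinates of \<open>q\<close> and \<open>p\<close> differ by less than \<open>\<delta>\<close>.\<close>
  define \<beta> where "\<beta> = (\<lambda>q. \<Prod>i<?n. flat_exp (\<delta> + (x0 i + (-1) * snd c q i)) * flat_exp (\<delta> + (- x0 i + snd c q i)))"
  show thesis
  proof
    show "closed (\<psi> ` B)" by fact
    show "\<psi> ` B \<subseteq> U"
      using BU U(2) \<psi> by (force simp: homeomorphism_def)
    show "smooth_on M (fst c) \<beta>"
      unfolding \<beta>_def using M smooth_manifoldD(3)[OF M c]
      by (intro smooth_on_prod smooth_on_mult smooth_on_flat_exp smooth_on_add smooth_on_const
          smooth_on_coordinate[OF M c]) auto
    show "\<beta> p \<noteq> 0" using d(1) by (simp add: \<beta>_def x0_def flat_exp_eq_0_iff)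
    fix q assume q: "q \<in> fst c" "q \<notin> \<psi> ` B"
    have "snd c q \<in> snd c ` fst c" using q by auto
    moreover have "openin (Euclidean_space ?n) (snd c ` fst c)"
      using smooth_manifoldD(1)[OF M c] by (simp add: is_chart_def)
    ultimately have "\<forall>i\<ge>?n. snd c q i = 0" by (auto simp: openin_Euclidean_space_iff)
    then obtain i where "i < ?n" "\<not> \<bar>snd c q i - x0 i\<bar> \<le> \<delta>" using K[OF q(1)] q(2) by (auto simp: memB)
    then have "i \<in> {..<?n}" "\<delta> + (x0 i + (-1) * snd c q i) \<le> 0 \<or> \<delta> + (- x0 i + snd c q i) \<le> 0" by auto
    then show "\<beta> q = 0" unfolding \<beta>_def by (intro prod_zero bexI[of _ i]) (auto simp: flat_exp_eq_0_iff)
  qed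
qed


section \<open>Frames and components\<close>

text \<open>\<open>e 0 p, \<dots>, e (r - 1) p\<close> is a basis of \<open>V\<close>.\<close>

definition frame_at :: "nat \<Rightarrow> (nat \<Rightarrow> 'm \<Rightarrow> 'v::real_vector) \<Rightarrow> 'm \<Rightarrow> 'v set \<Rightarrow> bool" where
  "frame_at r e p V \<longleftrightarrow> inj_on (\<lambda>a. e a p) {..<r} \<and> independent ((\<lambda>a. e a p) ` {..<r}) \<and>
     span ((\<lambda>a. e a p) ` {..<r}) = V"

lemma scaleR_fun_apply [simp]: "(c *\<^sub>R f) x = c *\<^sub>R f x"
  by (simp add: scaleR_fun_def)

lemma sum_fun_apply: "(\<Sum>a\<in>I. f a) x = (\<Sum>a\<in>I. f a x)"
  by (induction I rule: infinite_finite_induct) auto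

lemma frame_at_subspace: "frame_at r e p V \<Longrightarrow> subspace V"
  unfolding frame_at_def by (metis subspace_span)

lemma frame_at_mem: "frame_at r e p V \<Longrightarrow> a < r \<Longrightarrow> e a p \<in> V"
  unfolding frame_at_def by (metis span_base imageI lessThan_iff)

lemma comp_expand:
  assumes "frame_at r e p V" "v \<in> V"
  shows "v = (\<Sum>a<r. comp r e a p v *\<^sub>R e a p)"
proof -
  let ?B = "(\<lambda>a. e a p) ` {..<r}"
  have "v = (\<Sum>b\<in>?B. representation ?B v b *\<^sub>R b)"
    using assms by (intro real_vector.sum_representation_eq[symmetric]) (auto simp: frame_at_def)
  also have "\<dots> = (\<Sum>a<r. comp r e a p v *\<^sub>R e a p)"
    unfolding comp_def using assms by (subst sum.reindex) (auto simp: frame_at_def)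
  finally show ?thesis .
qed

text \<open>Components are \<open>0\<close> outside the span of the frame, since \<^const>\<open>representation\<close> is.\<close>

lemma comp_notin: "frame_at r e p V \<Longrightarrow> v \<notin> V \<Longrightarrow> comp r e a p v = 0"
  by (auto simp: comp_def frame_at_def representation_def)

lemma comp_add:
  "frame_at r e p V \<Longrightarrow> u \<in> V \<Longrightarrow> v \<in> V \<Longrightarrow> comp r e a p (u + v) = comp r e a p u + comp r e a p v"
  by (auto simp: comp_def frame_at_def real_vector.representation_add)

lemma comp_scale: "frame_at r e p V \<Longrightarrow> u \<in> V \<Longrightarrow> comp r e a p (k *\<^sub>R u) = k * comp r e a p u"
  by (auto simp: comp_def frame_at_def real_vector.representation_scale)

lemma comp_zero: "comp r e a p 0 = 0"
  by (simp add: comp_def real_vector.representation_zero)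

lemma comp_sum:
  assumes "frame_at r e p V" "\<And>b. b \<in> I \<Longrightarrow> v b \<in> V"
  shows "comp r e a p (\<Sum>b\<in>I. v b) = (\<Sum>b\<in>I. comp r e a p (v b))"
  using assms(2)
proof (induction I rule: infinite_finite_induct)
  case (insert x F)
  then have "(\<Sum>b\<in>F. v b) \<in> V" using frame_at_subspace[OF assms(1)] by (auto intro: subspace_sum)
  with insert show ?case by (simp add: comp_add[OF assms(1)])
qed (simp_all add: comp_zero)

lemma comp_frame:
  assumes "frame_at r e p V" "a < r" "b < r"
  shows "comp r e a p (e b p) = (if a = b then 1 else 0)"
  using assms by (auto simp: comp_def frame_at_def real_vector.representation_basis inj_on_def)

lemma comp_combination:
  assumes "frame_at r e p V" "a < r"
  shows "comp r e a p (\<Sum>b<r. k b *\<^sub>R e b p) = k a"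
proof -
  have "comp r e a p (\<Sum>b<r. k b *\<^sub>R e b p) = (\<Sum>b<r. k b * comp r e a p (e b p))"
    using assms frame_at_mem[OF assms(1)] frame_at_subspace[OF assms(1)]
    by (subst comp_sum[OF assms(1)]) (auto intro!: sum.cong comp_scale[OF assms(1)] simp: subspace_scale)
  also have "\<dots> = (\<Sum>b<r. if a = b then k b else 0)"
    by (intro sum.cong) (use assms comp_frame[OF assms(1)] in auto)
  finally show ?thesis using assms by simp
qed

lemma comp_eqI:
  assumes "frame_at r e p V" "u \<in> V" "v \<in> V" "\<And>a. a < r \<Longrightarrow> comp r e a p u = comp r e a p v"
  shows "u = v"
  using comp_expand[OF assms(1,2)] comp_expand[OF assms(1,3)] assms(4) by (metis (no_types, lifting) lessThan_iff sum.cong)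

text \<open>A criterion for frames that does not mention the set of their members: linear independence of the
  family also gives injectivity.\<close>

lemma frame_atI:
  assumes V: "subspace V" "\<And>a. a < r \<Longrightarrow> e a p \<in> V"
    and indep: "\<And>k b. (\<Sum>a<r. k a *\<^sub>R e a p) = 0 \<Longrightarrow> b < r \<Longrightarrow> k b = 0"
    and spans: "\<And>v. v \<in> V \<Longrightarrow> \<exists>k. v = (\<Sum>a<r. k a *\<^sub>R e a p)"
  shows "frame_at r e p V"
  unfolding frame_at_def
proof (intro conjI)
  show inj: "inj_on (\<lambda>a. e a p) {..<r}"
  proof (rule inj_onI, rule ccontr)
    fix a b assume ab: "a \<in> {..<r}" "b \<in> {..<r}" "e a p = e b p" "a \<noteq> b"
    have "(\<Sum>x<r. ((if x = a then 1 else 0) - (if x = b then 1 else 0)) *\<^sub>R e x p) = 0"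
      using ab by (simp add: scaleR_left_diff_distrib sum_subtractf if_distrib[of "\<lambda>k. k *\<^sub>R _"] cong: if_cong)
    from indep[OF this, of a] ab show False by simp
  qed
  show "independent ((\<lambda>a. e a p) ` {..<r})"
  proof (rule real_vector.independent_if_scalars_zero)
    fix f x assume "(\<Sum>x\<in>(\<lambda>a. e a p) ` {..<r}. f x *\<^sub>R x) = 0" "x \<in> (\<lambda>a. e a p) ` {..<r}"
    then show "f x = 0" using indep[of "\<lambda>a. f (e a p)"] inj by (auto simp: sum.reindex)
  qed simp
  show "span ((\<lambda>a. e a p) ` {..<r}) = V"
  proof
    show "span ((\<lambda>a. e a p) ` {..<r}) \<subseteq> V" using V by (intro span_minimal) auto
    show "V \<subseteq> span ((\<lambda>a. e a p) ` {..<r})"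
    proof
      fix v assume "v \<in> V"
      then obtain k where "v = (\<Sum>a<r. k a *\<^sub>R e a p)" using spans by blast
      then show "v \<in> span ((\<lambda>a. e a p) ` {..<r})" by (auto intro: span_sum span_scale span_base)
    qed
  qed
qed

lemma subspace_dual_space: "subspace V \<Longrightarrow> subspace (dual_space V)"
  unfolding subspace_def[of "dual_space V"] by (auto simp: dual_space_def algebra_simps)

lemma dual_space_sum:
  assumes "\<xi> \<in> dual_space V" "subspace V" "\<And>a. a \<in> I \<Longrightarrow> v a \<in> V"
  shows "\<xi> (\<Sum>a\<in>I. k a *\<^sub>R v a) = (\<Sum>a\<in>I. k a * \<xi> (v a))"
  using assms(3)
proof (induction I rule: infinite_finite_induct)
  case (insert x F)
  have mem: "(\<Sum>a\<in>F. k a *\<^sub>R v a) \<in> V" using insert assms(2) by (auto intro!: subspace_sum subspace_scale)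
  then show ?case using insert assms(1,2) by (auto simp: dual_space_def subspace_scale)
next
  case empty
  show ?case using assms(1,2) subspace_0[OF assms(2)] by (force simp: dual_space_def)
next
  case (infinite A)
  then show ?case using assms(1,2) subspace_0[OF assms(2)] by (force simp: dual_space_def)
qed

lemma dual_frame_apply:
  "frame_at r e p V \<Longrightarrow> a < r \<Longrightarrow> b < r \<Longrightarrow> dual_frame r e a p (e b p) = (if a = b then 1 else 0)"
  by (simp add: dual_frame_def comp_frame)

lemma frame_at_dual:
  assumes e: "frame_at r e p V"
  shows "frame_at r (dual_frame r e) p (dual_space V)"
    and "\<xi> \<in> dual_space V \<Longrightarrow> a < r \<Longrightarrow> comp r (dual_frame r e) a p \<xi> = \<xi> (e a p)"
proof -
  have expand: "\<xi> = (\<Sum>a<r. \<xi> (e a p) *\<^sub>R dual_frame r e a p)" if "\<xi> \<in> dual_space V" for \<xi>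
  proof
    fix v
    show "\<xi> v = (\<Sum>a<r. \<xi> (e a p) *\<^sub>R dual_frame r e a p) v"
    proof (cases "v \<in> V")
      case True
      have "\<xi> v = \<xi> (\<Sum>a<r. comp r e a p v *\<^sub>R e a p)" using comp_expand[OF e True] by simp
      also have "\<dots> = (\<Sum>a<r. comp r e a p v * \<xi> (e a p))"
        by (rule dual_space_sum[OF that frame_at_subspace[OF e]]) (use frame_at_mem[OF e] in auto)
      finally show ?thesis by (simp add: sum_fun_apply dual_frame_def mult.commute)
    next
      case False
      then show ?thesis using that comp_notin[OF e False]
        by (simp add: sum_fun_apply dual_frame_def dual_space_def)
    qed
  qed
  show f: "frame_at r (dual_frame r e) p (dual_space V)"
  proof (rule frame_atI)
    show "subspace (dual_space V)" by (rule subspace_dual_space[OF frame_at_subspace[OF e]])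
    show "dual_frame r e a p \<in> dual_space V" for a
      using comp_notin[OF e] by (auto simp: dual_space_def dual_frame_def comp_add[OF e] comp_scale[OF e])
    show "\<exists>k. \<xi> = (\<Sum>a<r. k a *\<^sub>R dual_frame r e a p)" if "\<xi> \<in> dual_space V" for \<xi>
      by (rule exI[of _ "\<lambda>a. \<xi> (e a p)"], rule expand[OF that])
    fix k b assume 0: "(\<Sum>a<r. k a *\<^sub>R dual_frame r e a p) = 0" and b: "b < r"
    have "0 = (\<Sum>a<r. k a *\<^sub>R dual_frame r e a p) (e b p)" using 0 by simp
    also have "\<dots> = (\<Sum>a<r. if a = b then k a else 0)"
      unfolding sum_fun_apply by (intro sum.cong) (use b dual_frame_apply[OF e] in auto)
    finally show "k b = 0" using b by simp
  qed
  show "comp r (dual_frame r e) a p \<xi> = \<xi> (e a p)" if "\<xi> \<in> dual_space V" "a < r"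
    by (subst expand[OF that(1)]) (rule comp_combination[OF f that(2)])
qed

lemma sum_lessThan_double: "(\<Sum>a<2 * r. f a) = (\<Sum>a<r. f a) + (\<Sum>a<r. f (r + a))"
  for r :: nat and f :: "nat \<Rightarrow> 'b::comm_monoid_add"
proof -
  have "{..<2 * r} = {..<r} \<union> {r..<r + r}" by auto
  then have "(\<Sum>a<2 * r. f a) = (\<Sum>a\<in>{..<r} \<union> {r..<r + r}. f a)" by (rule arg_cong)
  also have "\<dots> = (\<Sum>a<r. f a) + (\<Sum>a=r..<r + r. f a)" by (rule sum.union_disjoint) auto
  also have "(\<Sum>a=r..<r + r. f a) = (\<Sum>a<r. f (r + a))"
    by (rule sum.reindex_bij_witness[of _ "\<lambda>a. r + a" "\<lambda>a. a - r"]) auto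
  finally show ?thesis .
qed

lemma double_frame_combination:
  "(\<Sum>a<2 * r. k a *\<^sub>R double_frame r e a p) =
     (\<Sum>a<r. k a *\<^sub>R e a p, \<Sum>a<r. k (r + a) *\<^sub>R dual_frame r e a p)"
  unfolding sum_lessThan_double by (simp add: double_frame_def prod_eq_iff fst_sum snd_sum scaleR_prod_def)

text \<open>In a frame of \<open>A \<oplus> A\<^sup>*\<close>, the components of \<open>(v, \<xi>)\<close> are those of \<open>v\<close> and the values of \<open>\<xi>\<close> on the frame.\<close>

lemma frame_at_double:
  assumes e: "frame_at r e p V"
  shows "frame_at (2 * r) (double_frame r e) p (V \<times> dual_space V)"
    and "v \<in> V \<Longrightarrow> \<xi> \<in> dual_space V \<Longrightarrow> a < 2 * r \<Longrightarrow>
      comp (2 * r) (double_frame r e) a p (v, \<xi>) = (if a < r then comp r e a p v else \<xi> (e (a - r) p))"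
proof -
  note d = frame_at_dual[OF e]
  have expand: "(v, \<xi>) = (\<Sum>a<2 * r. (if a < r then comp r e a p v else \<xi> (e (a - r) p)) *\<^sub>R double_frame r e a p)"
    if "v \<in> V" "\<xi> \<in> dual_space V" for v \<xi>
    unfolding double_frame_combination
    using comp_expand[OF e that(1)] comp_expand[OF d(1) that(2)] d(2)[OF that(2)] by simp
  show f: "frame_at (2 * r) (double_frame r e) p (V \<times> dual_space V)"
  proof (rule frame_atI)
    show "subspace (V \<times> dual_space V)"
      by (intro subspace_Times subspace_dual_space frame_at_subspace[OF e])
    show "double_frame r e a p \<in> V \<times> dual_space V" if "a < 2 * r" for a
      using that frame_at_mem[OF e] frame_at_mem[OF d(1), of "a - r"] subspace_0[OF frame_at_subspace[OF e]]
        subspace_0[OF frame_at_subspace[OF d(1)]]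
      by (auto simp: double_frame_def)
    show "\<exists>k. w = (\<Sum>a<2 * r. k a *\<^sub>R double_frame r e a p)" if "w \<in> V \<times> dual_space V" for w
      using expand[of "fst w" "snd w"] that unfolding mem_Times_iff prod.collapse
      by (intro exI[of _ "\<lambda>a. if a < r then comp r e a p (fst w) else snd w (e (a - r) p)"]) simp
    fix k b assume "(\<Sum>a<2 * r. k a *\<^sub>R double_frame r e a p) = 0" and b: "b < 2 * r"
    then have 1: "(\<Sum>a<r. k a *\<^sub>R e a p) = 0" and 2: "(\<Sum>a<r. k (r + a) *\<^sub>R dual_frame r e a p) = 0"
      unfolding double_frame_combination by (auto simp: zero_prod_def)
    show "k b = 0"
    proof (cases "b < r")
      case True
      then show ?thesis using comp_combination[OF e True, of k] 1 by (simp add: comp_zero)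
    next
      case False
      then show ?thesis
        using comp_combination[OF d(1), of "b - r" "\<lambda>a. k (r + a)"] 2 b by (simp add: comp_zero)
    qed
  qed
  show "comp (2 * r) (double_frame r e) a p (v, \<xi>) = (if a < r then comp r e a p v else \<xi> (e (a - r) p))"
    if "v \<in> V" "\<xi> \<in> dual_space V" "a < 2 * r"
    by (subst expand[OF that(1,2)]) (rule comp_combination[OF f that(3)])
qed


section \<open>Vector bundles, their duals and doubles\<close>

lemma vector_bundle_iff:
  "vector_bundle A \<longleftrightarrow> smooth_manifold (base A) \<and> (\<forall>p. subspace (fib A p)) \<and>
     (\<Union>t\<in>frames A. fst t) = UNIV \<and>
     (\<forall>(W, e)\<in>frames A. open W \<and> (\<forall>p\<in>W. frame_at (rank A) e p (fib A p))) \<and>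
     (\<forall>(W, e)\<in>frames A. \<forall>(W', e')\<in>frames A. \<forall>a<rank A. \<forall>b<rank A.
        smooth_on (base A) (W \<inter> W') (\<lambda>p. comp (rank A) e' a p (e b p)))"
  by (simp add: vector_bundle_def frame_at_def)

lemma vector_bundleD:
  assumes "vector_bundle A"
  shows "smooth_manifold (base A)" "subspace (fib A p)" "\<exists>(W, e)\<in>frames A. p \<in> W"
    "(W, e) \<in> frames A \<Longrightarrow> open W" "(W, e) \<in> frames A \<Longrightarrow> p \<in> W \<Longrightarrow> frame_at (rank A) e p (fib A p)"
    "(W, e) \<in> frames A \<Longrightarrow> (W', e') \<in> frames A \<Longrightarrow> a < rank A \<Longrightarrow> b < rank A \<Longrightarrow>
      smooth_on (base A) (W \<inter> W') (\<lambda>p. comp (rank A) e' a p (e b p))"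
proof -
  note A = assms[unfolded vector_bundle_iff]
  show "smooth_manifold (base A)" "subspace (fib A p)" using A by auto
  have "p \<in> (\<Union>t\<in>frames A. fst t)" using A by auto
  then show "\<exists>(W, e)\<in>frames A. p \<in> W" by force
  show "(W, e) \<in> frames A \<Longrightarrow> open W" "(W, e) \<in> frames A \<Longrightarrow> p \<in> W \<Longrightarrow> frame_at (rank A) e p (fib A p)"
    using A by auto
  show "smooth_on (base A) (W \<inter> W') (\<lambda>p. comp (rank A) e' a p (e b p))"
    if "(W, e) \<in> frames A" "(W', e') \<in> frames A" "a < rank A" "b < rank A"
    using A that by fast
qed

lemma dual_bundle_simps [simp]:
  "base (dual_bundle A) = base A" "fib (dual_bundle A) p = dual_space (fib A p)"
  "rank (dual_bundle A) = rank A"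
  "frames (dual_bundle A) = (\<lambda>(W, e). (W, dual_frame (rank A) e)) ` frames A"
  by (simp_all add: dual_bundle_def)

lemma double_bundle_simps [simp]:
  "base (double_bundle A) = base A" "fib (double_bundle A) p = fib A p \<times> dual_space (fib A p)"
  "rank (double_bundle A) = 2 * rank A"
  "frames (double_bundle A) = (\<lambda>(W, e). (W, double_frame (rank A) e)) ` frames A"
  by (simp_all add: double_bundle_def)

lemma vector_bundle_dual:
  assumes A: "vector_bundle A"
  shows "vector_bundle (dual_bundle A)"
  unfolding vector_bundle_iff
proof (intro conjI ballI allI impI; (clarsimp simp del: image_eqI)?)
  note D = vector_bundleD[OF A]
  show "smooth_manifold (base A)" by (rule D)
  show "subspace (dual_space (fib A p))" for p by (rule subspace_dual_space[OF D(2)])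
  show "(\<Union>x\<in>frames A. fst (case x of (W, e) \<Rightarrow> (W, dual_frame (rank A) e))) = UNIV"
    using D(3) by fastforce
  show "open W \<and> (\<forall>p\<in>W. frame_at (rank A) (dual_frame (rank A) e) p (dual_space (fib A p)))"
    if "(W, e) \<in> frames A" for W e
    using D(4)[OF that] frame_at_dual(1)[OF D(5)[OF that]] by blast
  fix W e W' e' a b
  assume h: "(W, e) \<in> frames A" "(W', e') \<in> frames A" "a < rank A" "b < rank A"
  show "smooth_on (base A) (W \<inter> W')
          (\<lambda>p. comp (rank A) (dual_frame (rank A) e') a p (dual_frame (rank A) e b p))"
  proof (rule smooth_on_cong[OF D(1)])
    show "open (W \<inter> W')" using D(4) h by auto
    show "smooth_on (base A) (W \<inter> W') (\<lambda>p. comp (rank A) e b p (e' a p))"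
      using D(6)[OF h(2,1,4,3)] by (simp add: Int_commute)
    fix p assume "p \<in> W \<inter> W'"
    then have "frame_at (rank A) e p (fib A p)" "frame_at (rank A) e' p (fib A p)" using D(5) h by auto
    then show "comp (rank A) e b p (e' a p) =
        comp (rank A) (dual_frame (rank A) e') a p (dual_frame (rank A) e b p)"
      using frame_at_dual(2) frame_at_mem[OF frame_at_dual(1)] h by (metis dual_frame_def)
  qed
qed

lemma vector_bundle_double:
  assumes A: "vector_bundle A"
  shows "vector_bundle (double_bundle A)"
  unfolding vector_bundle_iff
proof (intro conjI ballI allI impI; (clarsimp simp del: image_eqI)?)
  note D = vector_bundleD[OF A]
  show "smooth_manifold (base A)" by (rule D)
  show "subspace (fib A p \<times> dual_space (fib A p))" for p
    by (intro subspace_Times subspace_dual_space D(2))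
  show "(\<Union>x\<in>frames A. fst (case x of (W, e) \<Rightarrow> (W, double_frame (rank A) e))) = UNIV"
    using D(3) by fastforce
  show "open W \<and> (\<forall>p\<in>W. frame_at (2 * rank A) (double_frame (rank A) e) p (fib A p \<times> dual_space (fib A p)))"
    if "(W, e) \<in> frames A" for W e
    using D(4)[OF that] frame_at_double(1)[OF D(5)[OF that]] by blast
  fix W e W' e' a b
  assume h: "(W, e) \<in> frames A" "(W', e') \<in> frames A" "a < 2 * rank A" "b < 2 * rank A"
  let ?r = "rank A"
  define g where "g = (\<lambda>p. if b < ?r then if a < ?r then comp ?r e' a p (e b p) else 0
                     else if a < ?r then 0 else comp ?r e (b - ?r) p (e' (a - ?r) p))"
  show "smooth_on (base A) (W \<inter> W')
          (\<lambda>p. comp (2 * ?r) (double_frame ?r e') a p (double_frame ?r e b p))"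
  proof (rule smooth_on_cong[OF D(1)])
    show "open (W \<inter> W')" using D(4) h by auto
    have "b - ?r < ?r" "a - ?r < ?r" if "\<not> b < ?r" "\<not> a < ?r" using h that by auto
    then show "smooth_on (base A) (W \<inter> W') g"
      using D(6)[OF h(1,2), of a b] D(6)[OF h(2,1), of "b - ?r" "a - ?r"] h
      by (cases "b < ?r"; cases "a < ?r") (simp_all add: g_def smooth_on_const Int_commute)
    fix p assume "p \<in> W \<inter> W'"
    then have e: "frame_at ?r e p (fib A p)" "frame_at ?r e' p (fib A p)" using D(5) h by auto
    have z: "0 \<in> dual_space (fib A p)" "0 \<in> fib A p"
      using subspace_0 D(2) subspace_dual_space by blast+
    show "g p = comp (2 * ?r) (double_frame ?r e') a p (double_frame ?r e b p)"
    proof (cases "b < ?r")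
      case True
      then show ?thesis using frame_at_double(2)[OF e(2) frame_at_mem[OF e(1) True] z(1) h(3)]
        by (simp add: g_def double_frame_def)
    next
      case False
      then have "dual_frame ?r e (b - ?r) p \<in> dual_space (fib A p)"
        using frame_at_mem[OF frame_at_dual(1)[OF e(1)], of "b - ?r"] h by simp
      from frame_at_double(2)[OF e(2) z(2) this h(3)] False show ?thesis
        by (simp add: g_def double_frame_def comp_zero dual_frame_def)
    qed
  qed
qed

lemma sectionsD:
  assumes "s \<in> sections B"
  shows "s p \<in> fib B p"
    "(W, e) \<in> frames B \<Longrightarrow> a < rank B \<Longrightarrow> smooth_on (base B) W (\<lambda>p. comp (rank B) e a p (s p))"
  using assms by (auto simp: sections_def)

lemma endosD:
  assumes "N \<in> endos B"
  shows "u \<in> fib B p \<Longrightarrow> N p u \<in> fib B p" "u \<in> fib B p \<Longrightarrow> N p (k *\<^sub>R u) = k *\<^sub>R N p u"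
    "u \<in> fib B p \<Longrightarrow> v \<in> fib B p \<Longrightarrow> N p (u + v) = N p u + N p v"
    "(W, e) \<in> frames B \<Longrightarrow> a < rank B \<Longrightarrow> b < rank B \<Longrightarrow>
      smooth_on (base B) W (\<lambda>p. comp (rank B) e a p (N p (e b p)))"
  using assms by (auto simp: endos_def)

lemma endo_sum:
  assumes "vector_bundle B" "N \<in> endos B" "\<And>b. b \<in> I \<Longrightarrow> v b \<in> fib B p"
  shows "N p (\<Sum>b\<in>I. k b *\<^sub>R v b) = (\<Sum>b\<in>I. k b *\<^sub>R N p (v b))"
  using assms(3)
proof (induction I rule: infinite_finite_induct)
  case (insert x F)
  have "(\<Sum>b\<in>F. k b *\<^sub>R v b) \<in> fib B p"
    using insert vector_bundleD(2)[OF assms(1)] by (auto intro!: subspace_sum subspace_scale)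
  then show ?case
    using insert vector_bundleD(2)[OF assms(1)] by (simp add: endosD[OF assms(2)] subspace_scale)
qed (use endosD(2)[OF assms(2), of 0 p 0] subspace_0[OF vector_bundleD(2)[OF assms(1)]] in simp_all)

lemma comp_endo:
  assumes B: "vector_bundle B" and N: "N \<in> endos B" and e: "(W, e) \<in> frames B" and p: "p \<in> W"
    and u: "u \<in> fib B p"
  shows "comp (rank B) e a p (N p u) =
    (\<Sum>b<rank B. comp (rank B) e b p u * comp (rank B) e a p (N p (e b p)))"
proof -
  note f = vector_bundleD(5)[OF B e p]
  have m: "e b p \<in> fib B p" if "b < rank B" for b by (rule frame_at_mem[OF f that])
  have "N p u = (\<Sum>b<rank B. comp (rank B) e b p u *\<^sub>R N p (e b p))"
    using endo_sum[OF B N, of "{..<rank B}" "\<lambda>b. e b p" p "\<lambda>b. comp (rank B) e b p u"] m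
    unfolding comp_expand[OF f u, symmetric] by simp
  then have "comp (rank B) e a p (N p u) = comp (rank B) e a p \<dots>" by simp
  also have "\<dots> = (\<Sum>b<rank B. comp (rank B) e a p (comp (rank B) e b p u *\<^sub>R N p (e b p)))"
    using m vector_bundleD(2)[OF B] by (intro comp_sum[OF f]) (auto intro: subspace_scale endosD(1)[OF N])
  also have "\<dots> = (\<Sum>b<rank B. comp (rank B) e b p u * comp (rank B) e a p (N p (e b p)))"
    by (intro sum.cong comp_scale[OF f] endosD(1)[OF N]) (use m in auto)
  finally show ?thesis .
qed

lemma app_section:
  assumes B: "vector_bundle B" and N: "N \<in> endos B" and s: "s \<in> sections B"
  shows "app N s \<in> sections B"
proof -
  have "smooth_on (base B) W (\<lambda>p. comp (rank B) e a p (app N s p))" if h: "(W, e) \<in> frames B" "a < rank B" for W e a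
  proof (rule smooth_on_cong[OF vector_bundleD(1)[OF B] vector_bundleD(4)[OF B h(1)]])
    show "smooth_on (base B) W (\<lambda>p. \<Sum>b<rank B. comp (rank B) e b p (s p) * comp (rank B) e a p (N p (e b p)))"
      using vector_bundleD(1,4)[OF B] h endosD(4)[OF N h] sectionsD(2)[OF s h(1)]
      by (intro smooth_on_sum smooth_on_mult) auto
  qed (use comp_endo[OF B N h(1)] sectionsD(1)[OF s] in \<open>auto simp: app_def\<close>)
  then show ?thesis using sectionsD(1)[OF s] endosD(1)[OF N] by (auto simp: sections_def app_def)
qed

lemma endo_compose:
  assumes B: "vector_bundle B" and N: "N \<in> endos B" and N': "N' \<in> endos B"
  shows "(\<lambda>p u. N p (N' p u)) \<in> endos B"
proof -
  have "smooth_on (base B) W (\<lambda>p. comp (rank B) e a p (N p (N' p (e c p))))"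
    if h: "(W, e) \<in> frames B" "a < rank B" "c < rank B" for W e a c
  proof (rule smooth_on_cong[OF vector_bundleD(1)[OF B] vector_bundleD(4)[OF B h(1)]])
    show "smooth_on (base B) W (\<lambda>p. \<Sum>b<rank B. comp (rank B) e b p (N' p (e c p)) * comp (rank B) e a p (N p (e b p)))"
      using vector_bundleD(1,4)[OF B] h endosD(4)[OF N] endosD(4)[OF N']
      by (intro smooth_on_sum smooth_on_mult) auto
    fix p assume p: "p \<in> W"
    have "N' p (e c p) \<in> fib B p"
      by (rule endosD(1)[OF N' frame_at_mem[OF vector_bundleD(5)[OF B h(1) p] h(3)]])
    from comp_endo[OF B N h(1) p this, of a]
    show "(\<Sum>b<rank B. comp (rank B) e b p (N' p (e c p)) * comp (rank B) e a p (N p (e b p))) =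
      comp (rank B) e a p (N p (N' p (e c p)))" by simp
  qed
  then show ?thesis using endosD(1-3)[OF N] endosD(1-3)[OF N'] by (simp add: endos_def split_beta)
qed

lemma endo_scale:
  assumes B: "vector_bundle B" and N: "N \<in> endos B"
  shows "(\<lambda>p u. k *\<^sub>R N p u) \<in> endos B"
proof -
  have "smooth_on (base B) W (\<lambda>p. comp (rank B) e a p (k *\<^sub>R N p (e c p)))"
    if h: "(W, e) \<in> frames B" "a < rank B" "c < rank B" for W e a c
  proof (rule smooth_on_cong[OF vector_bundleD(1)[OF B] vector_bundleD(4)[OF B h(1)]])
    show "smooth_on (base B) W (\<lambda>p. k * comp (rank B) e a p (N p (e c p)))"
      using vector_bundleD(1,4)[OF B] h endosD(4)[OF N]
      by (intro smooth_on_mult smooth_on_const) auto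
    fix p assume p: "p \<in> W"
    note f = vector_bundleD(5)[OF B h(1) p]
    show "k * comp (rank B) e a p (N p (e c p)) = comp (rank B) e a p (k *\<^sub>R N p (e c p))"
      by (rule comp_scale[OF f endosD(1)[OF N frame_at_mem[OF f h(3)]], symmetric])
  qed
  moreover have "k *\<^sub>R N p u \<in> fib B p" if "u \<in> fib B p" for p u
    using that endosD(1)[OF N] vector_bundleD(2)[OF B] by (simp add: subspace_scale)
  ultimately show ?thesis using endosD(1-3)[OF N]
    by (simp add: endos_def split_beta scaleR_add_right)
qed

lemma transpose_endo_mem:
  assumes A: "vector_bundle A" and N: "N \<in> endos A" and x: "\<xi> \<in> dual_space (fib A p)"
  shows "transpose_endo A N p \<xi> \<in> dual_space (fib A p)"
proof -
  have "subspace (fib A p)" by (rule vector_bundleD[OF A])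
  then show ?thesis
    using x endosD(1-3)[OF N, of _ p]
    by (auto simp: dual_space_def transpose_endo_def subspace_add subspace_scale)
qed

lemma transpose_endo_endos:
  assumes A: "vector_bundle A" and N: "N \<in> endos A"
  shows "transpose_endo A N \<in> endos (dual_bundle A)"
proof -
  have "smooth_on (base A) W (\<lambda>p. comp (rank A) (dual_frame (rank A) e) a p
          (transpose_endo A N p (dual_frame (rank A) e b p)))"
    if h: "(W, e) \<in> frames A" "a < rank A" "b < rank A" for W e a b
  proof (rule smooth_on_cong[OF vector_bundleD(1)[OF A] vector_bundleD(4)[OF A h(1)]])
    show "smooth_on (base A) W (\<lambda>p. comp (rank A) e b p (N p (e a p)))"
      by (rule endosD(4)[OF N h(1,3,2)])
    fix p assume p: "p \<in> W"
    note f = vector_bundleD(5)[OF A h(1) p]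
    have "transpose_endo A N p (dual_frame (rank A) e b p) \<in> dual_space (fib A p)"
      by (rule transpose_endo_mem[OF A N frame_at_mem[OF frame_at_dual(1)[OF f] h(3)]])
    from frame_at_dual(2)[OF f this h(2)] frame_at_mem[OF f h(2)]
    show "comp (rank A) e b p (N p (e a p)) =
        comp (rank A) (dual_frame (rank A) e) a p (transpose_endo A N p (dual_frame (rank A) e b p))"
      by (simp add: transpose_endo_def dual_frame_def)
  qed
  then show ?thesis using transpose_endo_mem[OF A N]
    by (auto simp: endos_def transpose_endo_def fun_eq_iff)
qed

text \<open>Bump functions yield enough global sections: the members of a frame at a point are values of global
  sections up to a factor.\<close>

lemma section_through_frame:
  assumes B: "vector_bundle B" and e: "(W, e) \<in> frames B" "p \<in> W" "a < rank B"
  obtains s k where "s \<in> sections B" "k \<noteq> 0" "s p = k *\<^sub>R e a p"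
proof -
  note M = vector_bundleD(1)[OF B]
  have "p \<in> (\<Union>c\<in>charts (base B). fst c)" using M by (simp add: smooth_manifold_def)
  then obtain c where c: "c \<in> charts (base B)" "p \<in> fst c" by auto
  define U where "U = fst c \<inter> W"
  have oc: "open (fst c)" and oW: "open W" using smooth_manifoldD(3)[OF M c(1)] vector_bundleD(4)[OF B e(1)] .
  obtain \<beta> K where K: "closed K" "K \<subseteq> U" "smooth_on (base B) (fst c) \<beta>" "\<beta> p \<noteq> 0"
    "\<And>q. q \<in> fst c \<Longrightarrow> q \<notin> K \<Longrightarrow> \<beta> q = 0"
    by (rule smooth_bump_function[OF M c(1), of U p]) (use oc oW c(2) e(2) in \<open>auto simp: U_def\<close>)
  define s where "s = (\<lambda>q. if q \<in> U then \<beta> q *\<^sub>R e a q else 0)"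
  have mem: "e a q \<in> fib B q" if "q \<in> U" for q
    using frame_at_mem[OF vector_bundleD(5)[OF B e(1)] e(3)] that by (simp add: U_def)
  have "smooth_on (base B) W' (\<lambda>q. comp (rank B) e' b q (s q))" if h: "(W', e') \<in> frames B" "b < rank B" for W' e' b
  proof (rule smooth_on_local[OF M])
    fix q assume q: "q \<in> W'"
    have oW': "open W'" by (rule vector_bundleD(4)[OF B h(1)])
    show "\<exists>V. open V \<and> q \<in> V \<and> V \<subseteq> W' \<and> smooth_on (base B) V (\<lambda>q. comp (rank B) e' b q (s q))"
    proof (cases "q \<in> U")
      case True
      have "smooth_on (base B) (U \<inter> W') (\<lambda>q. comp (rank B) e' b q (s q))"
      proof (rule smooth_on_cong[OF M])
        show "open (U \<inter> W')" using oc oW oW' by (auto simp: U_def)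
        then show "smooth_on (base B) (U \<inter> W') (\<lambda>q. \<beta> q * comp (rank B) e' b q (e a q))"
          using K(3) vector_bundleD(6)[OF B e(1) h(1) h(2) e(3)]
          by (intro smooth_on_mult[OF M]) (auto simp: U_def intro: smooth_on_subset)
        show "\<beta> x * comp (rank B) e' b x (e a x) = comp (rank B) e' b x (s x)" if "x \<in> U \<inter> W'" for x
          using that comp_scale[OF vector_bundleD(5)[OF B h(1)] mem] by (simp add: s_def)
      qed
      then show ?thesis using True q oc oW oW' by (intro exI[of _ "U \<inter> W'"]) (auto simp: U_def)
    next
      case False
      have o: "open (W' - K)" using oW' K(1) by (rule open_Diff)
      have "s x = 0" if "x \<notin> K" for x using K(5)[of x] that by (auto simp: s_def U_def)
      then have "smooth_on (base B) (W' - K) (\<lambda>q. comp (rank B) e' b q (s q))"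
        by (intro smooth_on_cong[OF M o _ smooth_on_const[of _ _ 0]]) (simp add: comp_zero)
      then show ?thesis using False q o K(2) by (intro exI[of _ "W' - K"]) auto
    qed
  qed
  moreover have "s q \<in> fib B q" for q
    using mem vector_bundleD(2)[OF B] by (auto simp: s_def intro: subspace_scale subspace_0)
  ultimately have "s \<in> sections B" by (auto simp: sections_def)
  then show thesis using K(4) c(2) e(2) by (intro that[of s "\<beta> p"]) (simp_all add: s_def U_def)
qed


section \<open>Evaluation of the derived bracket in coordinates\<close>

text \<open>
  The index of the coordinate conjugate to \<open>\<zeta>\<^sub>a\<close>, which exchanges \<open>\<theta>\<^sub>a\<close> and \<open>\<tau>\<^sup>a\<close>; it is written \<open>a\<^sup>*\<close> in
  comments. With it the pairing of sections and the odd part of the Poisson bracket are single sums.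
\<close>

definition dual_index :: "nat \<Rightarrow> nat \<Rightarrow> nat" where
  "dual_index r a = (if a < r then r + a else a - r)"

lemma sum_dual_index: "(\<Sum>a<2 * r. f (dual_index r a)) = (\<Sum>a<2 * r. f a)"
  by (rule sum.reindex_bij_witness[of _ "dual_index r" "dual_index r"]) (auto simp: dual_index_def)

lemma dual_index_dual_index: "a < 2 * r \<Longrightarrow> dual_index r (dual_index r a) = a"
  by (auto simp: dual_index_def)

lemma pairing_comps:
  assumes e: "frame_at r e q V" and z: "z \<in> V \<times> dual_space V" and w: "w \<in> V \<times> dual_space V"
  shows "pairing z w = (\<Sum>a<2 * r. comp (2 * r) (double_frame r e) a q z *
           comp (2 * r) (double_frame r e) (dual_index r a) q w)"
proof -
  have c: "comp (2 * r) (double_frame r e) a q z = (if a < r then comp r e a q (fst z) else snd z (e (a - r) q))"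
    if "a < 2 * r" "z \<in> V \<times> dual_space V" for a z
    using frame_at_double(2)[OF e, of "fst z" "snd z"] that by (auto simp: mem_Times_iff)
  have ev: "\<xi> v = (\<Sum>a<r. comp r e a q v * \<xi> (e a q))" if "v \<in> V" "\<xi> \<in> dual_space V" for v \<xi>
  proof -
    have "\<xi> v = \<xi> (\<Sum>a<r. comp r e a q v *\<^sub>R e a q)" using comp_expand[OF e that(1)] by simp
    also have "\<dots> = (\<Sum>a<r. comp r e a q v * \<xi> (e a q))"
      using frame_at_mem[OF e] by (intro dual_space_sum[OF that(2) frame_at_subspace[OF e]]) auto
    finally show ?thesis .
  qed
  have "pairing z w = (\<Sum>a<r. comp r e a q (fst z) * snd w (e a q)) + (\<Sum>a<r. snd z (e a q) * comp r e a q (fst w))"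
    using z w ev[of "fst z" "snd w"] ev[of "fst w" "snd z"]
    by (auto simp: pairing_def mem_Times_iff mult.commute)
  also have "\<dots> = (\<Sum>a<2 * r. comp (2 * r) (double_frame r e) a q z *
           comp (2 * r) (double_frame r e) (dual_index r a) q w)"
    unfolding sum_lessThan_double using z w by (simp add: c dual_index_def)
  finally show ?thesis .
qed

text \<open>The function \<open>\<Sum>\<^sub>a U\<^sub>a \<zeta>\<^sub>a\<close> of degree 1.\<close>

definition glinear :: "nat \<Rightarrow> (nat \<Rightarrow> 'm \<Rightarrow> real) \<Rightarrow> 'm gfun" where
  "glinear n U = (\<lambda>S m. if m = {#} \<and> (\<exists>a<n. S = {a}) then U (the_elem S) else (\<lambda>p. 0))"

lemma glinear_apply:
  "glinear n U {a} {#} p = (if a < n then U a p else 0)"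
  "m \<noteq> {#} \<Longrightarrow> glinear n U S m p = 0"
  "glinear n U {} m p = 0"
  "a \<noteq> b \<Longrightarrow> glinear n U {a, b} m p = 0"
  by (auto simp: glinear_def doubleton_eq_iff)

lemma of_section_eq_glinear:
  "of_section A u \<kappa> = glinear (2 * rank A)
     (\<lambda>a p. comp (2 * rank A) (double_frame (rank A) (snd (snd \<kappa>))) a p (u p))"
    (is "_ = glinear ?n ?U")
proof (intro ext)
  fix S m p
  have "of_section A u \<kappa> S m p = (\<Sum>a<?n. ?U a p * (if S = {a} \<and> m = {#} then 1 else 0))"
    by (simp add: of_section_def sum_fun_apply gscale_def zeta_def)
  also have "\<dots> = glinear ?n ?U S m p"
  proof (cases "m = {#} \<and> (\<exists>a<?n. S = {a})")
    case True
    then obtain a where a: "a < ?n" "S = {a}" "m = {#}" by blast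
    have "(\<Sum>x<?n. ?U x p * (if S = {x} \<and> m = {#} then 1 else 0)) = (\<Sum>x<?n. if a = x then ?U x p else 0)"
      by (intro sum.cong) (use a in auto)
    then show ?thesis using a by (simp add: glinear_apply)
  next
    case False
    then have "(\<Sum>x<?n. ?U x p * (if S = {x} \<and> m = {#} then 1 else 0)) = 0"
      by (intro sum.neutral) auto
    moreover have "glinear ?n ?U S m p = 0" using False by (auto simp: glinear_def)
    ultimately show ?thesis by simp
  qed
  finally show "of_section A u \<kappa> S m p = glinear ?n ?U S m p" .
qed

lemma coord_deriv_zero: "coord_deriv c i (\<lambda>p. 0) = (\<lambda>p. 0)"
  by (simp add: coord_deriv_def o_def pdiff_const fun_eq_iff)

lemma dpos_glinear: "dpos c i (glinear n U) = glinear n (\<lambda>a. coord_deriv c i (U a))"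
  by (intro ext) (auto simp: dpos_def glinear_def coord_deriv_zero)

lemma dmom_glinear: "dmom i (glinear n U) = (\<lambda>S m p. 0)"
  by (intro ext) (simp add: dmom_def glinear_apply)

lemma insert_eq_singleton_iff: "a \<notin> S \<Longrightarrow> insert a S = {b} \<longleftrightarrow> a = b \<and> S = {}"
  by auto

lemma dzeta_glinear:
  assumes "a < n"
  shows "dzeta_right a (glinear n U) = gscale (U a) gone" "dzeta_left a (glinear n U) = gscale (U a) gone"
  using assms by (auto simp: fun_eq_iff dzeta_right_def dzeta_left_def gscale_def gone_def glinear_def
      insert_eq_singleton_iff)

lemma gmul_zero: "gmul (\<lambda>S m p. 0) G = (\<lambda>S m p. 0)" "gmul F (\<lambda>S m p. 0) = (\<lambda>S m p. 0)"
  by (simp_all add: gmul_def)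

lemma submsets_empty: "{m1. m1 \<subseteq># {#}} = {{#}}"
  by auto

lemma submsets_single: "{m1. m1 \<subseteq># {#i#}} = {{#}, {#i#}}"
proof -
  have "m1 = {#} \<or> m1 = {#i#}" if "m1 \<subseteq># {#i#}" for m1
    using that by (cases m1) (auto simp: insert_subset_eq_iff)
  then show ?thesis by auto
qed

lemma Pow_singleton: "Pow {c} = {{}, {c}}"
  by auto

text \<open>The sign of sorting the pair \<open>(a, c)\<close>, for \<open>a \<noteq> c\<close>.\<close>

definition swap_sign :: "nat \<Rightarrow> nat \<Rightarrow> real" where
  "swap_sign a c = (if c < a then -1 else 1)"

text \<open>The sign of sorting the elements of \<open>S\<close> followed by those of \<open>T\<close>, for disjoint \<open>S\<close> and \<open>T\<close>.\<close>

definition shuffle_sign :: "nat set \<Rightarrow> nat set \<Rightarrow> real" where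
  "shuffle_sign S T = (-1) ^ card {(a, b). a \<in> S \<and> b \<in> T \<and> b < a}"

lemma shuffle_sign_simps [simp]:
  "shuffle_sign {} T = 1" "shuffle_sign S {} = 1" "shuffle_sign {a} {c} = swap_sign a c"
proof -
  have "{(x, y). x \<in> {a} \<and> y \<in> {c} \<and> y < x} = (if c < a then {(a, c)} else {})" by auto
  then show "shuffle_sign {a} {c} = swap_sign a c" by (simp add: shuffle_sign_def swap_sign_def)
qed (simp_all add: shuffle_sign_def)

lemma gmul_shuffle_sign:
  "gmul F G S m p = (\<Sum>S1\<in>Pow S. \<Sum>m1\<in>{m1. m1 \<subseteq># m}.
     shuffle_sign S1 (S - S1) * F S1 m1 p * G (S - S1) (m - m1) p)"
  by (simp add: gmul_def shuffle_sign_def)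

lemma gmul_empty_single:
  "gmul F G {} {#i#} p = F {} {#} p * G {} {#i#} p + F {} {#i#} p * G {} {#} p"
  by (simp add: gmul_shuffle_sign submsets_single)

lemma gmul_single_empty:
  "gmul F G {c} {#} p = F {} {#} p * G {c} {#} p + F {c} {#} p * G {} {#} p"
  by (simp add: gmul_shuffle_sign submsets_empty Pow_singleton)

lemma gmul_pair_empty:
  assumes "a \<noteq> c"
  shows "gmul F G {a, c} {#} p = F {} {#} p * G {a, c} {#} p + F {a, c} {#} p * G {} {#} p
     + swap_sign a c * F {a} {#} p * G {c} {#} p + swap_sign c a * F {c} {#} p * G {a} {#} p"
proof -
  have P: "Pow {a, c} = {{}, {a, c}, {a}, {c}}" by auto
  have D: "{a, c} - {a} = {c}" "{a, c} - {c} = {a}" "{a, c} - {a, c} = {}" using assms by auto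
  show ?thesis
    unfolding gmul_shuffle_sign submsets_empty P using assms
    by (simp add: D doubleton_eq_iff del: Diff_insert)
qed

lemma gmul_gscale_gone:
  assumes "finite S"
  shows "gmul (gscale f gone) G S {#} p = f p * G S {#} p"
    "gmul G (gscale f gone) S {#} p = f p * G S {#} p"
proof -
  have "gmul (gscale f gone) G S {#} p =
      (\<Sum>S1\<in>Pow S. if S1 = {} then f p * G S {#} p else 0)"
    unfolding gmul_shuffle_sign submsets_empty by (intro sum.cong) (auto simp: gscale_def gone_def)
  then show "gmul (gscale f gone) G S {#} p = f p * G S {#} p" using assms by simp
  have "gmul G (gscale f gone) S {#} p =
      (\<Sum>S1\<in>Pow S. if S1 = S then f p * G S {#} p else 0)"
    unfolding gmul_shuffle_sign submsets_empty by (intro sum.cong) (auto simp: gscale_def gone_def)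
  then show "gmul G (gscale f gone) S {#} p = f p * G S {#} p" using assms by simp
qed

lemma gmul_gscale_gone_single:
  "gmul (gscale f gone) G {} {#i#} p = f p * G {} {#i#} p"
  by (simp add: gmul_empty_single) (simp add: gscale_def gone_def)

lemma local_bracket_apply:
  "local_bracket A \<kappa> F G S m p =
     (\<Sum>i<mdim (base A). gmul (dpos (fst \<kappa>) i F) (dmom i G) S m p - gmul (dmom i F) (dpos (fst \<kappa>) i G) S m p) +
     (\<Sum>a<2 * rank A. gmul (dzeta_right a F) (dzeta_left (dual_index (rank A) a) G) S m p)"
proof -
  have "(\<Sum>a<2 * rank A. gmul (dzeta_right a F) (dzeta_left (dual_index (rank A) a) G) S m p) =
     (\<Sum>a<rank A. gmul (dzeta_right (rank A + a) F) (dzeta_left a G) S m p +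
                  gmul (dzeta_right a F) (dzeta_left (rank A + a) G) S m p)"
    unfolding sum_lessThan_double by (simp add: dual_index_def sum.distrib add.commute)
  then show ?thesis by (simp add: local_bracket_def sum_fun_apply)
qed

text \<open>The coefficients of \<open>{u, \<Theta>}\<close>, for \<open>u\<close> of degree 1, that enter \<open>{{u, \<Theta>}, v}\<close>: those of \<open>p\<^sub>i\<close> and of
  \<open>\<zeta>\<^sub>a \<zeta>\<^sub>c\<close>.\<close>

lemma local_bracket_glinear_left:
  fixes A :: "('m, 'v) vbundle"
  defines "n \<equiv> 2 * rank A"
  shows "local_bracket A \<kappa> (glinear n U) \<Theta> {} {#i#} p =
      (\<Sum>b<n. U b p * \<Theta> {dual_index (rank A) b} {#i#} p)"
    and "a < n \<Longrightarrow> c < n \<Longrightarrow> a \<noteq> c \<Longrightarrow> local_bracket A \<kappa> (glinear n U) \<Theta> {a, c} {#} p =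
      (\<Sum>j<mdim (base A). swap_sign a c * coord_deriv (fst \<kappa>) j (U a) p * \<Theta> {c} {#j#} p
         + swap_sign c a * coord_deriv (fst \<kappa>) j (U c) p * \<Theta> {a} {#j#} p) +
      (\<Sum>b<n. U b p * dzeta_left (dual_index (rank A) b) \<Theta> {a, c} {#} p)"
proof -
  show "local_bracket A \<kappa> (glinear n U) \<Theta> {} {#i#} p =
      (\<Sum>b<n. U b p * \<Theta> {dual_index (rank A) b} {#i#} p)"
    unfolding local_bracket_apply dpos_glinear dmom_glinear gmul_zero
    by (simp add: gmul_empty_single[of "glinear _ _"] glinear_apply n_def dzeta_glinear gmul_gscale_gone_single
        dzeta_left_def)
  assume ac: "a < n" "c < n" "a \<noteq> c"
  show "local_bracket A \<kappa> (glinear n U) \<Theta> {a, c} {#} p =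
      (\<Sum>j<mdim (base A). swap_sign a c * coord_deriv (fst \<kappa>) j (U a) p * \<Theta> {c} {#j#} p
         + swap_sign c a * coord_deriv (fst \<kappa>) j (U c) p * \<Theta> {a} {#j#} p) +
      (\<Sum>b<n. U b p * dzeta_left (dual_index (rank A) b) \<Theta> {a, c} {#} p)"
    unfolding local_bracket_apply dpos_glinear dmom_glinear gmul_zero
    using ac by (simp add: gmul_pair_empty[of _ _ "glinear _ _"] glinear_apply n_def[symmetric] dzeta_glinear gmul_gscale_gone dmom_def
        del: One_nat_def)
qed

text \<open>The coefficient of \<open>\<zeta>\<^sub>a \<zeta>\<^sub>b \<zeta>\<^sub>c\<close> in \<open>\<Theta>\<close>, up to a sign that makes it totally antisymmetric in its
  indices.\<close>

definition cubic_coeff :: "'m gfun \<Rightarrow> 'm \<Rightarrow> nat \<Rightarrow> nat \<Rightarrow> nat \<Rightarrow> real" where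
  "cubic_coeff \<Theta> p b a c = dzeta_right a (dzeta_left b \<Theta>) {c} {#} p"

lemma dzeta_right_single: "dzeta_right a H {c} {#} p = (if a = c then 0 else swap_sign c a * H {a, c} {#} p)"
proof -
  have "{b \<in> {c}. a < b} = (if a < c then {c} else {})" by auto
  then show ?thesis by (auto simp: dzeta_right_def swap_sign_def)
qed

lemma cubic_coeff_antisym:
  "cubic_coeff \<Theta> p b a c = - cubic_coeff \<Theta> p b c a"
  "cubic_coeff \<Theta> p b a c = - cubic_coeff \<Theta> p a b c"
proof -
  have card2: "card {x. (x = a \<or> x = c) \<and> x < b} = (if a < b then 1 else 0) + (if c < b then 1 else 0)"
    if "a \<noteq> c" for a b c :: nat
  proof -
    have "{x. (x = a \<or> x = c) \<and> x < b} = (if a < b then {a} else {}) \<union> (if c < b then {c} else {})" by auto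
    then show ?thesis using that by auto
  qed
  have C: "cubic_coeff \<Theta> p b a c = (if a = c \<or> b = a \<or> b = c then 0 else
      swap_sign c a * swap_sign b a * swap_sign b c * \<Theta> {a, b, c} {#} p)" for a b c
    unfolding cubic_coeff_def dzeta_right_single dzeta_left_def
    by (cases "a = c") (auto simp: card2 swap_sign_def insert_commute)
  show "cubic_coeff \<Theta> p b a c = - cubic_coeff \<Theta> p b c a"
    unfolding C by (auto simp: swap_sign_def insert_commute)
  show "cubic_coeff \<Theta> p b a c = - cubic_coeff \<Theta> p a b c"
    unfolding C by (auto simp: swap_sign_def insert_commute)
qed

text \<open>
  The component of \<open>{{u, \<Theta>}, v}\<close> along \<open>\<zeta>\<^sub>c\<close> at a point, in terms of the components \<open>U\<close>, \<open>V\<close> of \<open>u\<close>, \<open>v\<close>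
  there and of their derivatives \<open>dU\<close>, \<open>dV\<close>, where \<open>dU i a\<close> is the derivative of the component \<open>a\<close> in the
  direction of \<open>x\<^sup>i\<close>. Here \<open>T a i\<close> is the coefficient of \<open>\<zeta>\<^sub>a p\<^sub>i\<close> in \<open>\<Theta>\<close>, \<open>C\<close> is the \<^const>\<open>cubic_coeff\<close>
  of \<open>\<Theta>\<close>, \<open>n\<close> and \<open>d\<close> are the numbers of odd coordinates and of base coordinates, and \<open>st\<close> stands for
  \<open>a \<mapsto> a\<^sup>*\<close>. No derivative of a coefficient of \<open>\<Theta>\<close> occurs, since \<open>u\<close> and \<open>v\<close> do not involve the momenta.
\<close>

definition dorfman_comp where
  "dorfman_comp n d st T C U dU V dV c =
     - (\<Sum>i<d. (\<Sum>b<n. U b * T (st b) i) * dV i c) +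
     (\<Sum>a<n. V (st a) * ((\<Sum>i<d. dU i c * T a i - dU i a * T c i) + (\<Sum>b<n. U b * C (st b) a c)))"
  for n d :: nat and st :: "nat \<Rightarrow> nat" and T :: "nat \<Rightarrow> nat \<Rightarrow> real" and C :: "nat \<Rightarrow> nat \<Rightarrow> nat \<Rightarrow> real"
    and U V :: "nat \<Rightarrow> real" and dU dV :: "nat \<Rightarrow> nat \<Rightarrow> real" and c :: nat

lemma local_bracket_dorfman_comp:
  fixes A :: "('m, 'v) vbundle"
  defines "n \<equiv> 2 * rank A"
  assumes c: "c < n"
  shows "local_bracket A \<kappa> (local_bracket A \<kappa> (glinear n U) \<Theta>) (glinear n V) {c} {#} p =
    dorfman_comp n (mdim (base A)) (dual_index (rank A)) (\<lambda>a i. \<Theta> {a} {#i#} p) (cubic_coeff \<Theta> p)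
      (\<lambda>a. U a p) (\<lambda>i a. coord_deriv (fst \<kappa>) i (U a) p) (\<lambda>a. V a p) (\<lambda>i a. coord_deriv (fst \<kappa>) i (V a) p) c"
proof -
  let ?H = "local_bracket A \<kappa> (glinear n U) \<Theta>" and ?st = "dual_index (rank A)"
  let ?d = "mdim (base A)"
  have G: "dzeta_right a ?H {c} {#} p =
      (\<Sum>i<?d. coord_deriv (fst \<kappa>) i (U c) p * \<Theta> {a} {#i#} p - coord_deriv (fst \<kappa>) i (U a) p * \<Theta> {c} {#i#} p)
      + (\<Sum>b<n. U b p * cubic_coeff \<Theta> p (?st b) a c)" if a: "a < n" for a
  proof (cases "a = c")
    case True
    then show ?thesis by (simp add: dzeta_right_single cubic_coeff_def)
  next
    case False
    have s: "swap_sign c a * swap_sign a c = -1" "swap_sign c a * swap_sign c a = 1"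
      using False by (auto simp: swap_sign_def)
    have "dzeta_right a ?H {c} {#} p = swap_sign c a * ?H {a, c} {#} p"
      using False by (simp add: dzeta_right_single)
    also have "\<dots> = (\<Sum>j<?d. (swap_sign c a * swap_sign a c) * (coord_deriv (fst \<kappa>) j (U a) p * \<Theta> {c} {#j#} p)
         + (swap_sign c a * swap_sign c a) * (coord_deriv (fst \<kappa>) j (U c) p * \<Theta> {a} {#j#} p)) +
      (\<Sum>b<n. U b p * (swap_sign c a * dzeta_left (?st b) \<Theta> {a, c} {#} p))"
      using local_bracket_glinear_left(2)[of a A c \<kappa> U \<Theta> p] a c False unfolding n_def[symmetric]
      by (simp add: sum_distrib_left distrib_left ac_simps)
    also have "\<dots> = (\<Sum>i<?d. coord_deriv (fst \<kappa>) i (U c) p * \<Theta> {a} {#i#} p - coord_deriv (fst \<kappa>) i (U a) p * \<Theta> {c} {#i#} p)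
      + (\<Sum>b<n. U b p * cubic_coeff \<Theta> p (?st b) a c)"
      unfolding s using False by (simp add: cubic_coeff_def dzeta_right_single)
    finally show ?thesis .
  qed
  have st: "?st a < n" if "a < n" for a using that by (auto simp: dual_index_def n_def)
  have "local_bracket A \<kappa> ?H (glinear n V) {c} {#} p =
     - (\<Sum>i<?d. ?H {} {#i#} p * coord_deriv (fst \<kappa>) i (V c) p) +
     (\<Sum>a<n. V (?st a) p * dzeta_right a ?H {c} {#} p)"
    unfolding local_bracket_apply[of A \<kappa> ?H] dpos_glinear dmom_glinear gmul_zero
    using c st by (simp add: gmul_single_empty[of "dmom _ _"] glinear_apply dzeta_glinear gmul_gscale_gone
        n_def[symmetric] sum_negf) (simp add: dmom_def)
  also have "\<dots> = dorfman_comp n ?d ?st (\<lambda>a i. \<Theta> {a} {#i#} p) (cubic_coeff \<Theta> p)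
      (\<lambda>a. U a p) (\<lambda>i a. coord_deriv (fst \<kappa>) i (U a) p) (\<lambda>a. V a p) (\<lambda>i a. coord_deriv (fst \<kappa>) i (V a) p) c"
    unfolding dorfman_comp_def using G local_bracket_glinear_left(1)[of A \<kappa> U \<Theta> _ p]
    unfolding n_def[symmetric] by simp
  finally show ?thesis .
qed

text \<open>The coordinate form of \<open>\<langle>[u, v], w\<rangle> + \<langle>[u, w], v\<rangle> = \<rho>(u)\<langle>v, w\<rangle>\<close>. The second summand of
  \<^const>\<open>dorfman_comp\<close> is a matrix, antisymmetric in \<open>a\<close> and \<open>c\<close>, applied to \<open>V\<close>, hence cancels.\<close>

lemma dorfman_comp_metric:
  assumes st: "\<And>f :: nat \<Rightarrow> real. (\<Sum>a<n. f (st a)) = (\<Sum>a<n. f a)" "\<And>a. a < n \<Longrightarrow> st (st a) = a"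
    and C: "\<And>b a c. C b a c = - C b c a"
  shows "(\<Sum>c<n. dorfman_comp n d st T C U dU V dV c * W (st c)) +
         (\<Sum>c<n. dorfman_comp n d st T C U dU W dW c * V (st c)) =
         - (\<Sum>i<d. (\<Sum>b<n. U b * T (st b) i) * (\<Sum>a<n. dV i a * W (st a) + V a * dW i (st a)))"
proof -
  \<comment> \<open>\<open>G\<close> is the antisymmetric matrix, and \<open>- R\<close> is the vector \<open>\<rho>(u)\<close>.\<close>
  define G where "G a c = (\<Sum>i<d. dU i c * T a i - dU i a * T c i) + (\<Sum>b<n. U b * C (st b) a c)" for a c
  define R where "R i = (\<Sum>b<n. U b * T (st b) i)" for i
  have G: "G a c = - G c a" for a c
    unfolding G_def using C[of _ a c] by (simp add: sum_negf[symmetric] algebra_simps)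
  have D: "dorfman_comp n d st T C U dU V dV c = - (\<Sum>i<d. R i * dV i c) + (\<Sum>a<n. V (st a) * G a c)" for V dV c
    by (simp add: dorfman_comp_def G_def R_def)
  have E: "(\<Sum>c<n. dorfman_comp n d st T C U dU V dV c * W (st c)) =
      - (\<Sum>i<d. R i * (\<Sum>c<n. dV i c * W (st c))) + (\<Sum>c<n. \<Sum>a<n. V (st a) * G a c * W (st c))" for V W dV
    unfolding D distrib_right sum.distrib
    by (simp add: sum_distrib_left sum_distrib_right sum_negf mult.assoc sum.swap[of _ "{..<d}"])
  have "(\<Sum>c<n. \<Sum>a<n. V (st a) * G a c * W (st c)) = (\<Sum>a<n. \<Sum>c<n. V (st a) * G a c * W (st c))"
    by (rule sum.swap)
  also have "\<dots> = - (\<Sum>c<n. \<Sum>a<n. W (st a) * G a c * V (st c))"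
    unfolding sum_negf[symmetric] using G by (intro sum.cong refl) (metis minus_mult_left minus_mult_right mult.assoc mult.commute)
  finally have cancel: "(\<Sum>c<n. \<Sum>a<n. V (st a) * G a c * W (st c)) + (\<Sum>c<n. \<Sum>a<n. W (st a) * G a c * V (st c)) = 0"
    by simp
  have re: "(\<Sum>c<n. dW i c * V (st c)) = (\<Sum>a<n. V a * dW i (st a))" for i
    using st(1)[of "\<lambda>c. dW i c * V (st c)", symmetric] st(2) by (simp add: mult.commute)
  show ?thesis
    unfolding E using cancel by (simp add: re R_def[symmetric] sum.distrib distrib_left)
qed

text \<open>The coordinate form of \<open>[u, v] + [v, u] = D\<langle>u, v\<rangle>\<close>.\<close>

lemma dorfman_comp_symmetric_part:
  assumes st: "\<And>f :: nat \<Rightarrow> real. (\<Sum>a<n. f (st a)) = (\<Sum>a<n. f a)" "\<And>a. a < n \<Longrightarrow> st (st a) = a"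
    and C: "\<And>b a c. C b a c = - C a b c"
  shows "dorfman_comp n d st T C U dU V dV c + dorfman_comp n d st T C V dV U dU c =
         - (\<Sum>i<d. T c i * (\<Sum>a<n. dU i a * V (st a) + U a * dV i (st a)))"
proof -
  have E: "dorfman_comp n d st T C U dU V dV c = - (\<Sum>i<d. (\<Sum>b<n. U b * T (st b) i) * dV i c)
     + (\<Sum>i<d. (\<Sum>a<n. V (st a) * T a i) * dU i c) - (\<Sum>i<d. T c i * (\<Sum>a<n. dU i a * V (st a)))
     + (\<Sum>a<n. \<Sum>b<n. V (st a) * U b * C (st b) a c)" for U V dU dV
  proof -
    have "(\<Sum>i<d. (\<Sum>a<n. V (st a) * T a i) * dU i c) = (\<Sum>a<n. V (st a) * (\<Sum>i<d. dU i c * T a i))"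
      unfolding sum_distrib_left sum_distrib_right by (subst sum.swap) (simp add: mult_ac)
    moreover have "(\<Sum>i<d. T c i * (\<Sum>a<n. dU i a * V (st a))) = (\<Sum>a<n. V (st a) * (\<Sum>i<d. dU i a * T c i))"
      unfolding sum_distrib_left by (subst sum.swap) (simp add: mult_ac)
    moreover have "(\<Sum>a<n. \<Sum>b<n. V (st a) * U b * C (st b) a c) = (\<Sum>a<n. V (st a) * (\<Sum>b<n. U b * C (st b) a c))"
      unfolding sum_distrib_left by (simp add: mult_ac)
    ultimately show ?thesis
      unfolding dorfman_comp_def by (simp add: distrib_left sum.distrib sum_subtractf right_diff_distrib)
  qed
  have re: "(\<Sum>b<n. U b * T (st b) i) = (\<Sum>a<n. U (st a) * T a i)" for U i
    using st(1)[of "\<lambda>b. U b * T (st b) i", symmetric] st(2) by simp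
  have re2: "(\<Sum>a<n. dV i a * U (st a)) = (\<Sum>a<n. U a * dV i (st a))" for i
    using st(1)[of "\<lambda>c. dV i c * U (st c)", symmetric] st(2) by (simp add: mult.commute)
  have "(\<Sum>a<n. \<Sum>b<n. U (st a) * V b * C (st b) a c) = (\<Sum>a<n. \<Sum>b<n. U a * V b * C (st b) (st a) c)"
    using st(1)[of "\<lambda>a. \<Sum>b<n. U (st a) * V b * C (st b) a c", symmetric] st(2) by simp
  also have "\<dots> = (\<Sum>a<n. \<Sum>b<n. U a * V (st b) * C b (st a) c)"
  proof (rule sum.cong[OF refl])
    fix a
    show "(\<Sum>b<n. U a * V b * C (st b) (st a) c) = (\<Sum>b<n. U a * V (st b) * C b (st a) c)"
      using st(1)[of "\<lambda>b. U a * V b * C (st b) (st a) c", symmetric] st(2) by simp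
  qed
  also have "\<dots> = (\<Sum>b<n. \<Sum>a<n. U a * V (st b) * C b (st a) c)" by (rule sum.swap)
  also have "\<dots> = - (\<Sum>a<n. \<Sum>b<n. V (st a) * U b * C (st b) a c)"
    unfolding sum_negf[symmetric] using C
    by (intro sum.cong refl) (metis minus_mult_right mult.commute)
  finally have cubic: "(\<Sum>a<n. \<Sum>b<n. U (st a) * V b * C (st b) a c) = - (\<Sum>a<n. \<Sum>b<n. V (st a) * U b * C (st b) a c)" .
  show ?thesis
    unfolding E re cubic re2 sum.distrib distrib_left by (simp add: re2)
qed

lemma dorfman_comp_cong:
  assumes "\<And>a. a < n \<Longrightarrow> U a = U' a" "\<And>a. a < n \<Longrightarrow> V a = V' a"
    "\<And>i a. i < d \<Longrightarrow> a < n \<Longrightarrow> dU i a = dU' i a" "\<And>i a. i < d \<Longrightarrow> a < n \<Longrightarrow> dV i a = dV' i a"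
    "\<And>a. a < n \<Longrightarrow> st a < n" "c < n"
  shows "dorfman_comp n d st T C U dU V dV c = dorfman_comp n d st T C U' dU' V' dV' c"
  unfolding dorfman_comp_def using assms by simp

lemma dorfman_comp_scale:
  "dorfman_comp n d st T C (\<lambda>a. k * U a) (\<lambda>i a. k * dU i a) (\<lambda>a. l * V a) (\<lambda>i a. l * dV i a) c =
     k * l * dorfman_comp n d st T C U dU V dV c"
proof -
  have 1: "(\<Sum>i<d. (\<Sum>b<n. k * U b * T (st b) i) * (l * dV i c)) = k * l * (\<Sum>i<d. (\<Sum>b<n. U b * T (st b) i) * dV i c)"
    unfolding sum_distrib_left sum_distrib_right by (simp add: mult_ac)
  have 2: "(\<Sum>i<d. k * dU i c * T a i - k * dU i a * T c i) = k * (\<Sum>i<d. dU i c * T a i - dU i a * T c i)" for a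
    unfolding sum_distrib_left by (simp add: algebra_simps)
  have 3: "(\<Sum>b<n. k * U b * C (st b) a c) = k * (\<Sum>b<n. U b * C (st b) a c)" for a
    unfolding sum_distrib_left by (simp add: mult_ac)
  show ?thesis
    unfolding dorfman_comp_def 1 2 3 distrib_left[symmetric] sum_distrib_left
    by (simp add: algebra_simps sum_distrib_left sum.distrib)
qed

lemma dorfman_comp_add:
  "dorfman_comp n d st (\<lambda>a i. T a i + T' a i) (\<lambda>b a c. C b a c + C' b a c) U dU V dV c =
   dorfman_comp n d st T C U dU V dV c + dorfman_comp n d st T' C' U dU V dV c"
proof -
  have 1: "(\<Sum>i<d. (\<Sum>b<n. U b * (T (st b) i + T' (st b) i)) * dV i c) =
      (\<Sum>i<d. (\<Sum>b<n. U b * T (st b) i) * dV i c) + (\<Sum>i<d. (\<Sum>b<n. U b * T' (st b) i) * dV i c)"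
    by (simp add: distrib_left distrib_right sum.distrib)
  have 2: "(\<Sum>i<d. dU i c * (T a i + T' a i) - dU i a * (T c i + T' c i)) + (\<Sum>b<n. U b * (C (st b) a c + C' (st b) a c))
     = ((\<Sum>i<d. dU i c * T a i - dU i a * T c i) + (\<Sum>b<n. U b * C (st b) a c))
      + ((\<Sum>i<d. dU i c * T' a i - dU i a * T' c i) + (\<Sum>b<n. U b * C' (st b) a c))" for a
    by (simp add: algebra_simps sum.distrib sum_subtractf)
  show ?thesis unfolding dorfman_comp_def 1 2 by (simp add: distrib_left sum.distrib)
qed

text \<open>
  Let \<open>S\<close> contain exactly one index of each pair \<open>a\<close>, \<open>a\<^sup>*\<close>, and let \<open>u\<close>, \<open>v\<close> be sections of the subbundle
  spanned by the members of the frame with index in \<open>S\<close>. The component along \<open>c \<in> S\<close> of their bracket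
  involves only coefficients of \<open>\<Theta>\<close> with an index outside \<open>S\<close>: those of \<open>\<zeta>\<^sub>a p\<^sub>i\<close> with \<open>a \<notin> S\<close>, and those of
  \<open>\<zeta>\<^sub>a \<zeta>\<^sub>b \<zeta>\<^sub>c\<close> with \<open>a, b \<notin> S\<close>.
\<close>

lemma dorfman_comp_isotropic:
  assumes st: "\<And>a. a < n \<Longrightarrow> st a < n" "\<And>a. a < n \<Longrightarrow> st a \<in> S \<longleftrightarrow> a \<notin> S"
    and U: "\<And>a. a < n \<Longrightarrow> a \<notin> S \<Longrightarrow> U a = 0 \<and> V a = 0 \<and> (\<forall>i<d. dU i a = 0)"
    and T: "\<And>a i. a < n \<Longrightarrow> a \<notin> S \<Longrightarrow> T a i = 0"
    and C: "\<And>a b c. a < n \<Longrightarrow> b < n \<Longrightarrow> c < n \<Longrightarrow> a \<notin> S \<Longrightarrow> b \<notin> S \<Longrightarrow> c \<in> S \<Longrightarrow> C b a c = 0"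
    and c: "c < n" "c \<in> S"
  shows "dorfman_comp n d st T C U dU V dV c = 0"
proof -
  have 1: "U b * T (st b) i = 0" if "b < n" for b i using st U T that by (metis mult_eq_0_iff)
  have 2: "U b * C (st b) a c = 0" if "a < n" "a \<notin> S" "b < n" for a b
    using st U C that c by (metis mult_eq_0_iff)
  have "V (st a) * ((\<Sum>i<d. dU i c * T a i - dU i a * T c i) + (\<Sum>b<n. U b * C (st b) a c)) = 0"
    if "a < n" for a
  proof (cases "a \<in> S")
    case True
    then show ?thesis using st U that by auto
  next
    case False
    have "(\<Sum>i<d. dU i c * T a i - dU i a * T c i) = 0"
      using U T that False by (intro sum.neutral) auto
    moreover have "(\<Sum>b<n. U b * C (st b) a c) = 0"
      using 2 that False by (intro sum.neutral) auto
    ultimately show ?thesis by simp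
  qed
  then have "(\<Sum>a<n. V (st a) * ((\<Sum>i<d. dU i c * T a i - dU i a * T c i) + (\<Sum>b<n. U b * C (st b) a c))) = 0"
    by (intro sum.neutral) auto
  moreover have "(\<Sum>b<n. U b * T (st b) i) = 0" for i using 1 by (intro sum.neutral) auto
  ultimately show ?thesis unfolding dorfman_comp_def by simp
qed


section \<open>The Dorfman bracket of sections\<close>

text \<open>The coordinate system around \<open>p\<close> in which \<^const>\<open>to_section\<close> evaluates elements of \<open>\<A>\<^sup>1\<close> at \<open>p\<close>.\<close>

definition coords_at :: "('m, 'v) vbundle \<Rightarrow> 'm \<Rightarrow> ('m, 'v) coords" where
  "coords_at A p = (SOME \<kappa>. \<kappa> \<in> coord_systems A \<and> p \<in> cdom \<kappa>)"

abbreviation frame_of :: "('m, 'v) vbundle \<Rightarrow> 'm \<Rightarrow> nat \<Rightarrow> 'm \<Rightarrow> 'v" where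
  "frame_of A p \<equiv> snd (snd (coords_at A p))"

lemma coords_at:
  assumes "vector_bundle A"
  shows "fst (coords_at A p) \<in> charts (base A)" "p \<in> fst (fst (coords_at A p))"
    "(fst (snd (coords_at A p)), frame_of A p) \<in> frames A" "p \<in> fst (snd (coords_at A p))"
proof -
  have "p \<in> (\<Union>c\<in>charts (base A). fst c)"
    using vector_bundleD(1)[OF assms] by (simp add: smooth_manifold_def)
  then obtain c where c: "c \<in> charts (base A)" "p \<in> fst c" by auto
  obtain W e where e: "(W, e) \<in> frames A" "p \<in> W" using vector_bundleD(3)[OF assms] by blast
  have "(c, (W, e)) \<in> coord_systems A \<and> p \<in> cdom (c, (W, e))"
    using c e by (simp add: coord_systems_def cdom_def)
  then have "coords_at A p \<in> coord_systems A \<and> p \<in> cdom (coords_at A p)"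
    unfolding coords_at_def by (rule someI)
  then show "fst (coords_at A p) \<in> charts (base A)" "p \<in> fst (fst (coords_at A p))"
    "(fst (snd (coords_at A p)), frame_of A p) \<in> frames A" "p \<in> fst (snd (coords_at A p))"
    by (auto simp: coord_systems_def cdom_def)
qed

text \<open>The components of a section of \<open>A \<oplus> A\<^sup>*\<close> in the coordinates around \<open>p\<close>, as functions of the point \<open>q\<close>,
  and the derivatives of these functions at \<open>p\<close>.\<close>

definition scomp :: "('m, 'v::real_vector) vbundle \<Rightarrow> 'm \<Rightarrow> ('m \<Rightarrow> 'v \<times> ('v \<Rightarrow> real)) \<Rightarrow> nat \<Rightarrow> 'm \<Rightarrow> real" where
  "scomp A p u a q = comp (2 * rank A) (double_frame (rank A) (frame_of A p)) a q (u q)"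

definition scomp_deriv :: "('m, 'v::real_vector) vbundle \<Rightarrow> 'm \<Rightarrow> ('m \<Rightarrow> 'v \<times> ('v \<Rightarrow> real)) \<Rightarrow> nat \<Rightarrow> nat \<Rightarrow> real" where
  "scomp_deriv A p u i a = coord_deriv (fst (coords_at A p)) i (scomp A p u a) p"

text \<open>The components at \<open>p\<close> of the derived bracket of \<open>u\<close> and \<open>v\<close>.\<close>

definition bracket_comp :: "('m, 'v::real_vector) vbundle \<Rightarrow> ('m, 'v) gfamily \<Rightarrow> 'm \<Rightarrow>
    ('m \<Rightarrow> 'v \<times> ('v \<Rightarrow> real)) \<Rightarrow> ('m \<Rightarrow> 'v \<times> ('v \<Rightarrow> real)) \<Rightarrow> nat \<Rightarrow> real" where
  "bracket_comp A \<Theta> p u v = dorfman_comp (2 * rank A) (mdim (base A)) (dual_index (rank A))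
     (\<lambda>a i. \<Theta> (coords_at A p) {a} {#i#} p) (cubic_coeff (\<Theta> (coords_at A p)) p)
     (\<lambda>a. scomp A p u a p) (scomp_deriv A p u) (\<lambda>a. scomp A p v a p) (scomp_deriv A p v)"

lemma derived_bracket_expand:
  "derived_bracket A \<Theta> u v p =
     (\<Sum>c<2 * rank A. bracket_comp A \<Theta> p u v c *\<^sub>R double_frame (rank A) (frame_of A p) c p)"
  unfolding derived_bracket_def to_section_def Let_def coords_at_def[symmetric] big_bracket_def
    of_section_eq_glinear
  by (intro sum.cong refl)
    (simp add: local_bracket_dorfman_comp bracket_comp_def scomp_deriv_def[abs_def] scomp_def[abs_def])

context
  fixes A :: "('m::{t2_space,second_countable_topology}, 'v::real_vector) vbundle"
  assumes A: "vector_bundle A"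
begin

lemma frame_of_at:
  assumes "q \<in> fst (snd (coords_at A p))"
  shows "frame_at (rank A) (frame_of A p) q (fib A q)"
    "frame_at (2 * rank A) (double_frame (rank A) (frame_of A p)) q (fib (double_bundle A) q)"
  using vector_bundleD(5)[OF A coords_at(3)[OF A] assms] frame_at_double(1) by auto

lemma derived_bracket_mem: "derived_bracket A \<Theta> u v p \<in> fib (double_bundle A) p"
proof -
  note f = frame_of_at(2)[OF coords_at(4)[OF A, of p]]
  show ?thesis unfolding derived_bracket_expand
    using frame_at_mem[OF f] frame_at_subspace[OF f] by (intro subspace_sum subspace_scale) auto
qed

lemma comp_derived_bracket:
  "c < 2 * rank A \<Longrightarrow> comp (2 * rank A) (double_frame (rank A) (frame_of A p)) c p (derived_bracket A \<Theta> u v p) =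
     bracket_comp A \<Theta> p u v c"
  unfolding derived_bracket_expand by (rule comp_combination[OF frame_of_at(2)[OF coords_at(4)[OF A]]])

lemma pairing_derived_bracket:
  assumes "w \<in> sections (double_bundle A)"
  shows "pairing (derived_bracket A \<Theta> u v p) (w p) =
    (\<Sum>c<2 * rank A. bracket_comp A \<Theta> p u v c * scomp A p w (dual_index (rank A) c) p)"
proof -
  note f = frame_of_at(1)[OF coords_at(4)[OF A, of p]]
  show ?thesis
    unfolding scomp_def using derived_bracket_mem sectionsD(1)[OF assms, of p]
    by (subst pairing_comps[OF f]) (simp_all add: comp_derived_bracket)
qed

lemma scomp_pdiff:
  assumes "u \<in> sections (double_bundle A)" "a < 2 * rank A" "i < mdim (base A)"
  shows "pdiff i (scomp A p u a \<circ> chart_inv (fst (coords_at A p))) (snd (fst (coords_at A p)) p)"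
proof (rule smooth_on_pdiff[of "base A"])
  have "(fst (snd (coords_at A p)), double_frame (rank A) (frame_of A p)) \<in> frames (double_bundle A)"
    using coords_at(3)[OF A, of p] by force
  from sectionsD(2)[OF assms(1) this] assms(2)
  show "smooth_on (base A) (fst (snd (coords_at A p))) (scomp A p u a)"
    by (simp add: scomp_def[abs_def])
qed (use coords_at[OF A] assms in auto)

lemma pairing_deriv:
  assumes u: "u \<in> sections (double_bundle A)" and v: "v \<in> sections (double_bundle A)"
    and i: "i < mdim (base A)"
  shows "pdiff i ((\<lambda>q. pairing (u q) (v q)) \<circ> chart_inv (fst (coords_at A p))) (snd (fst (coords_at A p)) p)"
    and "coord_deriv (fst (coords_at A p)) i (\<lambda>q. pairing (u q) (v q)) p =
      (\<Sum>a<2 * rank A. scomp_deriv A p u i a * scomp A p v (dual_index (rank A) a) p +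
         scomp A p u a p * scomp_deriv A p v i (dual_index (rank A) a))"
proof -
  let ?c = "fst (coords_at A p)" and ?r = "rank A"
  let ?g = "\<lambda>q. \<Sum>a<2 * ?r. scomp A p u a q * scomp A p v (dual_index ?r a) q"
  have eq: "pairing (u q) (v q) = ?g q" if "q \<in> fst (snd (coords_at A p))" for q
    unfolding scomp_def using pairing_comps[OF frame_of_at(1)[OF that]] sectionsD(1)[OF u] sectionsD(1)[OF v]
    by simp
  have inv: "chart_inv ?c (snd ?c p) = p"
    by (rule chart_inv_apply[OF vector_bundleD(1)[OF A] coords_at(1,2)[OF A]])
  have p: "p \<in> fst ?c \<inter> fst (snd (coords_at A p))" using coords_at(2,4)[OF A] by blast
  note cong = coord_deriv_cong[where f = "\<lambda>q. pairing (u q) (v q)" and g = ?g,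
      OF vector_bundleD(1)[OF A] coords_at(1)[OF A] vector_bundleD(4)[OF A coords_at(3)[OF A]] p i eq]
  have st: "dual_index ?r a < 2 * ?r" if "a < 2 * ?r" for a using that by (auto simp: dual_index_def)
  have 1: "pdiff i (\<lambda>x. scomp A p u a (chart_inv ?c x) * scomp A p v (dual_index ?r a) (chart_inv ?c x)) (snd ?c p)"
    "pderivative i (\<lambda>x. scomp A p u a (chart_inv ?c x) * scomp A p v (dual_index ?r a) (chart_inv ?c x)) (snd ?c p)
     = scomp_deriv A p u i a * scomp A p v (dual_index ?r a) p + scomp A p u a p * scomp_deriv A p v i (dual_index ?r a)"
    if "a < 2 * ?r" for a
    using pdiff_mult[OF scomp_pdiff[OF u that i, of p] scomp_pdiff[OF v st[OF that] i, of p]] inv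
    by (simp_all add: o_def scomp_deriv_def coord_deriv_def)
  from pdiff_sum[of "{..<2 * ?r}", OF 1(1)] have 2: "pdiff i (?g \<circ> chart_inv ?c) (snd ?c p)"
    "coord_deriv ?c i ?g p = (\<Sum>a<2 * ?r. scomp_deriv A p u i a * scomp A p v (dual_index ?r a) p +
         scomp A p u a p * scomp_deriv A p v i (dual_index ?r a))"
    using 1(2) by (simp_all add: o_def coord_deriv_def)
  show "pdiff i ((\<lambda>q. pairing (u q) (v q)) \<circ> chart_inv ?c) (snd ?c p)"
    by (rule iffD2[OF cong(2) 2(1)])
  show "coord_deriv ?c i (\<lambda>q. pairing (u q) (v q)) p =
      (\<Sum>a<2 * ?r. scomp_deriv A p u i a * scomp A p v (dual_index ?r a) p +
         scomp A p u a p * scomp_deriv A p v i (dual_index ?r a))"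
    by (rule trans[OF cong(1) 2(2)])
qed

text \<open>The derivative \<open>\<rho>(u) f = {{u, \<Theta>}, f}\<close> at \<open>p\<close>; the sign is that of \<open>{p\<^sub>i, x\<^sup>i} = -1\<close>.\<close>

definition anchor_deriv :: "('m, 'v) gfamily \<Rightarrow> 'm \<Rightarrow> ('m \<Rightarrow> 'v \<times> ('v \<Rightarrow> real)) \<Rightarrow> ('m \<Rightarrow> real) \<Rightarrow> real" where
  "anchor_deriv \<Theta> p u f = - (\<Sum>i<mdim (base A).
     (\<Sum>b<2 * rank A. scomp A p u b p * \<Theta> (coords_at A p) {dual_index (rank A) b} {#i#} p) *
     coord_deriv (fst (coords_at A p)) i f p)"

text \<open>The value at \<open>p\<close> of the section \<open>D f\<close> of \<open>A \<oplus> A\<^sup>*\<close> given by \<open>\<langle>D f, w\<rangle> = \<rho>(w) f\<close>.\<close>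

definition courant_grad :: "('m, 'v) gfamily \<Rightarrow> 'm \<Rightarrow> ('m \<Rightarrow> real) \<Rightarrow> 'v \<times> ('v \<Rightarrow> real)" where
  "courant_grad \<Theta> p f = (\<Sum>c<2 * rank A.
     - (\<Sum>i<mdim (base A). \<Theta> (coords_at A p) {c} {#i#} p * coord_deriv (fst (coords_at A p)) i f p) *\<^sub>R
     double_frame (rank A) (frame_of A p) c p)"

lemma derived_bracket_metric:
  assumes v: "v \<in> sections (double_bundle A)" and w: "w \<in> sections (double_bundle A)"
  shows "pairing (derived_bracket A \<Theta> u v p) (w p) + pairing (derived_bracket A \<Theta> u w p) (v p) =
    anchor_deriv \<Theta> p u (\<lambda>q. pairing (v q) (w q))"
proof -
  have "anchor_deriv \<Theta> p u (\<lambda>q. pairing (v q) (w q)) = - (\<Sum>i<mdim (base A).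
     (\<Sum>b<2 * rank A. scomp A p u b p * \<Theta> (coords_at A p) {dual_index (rank A) b} {#i#} p) *
     (\<Sum>a<2 * rank A. scomp_deriv A p v i a * scomp A p w (dual_index (rank A) a) p +
         scomp A p v a p * scomp_deriv A p w i (dual_index (rank A) a)))"
    unfolding anchor_deriv_def by (simp add: pairing_deriv(2)[OF v w])
  also have "\<dots> = (\<Sum>c<2 * rank A. bracket_comp A \<Theta> p u v c * scomp A p w (dual_index (rank A) c) p) +
      (\<Sum>c<2 * rank A. bracket_comp A \<Theta> p u w c * scomp A p v (dual_index (rank A) c) p)"
    unfolding bracket_comp_def
    by (rule dorfman_comp_metric[OF sum_dual_index dual_index_dual_index cubic_coeff_antisym(1), symmetric])
  finally show ?thesis by (simp add: pairing_derived_bracket[OF v] pairing_derived_bracket[OF w])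
qed

lemma derived_bracket_symmetric_part:
  assumes u: "u \<in> sections (double_bundle A)" and v: "v \<in> sections (double_bundle A)"
  shows "derived_bracket A \<Theta> u v p + derived_bracket A \<Theta> v u p = courant_grad \<Theta> p (\<lambda>q. pairing (u q) (v q))"
proof -
  have "bracket_comp A \<Theta> p u v c + bracket_comp A \<Theta> p v u c =
      - (\<Sum>i<mdim (base A). \<Theta> (coords_at A p) {c} {#i#} p *
        coord_deriv (fst (coords_at A p)) i (\<lambda>q. pairing (u q) (v q)) p)" for c
    using dorfman_comp_symmetric_part[where st = "dual_index (rank A)" and C = "cubic_coeff (\<Theta> (coords_at A p)) p",
        OF sum_dual_index dual_index_dual_index cubic_coeff_antisym(2)]
    by (simp add: bracket_comp_def pairing_deriv(2)[OF u v])
  then show ?thesis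
    unfolding derived_bracket_expand courant_grad_def sum.distrib[symmetric] scaleR_add_left[symmetric] by simp
qed

lemma coord_deriv_uminus_pairing:
  assumes u: "u \<in> sections (double_bundle A)" and v: "v \<in> sections (double_bundle A)"
    and i: "i < mdim (base A)"
  shows "coord_deriv (fst (coords_at A p)) i (\<lambda>q. - pairing (u q) (v q)) p =
     - coord_deriv (fst (coords_at A p)) i (\<lambda>q. pairing (u q) (v q)) p"
  using pdiff_mult(2)[OF pdiff_const(1)[of i "-1"] pairing_deriv(1)[OF u v i, of p]]
  by (simp add: coord_deriv_def o_def pdiff_const)

lemma uminus_pairing:
  assumes u: "u \<in> sections (double_bundle A)" and v: "v \<in> sections (double_bundle A)"
  shows "anchor_deriv \<Theta> p w (\<lambda>q. - pairing (u q) (v q)) = - anchor_deriv \<Theta> p w (\<lambda>q. pairing (u q) (v q))"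
    "courant_grad \<Theta> p (\<lambda>q. - pairing (u q) (v q)) = - courant_grad \<Theta> p (\<lambda>q. pairing (u q) (v q))"
  by (simp_all add: anchor_deriv_def courant_grad_def coord_deriv_uminus_pairing[OF u v] sum_negf)

lemma scomp_scale:
  assumes u: "u \<in> sections (double_bundle A)" and a: "a < 2 * rank A"
  shows "scomp A p (\<lambda>q. k *\<^sub>R u q) a p = k * scomp A p u a p"
    "i < mdim (base A) \<Longrightarrow> scomp_deriv A p (\<lambda>q. k *\<^sub>R u q) i a = k * scomp_deriv A p u i a"
proof -
  have eq: "scomp A p (\<lambda>q. k *\<^sub>R u q) a q = k * scomp A p u a q" if "q \<in> fst (snd (coords_at A p))" for q
    unfolding scomp_def by (rule comp_scale[OF frame_of_at(2)[OF that] sectionsD(1)[OF u]])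
  then show "scomp A p (\<lambda>q. k *\<^sub>R u q) a p = k * scomp A p u a p" using coords_at(4)[OF A] by blast
  assume i: "i < mdim (base A)"
  have "coord_deriv (fst (coords_at A p)) i (scomp A p (\<lambda>q. k *\<^sub>R u q) a) p =
      coord_deriv (fst (coords_at A p)) i (\<lambda>q. k * scomp A p u a q) p"
    by (rule coord_deriv_cong(1)[OF vector_bundleD(1)[OF A] coords_at(1)[OF A]
      vector_bundleD(4)[OF A coords_at(3)[OF A]] _ i eq]) (use coords_at[OF A] in auto)
  also have "\<dots> = k * coord_deriv (fst (coords_at A p)) i (scomp A p u a) p"
    using pdiff_mult(2)[OF pdiff_const(1)[of i k] scomp_pdiff[OF u a i, of p]]
    by (simp add: coord_deriv_def o_def pdiff_const)
  finally show "scomp_deriv A p (\<lambda>q. k *\<^sub>R u q) i a = k * scomp_deriv A p u i a"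
    by (simp add: scomp_deriv_def)
qed

lemma derived_bracket_scale:
  assumes u: "u \<in> sections (double_bundle A)" and v: "v \<in> sections (double_bundle A)"
  shows "derived_bracket A \<Theta> (\<lambda>q. k *\<^sub>R u q) (\<lambda>q. l *\<^sub>R v q) p = (k * l) *\<^sub>R derived_bracket A \<Theta> u v p"
proof -
  have "bracket_comp A \<Theta> p (\<lambda>q. k *\<^sub>R u q) (\<lambda>q. l *\<^sub>R v q) c = k * l * bracket_comp A \<Theta> p u v c"
    if "c < 2 * rank A" for c
    unfolding bracket_comp_def dorfman_comp_scale[symmetric]
    by (rule dorfman_comp_cong) (use that in \<open>auto simp: scomp_scale[OF u] scomp_scale[OF v] dual_index_def\<close>)
  then show ?thesis unfolding derived_bracket_expand by (simp add: scaleR_sum_right)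
qed

lemma derived_bracket_add:
  "derived_bracket A (\<Theta> + \<Theta>') u v p = derived_bracket A \<Theta> u v p + derived_bracket A \<Theta>' u v p"
proof -
  have C: "cubic_coeff ((\<Theta> + \<Theta>') \<kappa>) p = (\<lambda>b a c. cubic_coeff (\<Theta> \<kappa>) p b a c + cubic_coeff (\<Theta>' \<kappa>) p b a c)" for \<kappa>
    by (auto simp: fun_eq_iff cubic_coeff_def dzeta_right_def dzeta_left_def algebra_simps)
  have "bracket_comp A (\<Theta> + \<Theta>') p u v c = bracket_comp A \<Theta> p u v c + bracket_comp A \<Theta>' p u v c" for c
    unfolding bracket_comp_def C dorfman_comp_add[symmetric] by simp
  then show ?thesis unfolding derived_bracket_expand by (simp add: scaleR_add_left sum.distrib)
qed

lemma bracket_comp_isotropic: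
  assumes S: "\<And>a. a < 2 * rank A \<Longrightarrow> dual_index (rank A) a \<in> S \<longleftrightarrow> a \<notin> S"
    and u: "\<And>q a. q \<in> fst (snd (coords_at A p)) \<Longrightarrow> a < 2 * rank A \<Longrightarrow> a \<notin> S \<Longrightarrow> scomp A p u a q = 0"
    and v: "\<And>q a. q \<in> fst (snd (coords_at A p)) \<Longrightarrow> a < 2 * rank A \<Longrightarrow> a \<notin> S \<Longrightarrow> scomp A p v a q = 0"
    and T: "\<And>a i. a < 2 * rank A \<Longrightarrow> a \<notin> S \<Longrightarrow> \<Theta> (coords_at A p) {a} {#i#} p = 0"
    and C: "\<And>a b c. a < 2 * rank A \<Longrightarrow> b < 2 * rank A \<Longrightarrow> c < 2 * rank A \<Longrightarrow>
      a \<notin> S \<Longrightarrow> b \<notin> S \<Longrightarrow> c \<in> S \<Longrightarrow> \<Theta> (coords_at A p) {a, b, c} {#} p = 0"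
    and c: "c < 2 * rank A" "c \<in> S"
  shows "bracket_comp A \<Theta> p u v c = 0"
  unfolding bracket_comp_def
proof (rule dorfman_comp_isotropic[where S = S])
  show "dual_index (rank A) a < 2 * rank A" if "a < 2 * rank A" for a using that by (auto simp: dual_index_def)
  show "dual_index (rank A) a \<in> S \<longleftrightarrow> a \<notin> S" if "a < 2 * rank A" for a by (rule S[OF that])
  fix a assume a: "a < 2 * rank A" "a \<notin> S"
  show "\<Theta> (coords_at A p) {a} {#i#} p = 0" for i by (rule T[OF a])
  have "scomp_deriv A p u i a = coord_deriv (fst (coords_at A p)) i (\<lambda>q. 0) p" if "i < mdim (base A)" for i
    unfolding scomp_deriv_def
    by (rule coord_deriv_cong(1)[OF vector_bundleD(1)[OF A] coords_at(1)[OF A]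
      vector_bundleD(4)[OF A coords_at(3)[OF A]] _ that u[OF _ a]]) (use coords_at[OF A] in auto)
  then show "scomp A p u a p = 0 \<and> scomp A p v a p = 0 \<and> (\<forall>i<mdim (base A). scomp_deriv A p u i a = 0)"
    using u[OF coords_at(4)[OF A] a] v[OF coords_at(4)[OF A] a] by (simp add: coord_deriv_zero)
  fix b c assume b: "b < 2 * rank A" "c < 2 * rank A" "b \<notin> S" "c \<in> S"
  have "\<Theta> (coords_at A p) (insert b {a, c}) {#} p = 0"
    using C[OF b(1) a(1) b(2,3) a(2) b(4)] by simp
  then show "cubic_coeff (\<Theta> (coords_at A p)) p b a c = 0"
    unfolding cubic_coeff_def dzeta_right_single by (simp add: dzeta_left_def)
qed (use c in auto)

lemma pairing_nondegenerate:
  assumes z: "z \<in> fib (double_bundle A) p" and z': "z' \<in> fib (double_bundle A) p"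
    and eq: "\<And>w. w \<in> sections (double_bundle A) \<Longrightarrow> pairing z (w p) = pairing z' (w p)"
  shows "z = z'"
proof (rule comp_eqI[OF frame_of_at(2)[OF coords_at(4)[OF A, of p]] z z'])
  let ?r = "rank A" and ?E = "double_frame (rank A) (frame_of A p)"
  note f = frame_of_at(2)[OF coords_at(4)[OF A, of p]]
  fix a assume a: "a < 2 * ?r"
  then have b: "dual_index ?r a < rank (double_bundle A)" by (auto simp: dual_index_def)
  have "(fst (snd (coords_at A p)), ?E) \<in> frames (double_bundle A)"
    using coords_at(3)[OF A, of p] by force
  then obtain w k where w: "w \<in> sections (double_bundle A)" "k \<noteq> 0" "w p = k *\<^sub>R ?E (dual_index ?r a) p"
    using section_through_frame[OF vector_bundle_double[OF A] _ coords_at(4)[OF A] b] by blast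
  have "pairing y (w p) = comp (2 * ?r) ?E a p y * k" if y: "y \<in> fib (double_bundle A) p" for y
  proof -
    have "pairing y (w p) = (\<Sum>x<2 * ?r. comp (2 * ?r) ?E x p y * comp (2 * ?r) ?E (dual_index ?r x) p (w p))"
      using pairing_comps[OF frame_of_at(1)[OF coords_at(4)[OF A]]] y sectionsD(1)[OF w(1), of p] by simp
    also have "\<dots> = (\<Sum>x<2 * ?r. if x = a then comp (2 * ?r) ?E x p y * k else 0)"
    proof (intro sum.cong refl)
      fix x assume x: "x \<in> {..<2 * ?r}"
      then have x': "dual_index ?r x < 2 * ?r" by (auto simp: dual_index_def)
      have "dual_index ?r x = dual_index ?r a \<longleftrightarrow> x = a"
        using a x dual_index_dual_index by (metis lessThan_iff)
      then have "comp (2 * ?r) ?E (dual_index ?r x) p (w p) = (if x = a then k else 0)"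
        unfolding w(3) using comp_scale[OF f frame_at_mem[OF f]] comp_frame[OF f x'] b by simp
      then show "comp (2 * ?r) ?E x p y * comp (2 * ?r) ?E (dual_index ?r x) p (w p) =
          (if x = a then comp (2 * ?r) ?E x p y * k else 0)" by simp
    qed
    finally show ?thesis using a by simp
  qed
  from this[OF z] this[OF z'] eq[OF w(1)] w(2)
  show "comp (2 * ?r) ?E a p z = comp (2 * ?r) ?E a p z'" by simp
qed

lemma pairing_add_left:
  assumes "z \<in> fib (double_bundle A) p" "z' \<in> fib (double_bundle A) p" "w \<in> fib (double_bundle A) p"
  shows "pairing (z + z') w = pairing z w + pairing z' w"
  using assms by (auto simp: pairing_def dual_space_def)

lemma pairing_diff_left:
  assumes "z \<in> fib (double_bundle A) p" "z' \<in> fib (double_bundle A) p" "w \<in> fib (double_bundle A) p"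
  shows "pairing (z - z') w = pairing z w - pairing z' w"
proof -
  have "z - z' \<in> fib (double_bundle A) p"
    using assms(1,2) vector_bundleD(2)[OF vector_bundle_double[OF A]] by (rule subspace_diff[rotated 1])
  from pairing_add_left[OF this assms(2,3)] show ?thesis by simp
qed


section \<open>The square of a Nijenhuis tensor\<close>

text \<open>
  For \<open>[u, \<N>\<^sup>2 v] = \<N>\<^sup>2 [u, v]\<close>, the torsion \<open>\<T>\<close> of \<open>\<N>\<close> is paired with sections:
  \<open>\<langle>\<T>(u, v), w\<rangle> + \<langle>\<T>(u, w), v\<rangle> = \<langle>\<N>\<^sup>2 [u, v] - [u, \<N>\<^sup>2 v], w\<rangle>\<close>, because the derivatives of pairings that
  arise cancel by skew-symmetry. Then \<open>\<T>(u, v) + \<T>(v, u) = 0\<close> gives \<open>D\<langle>u, \<N>\<^sup>2 v\<rangle> = \<N>\<^sup>2 D\<langle>u, v\<rangle>\<close>, and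
  \<open>[\<N>\<^sup>2 u, v] = \<N>\<^sup>2 [u, v]\<close> follows by exchanging the arguments.
\<close>

lemma nijenhuis_square_commutes:
  assumes nij: "nijenhuis_tensor A \<Theta> \<N>"
    and u: "u \<in> sections (double_bundle A)" and v: "v \<in> sections (double_bundle A)"
  defines "\<phi> \<equiv> \<lambda>p x. \<N> p (\<N> p x)"
  shows "derived_bracket A \<Theta> u (app \<phi> v) = app \<phi> (derived_bracket A \<Theta> u v)"
    and "derived_bracket A \<Theta> (app \<phi> u) v = app \<phi> (derived_bracket A \<Theta> u v)"
proof -
  let ?E = "double_bundle A" and ?br = "derived_bracket A \<Theta>"
  note E = vector_bundle_double[OF A]
  have N: "\<N> \<in> endos ?E"
    and skew: "\<And>p x y. x \<in> fib ?E p \<Longrightarrow> y \<in> fib ?E p \<Longrightarrow> pairing (\<N> p x) y = - pairing x (\<N> p y)"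
    and tor: "\<And>u v. u \<in> sections ?E \<Longrightarrow> v \<in> sections ?E \<Longrightarrow> torsion ?br \<N> u v = 0"
    using nij by (auto simp: nijenhuis_tensor_def Let_def eq_neg_iff_add_eq_0)
  note Nmem = endosD(1)[OF N] and Nadd = endosD(3)[OF N]
  have Numinus: "\<N> p (- x) = - \<N> p x" if "x \<in> fib ?E p" for p x
    using endosD(2)[OF N that, of "-1"] by simp
  have Ndiff: "\<N> p (x - y) = \<N> p x - \<N> p y" if "x \<in> fib ?E p" "y \<in> fib ?E p" for p x y
    using Nadd[OF that(1) subspace_neg[OF vector_bundleD(2)[OF E] that(2)]] Numinus[OF that(2)] by simp
  note app = app_section[OF E N]
  have mem: "?br x y p \<in> fib ?E p" for x y p by (rule derived_bracket_mem)
  have smem: "x p \<in> fib ?E p" if "x \<in> sections ?E" for x p by (rule sectionsD(1)[OF that])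
  have tor_at: "?br (app \<N> x) (app \<N> y) p =
      \<N> p (?br (app \<N> x) y p + ?br x (app \<N> y) p - \<N> p (?br x y p))"
    if "x \<in> sections ?E" "y \<in> sections ?E" for x y p
    using fun_cong[OF tor[OF that], of p] by (simp add: torsion_def app_def)
  have tor_pairing: "pairing (?br (app \<N> x) (app \<N> y) p) z + pairing (?br (app \<N> x) y p) (\<N> p z) +
      pairing (?br x (app \<N> y) p) (\<N> p z) + pairing (?br x y p) (\<N> p (\<N> p z)) = 0"
    if "x \<in> sections ?E" "y \<in> sections ?E" "z \<in> fib ?E p" for x y z p
  proof -
    have m: "?br (app \<N> x) y p + ?br x (app \<N> y) p - \<N> p (?br x y p) \<in> fib ?E p"
      "?br (app \<N> x) y p + ?br x (app \<N> y) p \<in> fib ?E p"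
      by (intro subspace_diff[OF vector_bundleD(2)[OF E]] subspace_add[OF vector_bundleD(2)[OF E]] Nmem mem)+
    show ?thesis
      unfolding tor_at[OF that(1,2)] skew[OF m(1) that(3)]
      using pairing_diff_left[OF m(2) Nmem[OF mem] Nmem[OF that(3)], of x y]
        pairing_add_left[OF mem mem Nmem[OF that(3)], of "app \<N> x" y x "app \<N> y"]
        skew[OF mem[of x y p] Nmem[OF that(3)]] by linarith
  qed
  have phi: "app \<phi> x = app \<N> (app \<N> x)" for x by (simp add: \<phi>_def app_def)
  have skew_sec: "(\<lambda>q. pairing (app \<N> x q) (y q)) = (\<lambda>q. - pairing (x q) (app \<N> y q))"
    if "x \<in> sections ?E" "y \<in> sections ?E" for x y
    using skew smem that by (simp add: app_def fun_eq_iff)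
  have right: "?br x (app \<phi> y) p = \<N> p (\<N> p (?br x y p))"
    if x: "x \<in> sections ?E" and y: "y \<in> sections ?E" for x y p
  proof (rule pairing_nondegenerate[OF mem Nmem[OF Nmem[OF mem]]])
    fix w assume w: "w \<in> sections ?E"
    have ap: "app \<N> s p = \<N> p (s p)" for s by (simp add: app_def)
    note met = derived_bracket_metric[of _ _ \<Theta> _ p]
    have m1: "pairing (?br (app \<N> x) (app \<N> y) p) (w p) + pairing (?br (app \<N> x) w p) (\<N> p (y p)) =
        - anchor_deriv \<Theta> p (app \<N> x) (\<lambda>q. pairing (y q) (app \<N> w q))"
      using met[OF app[OF y] w, of "app \<N> x"] uminus_pairing(1)[OF y app[OF w]]
      unfolding skew_sec[OF y w] ap by simp
    have m2: "pairing (?br (app \<N> x) y p) (\<N> p (w p)) + pairing (?br (app \<N> x) (app \<N> w) p) (y p) =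
        anchor_deriv \<Theta> p (app \<N> x) (\<lambda>q. pairing (y q) (app \<N> w q))"
      using met[OF y app[OF w], of "app \<N> x"] unfolding ap .
    have m3: "pairing (?br x (app \<N> y) p) (\<N> p (w p)) + pairing (?br x (app \<N> w) p) (\<N> p (y p)) =
        anchor_deriv \<Theta> p x (\<lambda>q. pairing (app \<N> y q) (app \<N> w q))"
      using met[OF app[OF y] app[OF w], of x] unfolding ap .
    have m4: "pairing (?br x (app \<phi> y) p) (w p) + pairing (?br x w p) (\<N> p (\<N> p (y p))) =
        - anchor_deriv \<Theta> p x (\<lambda>q. pairing (app \<N> y q) (app \<N> w q))"
      using met[OF app[OF app[OF y]] w, of x] uminus_pairing(1)[OF app[OF y] app[OF w]]
      unfolding phi skew_sec[OF app[OF y] w] ap by simp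
    have m5: "pairing (\<N> p (\<N> p (?br x y p))) (w p) = pairing (?br x y p) (\<N> p (\<N> p (w p)))"
      using skew[OF Nmem[OF mem[of x y p]] smem[OF w]] skew[OF mem[of x y p] Nmem[OF smem[OF w]]] by linarith
    show "pairing (?br x (app \<phi> y) p) (w p) = pairing (\<N> p (\<N> p (?br x y p))) (w p)"
      using tor_pairing[OF x y smem[OF w], of p] tor_pairing[OF x w smem[OF y], of p] m1 m2 m3 m4 m5
      by linarith
  qed
  show "?br u (app \<phi> v) = app \<phi> (?br u v)"
    using right[OF u v] by (simp add: fun_eq_iff app_def \<phi>_def)
  have left: "?br (app \<phi> u) v p = \<N> p (\<N> p (?br u v p))" for p
  proof -
    let ?D = "\<lambda>x y. courant_grad \<Theta> p (\<lambda>q. pairing (x q) (y q))"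
    note sym = derived_bracket_symmetric_part[of _ _ \<Theta> p]
    have Dskew: "?D (app \<N> x) y = - ?D x (app \<N> y)" if "x \<in> sections ?E" "y \<in> sections ?E" for x y
      unfolding skew_sec[OF that] by (rule uminus_pairing(2)[OF that(1) app[OF that(2)]])
    have "?D (app \<N> u) (app \<N> v) = ?br (app \<N> u) (app \<N> v) p + ?br (app \<N> v) (app \<N> u) p"
      by (rule sym[OF app[OF u] app[OF v], symmetric])
    also have "\<dots> = \<N> p (?br (app \<N> u) v p) + \<N> p (?br u (app \<N> v) p) - \<N> p (\<N> p (?br u v p)) +
        (\<N> p (?br (app \<N> v) u p) + \<N> p (?br v (app \<N> u) p) - \<N> p (\<N> p (?br v u p)))"
    proof -
      have *: "?br (app \<N> x) (app \<N> y) p =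
          \<N> p (?br (app \<N> x) y p) + \<N> p (?br x (app \<N> y) p) - \<N> p (\<N> p (?br x y p))"
        if "x \<in> sections ?E" "y \<in> sections ?E" for x y
        using tor_at[OF that, of p] Ndiff[OF subspace_add[OF vector_bundleD(2)[OF E] mem mem] Nmem[OF mem]]
          Nadd[OF mem mem] by metis
      show ?thesis unfolding *[OF u v] *[OF v u] ..
    qed
    also have "\<dots> = (\<N> p (?br (app \<N> u) v p) + \<N> p (?br v (app \<N> u) p)) +
        (\<N> p (?br u (app \<N> v) p) + \<N> p (?br (app \<N> v) u p)) - (\<N> p (\<N> p (?br u v p)) + \<N> p (\<N> p (?br v u p)))"
      by (simp add: algebra_simps)
    also have "\<dots> = \<N> p (?D (app \<N> u) v) + \<N> p (?D u (app \<N> v)) - \<N> p (\<N> p (?D u v))"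
      using sym[OF app[OF u] v] sym[OF u app[OF v]] sym[OF u v] Nadd[OF mem mem] Nadd[OF Nmem[OF mem] Nmem[OF mem]]
      by metis
    also have "\<N> p (?D (app \<N> u) v) = - \<N> p (?D u (app \<N> v))"
    proof -
      have "?D u (app \<N> v) \<in> fib ?E p"
        using subspace_add[OF vector_bundleD(2)[OF E] mem mem] sym[OF u app[OF v]] by metis
      then show ?thesis unfolding Dskew[OF u v] by (rule Numinus)
    qed
    finally have 1: "?D u (app \<phi> v) = \<N> p (\<N> p (?D u v))"
      using Dskew[OF u app[OF v]] by (simp add: phi)
    have "?D (app \<phi> u) v = ?D u (app \<phi> v)"
      unfolding phi Dskew[OF app[OF u] v] Dskew[OF u app[OF v]] by simp
    then have "?br (app \<phi> u) v p + ?br v (app \<phi> u) p = \<N> p (\<N> p (?D u v))"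
      using sym[OF app[OF app[OF u]] v] 1 by (simp add: phi)
    also have "?D u v = ?br u v p + ?br v u p" by (rule sym[OF u v, symmetric])
    also have "\<N> p (\<N> p (?br u v p + ?br v u p)) = \<N> p (\<N> p (?br u v p)) + \<N> p (\<N> p (?br v u p))"
      using Nadd[OF mem mem] Nadd[OF Nmem[OF mem] Nmem[OF mem]] by metis
    finally show ?thesis unfolding right[OF v u] by simp
  qed
  then show "?br (app \<phi> u) v = app \<phi> (?br u v)"
    by (simp add: fun_eq_iff app_def \<phi>_def)
qed

end


section \<open>Restriction to the two summands\<close>

lemma zero_section: "vector_bundle B \<Longrightarrow> (\<lambda>p. 0) \<in> sections B"
  by (auto simp: sections_def comp_zero smooth_on_const intro: subspace_0 vector_bundleD(2))

lemma pair_section: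
  assumes A: "vector_bundle A" and X: "X \<in> sections A" and \<xi>: "\<xi> \<in> sections (dual_bundle A)"
  shows "(\<lambda>p. (X p, \<xi> p)) \<in> sections (double_bundle A)"
proof -
  let ?r = "rank A"
  have m: "X p \<in> fib A p" "\<xi> p \<in> dual_space (fib A p)" for p
    using sectionsD(1)[OF X, of p] sectionsD(1)[OF \<xi>, of p] by simp_all
  have "smooth_on (base A) W (\<lambda>p. comp (2 * ?r) (double_frame ?r e) a p (X p, \<xi> p))"
    if h: "(W, e) \<in> frames A" "a < 2 * ?r" for W e a
  proof (rule smooth_on_cong[OF vector_bundleD(1)[OF A] vector_bundleD(4)[OF A h(1)]])
    have d: "(W, dual_frame ?r e) \<in> frames (dual_bundle A)" using h(1) by force
    show "smooth_on (base A) W (\<lambda>p. if a < ?r then comp ?r e a p (X p)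
        else comp ?r (dual_frame ?r e) (a - ?r) p (\<xi> p))"
      using sectionsD(2)[OF X h(1)] sectionsD(2)[OF \<xi> d, of "a - ?r"] h(2) by (cases "a < ?r") simp_all
    fix p assume p: "p \<in> W"
    note f = vector_bundleD(5)[OF A h(1) p]
    show "(if a < ?r then comp ?r e a p (X p) else comp ?r (dual_frame ?r e) (a - ?r) p (\<xi> p)) =
        comp (2 * ?r) (double_frame ?r e) a p (X p, \<xi> p)"
      using frame_at_double(2)[OF f m h(2)] frame_at_dual(2)[OF f m(2), of "a - ?r"] h(2) by simp
  qed
  then show ?thesis using m by (auto simp: sections_def)
qed

text \<open>\<open>\<gamma>\<close> does not contribute to the component in \<open>A\<close> of the bracket of two sections of \<open>A\<close>.\<close>

lemma fst_derived_bracket_dual_lie_algebroid: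
  assumes A: "vector_bundle A" and g: "dual_lie_algebroid A \<gamma>"
    and X: "X \<in> sections A" and Y: "Y \<in> sections A"
  shows "fst (derived_bracket A \<gamma> (\<lambda>p. (X p, 0)) (\<lambda>p. (Y p, 0)) p) = 0"
proof -
  let ?r = "rank A" and ?\<kappa> = "coords_at A p"
  have \<kappa>: "?\<kappa> \<in> coord_systems A" "p \<in> cdom ?\<kappa>"
    using coords_at[OF A, of p] by (cases "?\<kappa>"; auto simp: coord_systems_def cdom_def)+
  have mono: "\<gamma> ?\<kappa> S m p = 0"
    if "(S, m) \<notin> {({a}, {#i#}) |a i. a < ?r} \<union> {({a, b, ?r + c}, {#}) |a b c. a < b \<and> b < ?r}" for S m
    using g \<kappa> that unfolding dual_lie_algebroid_def only_monomials_def Let_def by blast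
  have s: "scomp A p (\<lambda>p. (Z p, 0)) a q = 0"
    if "Z \<in> sections A" "q \<in> fst (snd ?\<kappa>)" "a < 2 * ?r" "a \<notin> {..<?r}" for Z q a
    using frame_at_double(2)[OF frame_of_at(1)[OF A that(2)] sectionsD(1)[OF that(1)]
        subspace_0[OF subspace_dual_space[OF vector_bundleD(2)[OF A]]] that(3)] that(4)
    by (simp add: scomp_def)
  have "bracket_comp A \<gamma> p (\<lambda>p. (X p, 0)) (\<lambda>p. (Y p, 0)) c = 0" if "c < ?r" for c
  proof (rule bracket_comp_isotropic[OF A, where S = "{..<?r}"])
    show "\<gamma> ?\<kappa> {a} {#i#} p = 0" if "a \<notin> {..<?r}" for a i
      by (rule mono) (use that in auto)
    show "\<gamma> ?\<kappa> {a, b, c} {#} p = 0" if "a \<notin> {..<?r}" "b \<notin> {..<?r}" "c \<in> {..<?r}" for a b c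
    proof (rule mono)
      note notin = that(1,2)
      show "({a, b, c}, {#}) \<notin> {({a}, {#i#}) |a i. a < ?r} \<union> {({a, b, ?r + c}, {#}) |a b c. a < b \<and> b < ?r}"
      proof
        assume "({a, b, c}, {#}) \<in> {({a}, {#i#}) |a i. a < ?r} \<union> {({a, b, ?r + c}, {#}) |a b c. a < b \<and> b < ?r}"
        then have "({a, b, c}, {#}) \<in> {({a, b, ?r + c}, {#}) |a b c. a < b \<and> b < ?r}"
          by (rule UnE) (auto simp only: mem_Collect_eq prod.inject add_mset_not_empty empty_not_add_mset)
        then obtain a' b' c' where h: "{a, b, c} = {a', b', ?r + c'}" "a' < b'" "b' < ?r"
          unfolding mem_Collect_eq prod.inject by (elim exE conjE) (rule that)
        have "a' \<in> {a, b, c}" "b' \<in> {a, b, c}" unfolding h(1) by auto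
        then show False using h(2,3) notin by auto
      qed
    qed
    show "dual_index ?r a \<in> {..<?r} \<longleftrightarrow> a \<notin> {..<?r}" if "a < 2 * ?r" for a
      using that by (auto simp: dual_index_def)
  qed (use that s X Y in auto)
  then show ?thesis unfolding derived_bracket_expand double_frame_combination by simp
qed

text \<open>\<open>\<mu>\<close> does not contribute to the component in \<open>A\<^sup>*\<close> of the bracket of two sections of \<open>A\<^sup>*\<close>.\<close>

lemma snd_derived_bracket_lie_algebroid:
  assumes A: "vector_bundle A" and g: "lie_algebroid A \<mu>"
    and \<xi>: "\<xi> \<in> sections (dual_bundle A)" and \<eta>: "\<eta> \<in> sections (dual_bundle A)"
  shows "snd (derived_bracket A \<mu> (\<lambda>p. (0, \<xi> p)) (\<lambda>p. (0, \<eta> p)) p) = 0"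
proof -
  let ?r = "rank A" and ?\<kappa> = "coords_at A p"
  have \<kappa>: "?\<kappa> \<in> coord_systems A" "p \<in> cdom ?\<kappa>"
    using coords_at[OF A, of p] by (cases "?\<kappa>"; auto simp: coord_systems_def cdom_def)+
  have mono: "\<mu> ?\<kappa> S m p = 0"
    if "(S, m) \<notin> {({?r + a}, {#i#}) |a i. True} \<union> {({?r + a, ?r + b, c}, {#}) |a b c. a < b \<and> c < ?r}" for S m
    using g \<kappa> that unfolding lie_algebroid_def only_monomials_def Let_def by blast
  have s: "scomp A p (\<lambda>p. (0, \<zeta> p)) a q = 0"
    if "\<zeta> \<in> sections (dual_bundle A)" "q \<in> fst (snd ?\<kappa>)" "a < 2 * ?r" "a \<notin> {?r..}" for \<zeta> q a
  proof -
    have "\<zeta> q \<in> dual_space (fib A q)" using sectionsD(1)[OF that(1), of q] by simp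
    from frame_at_double(2)[OF frame_of_at(1)[OF A that(2)] subspace_0[OF vector_bundleD(2)[OF A]] this that(3)]
    show ?thesis using that(4) by (simp add: scomp_def comp_zero)
  qed
  have "bracket_comp A \<mu> p (\<lambda>p. (0, \<xi> p)) (\<lambda>p. (0, \<eta> p)) c = 0" if "?r \<le> c" "c < 2 * ?r" for c
  proof (rule bracket_comp_isotropic[OF A, where S = "{?r..}"])
    show "\<mu> ?\<kappa> {a} {#i#} p = 0" if "a \<notin> {?r..}" for a i
      by (rule mono) (use that in auto)
    show "\<mu> ?\<kappa> {a, b, c} {#} p = 0" if "a \<notin> {?r..}" "b \<notin> {?r..}" "c \<in> {?r..}" for a b c
    proof (rule mono)
      note notin = that(1,2)
      show "({a, b, c}, {#}) \<notin> {({?r + a}, {#i#}) |a i. True} \<union> {({?r + a, ?r + b, c}, {#}) |a b c. a < b \<and> c < ?r}"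
      proof
        assume "({a, b, c}, {#}) \<in> {({?r + a}, {#i#}) |a i. True} \<union> {({?r + a, ?r + b, c}, {#}) |a b c. a < b \<and> c < ?r}"
        then have "({a, b, c}, {#}) \<in> {({?r + a, ?r + b, c}, {#}) |a b c. a < b \<and> c < ?r}"
          by (rule UnE) (auto simp only: mem_Collect_eq prod.inject add_mset_not_empty empty_not_add_mset)
        then obtain a' b' c' where h: "{a, b, c} = {?r + a', ?r + b', c'}" "a' < b'"
          unfolding mem_Collect_eq prod.inject by (elim exE conjE) (rule that)
        have "?r + a' \<in> {a, b, c}" "?r + b' \<in> {a, b, c}" unfolding h(1) by auto
        then show False using h(2) notin by auto
      qed
    qed
    show "dual_index ?r a \<in> {?r..} \<longleftrightarrow> a \<notin> {?r..}" if "a < 2 * ?r" for a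
      using that by (auto simp: dual_index_def)
  qed (use that s \<xi> \<eta> in auto)
  then show ?thesis unfolding derived_bracket_expand double_frame_combination by simp
qed

text \<open>An endomorphism \<open>P\<close> without torsion such that \<open>P\<^sup>2 = c Id\<close> is normalized by the factor \<open>1 / sqrt \<bar>c\<bar>\<close>
  if \<open>c \<noteq> 0\<close>.\<close>

lemma proportional_to_cps_structure:
  assumes B: "vector_bundle B" and P: "P \<in> endos B"
    and sq: "\<And>p v. v \<in> fib B p \<Longrightarrow> P p (P p v) = c *\<^sub>R v"
    and br_mem: "\<And>u v p. br u v p \<in> fib B p"
    and br_scale: "\<And>u v k l p. u \<in> sections B \<Longrightarrow> v \<in> sections B \<Longrightarrow>
      br (\<lambda>q. k *\<^sub>R u q) (\<lambda>q. l *\<^sub>R v q) p = (k * l) *\<^sub>R br u v p"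
    and tor: "\<And>u v. u \<in> sections B \<Longrightarrow> v \<in> sections B \<Longrightarrow> torsion br P u v = 0"
  shows "\<exists>Q. cps_structure B br Q \<and> proportional B P Q"
proof -
  define s where "s = (if c = 0 then 1 else sqrt \<bar>c\<bar>)"
  define Q where "Q = (\<lambda>p v. (1 / s) *\<^sub>R P p v)"
  have s: "s \<noteq> 0" by (simp add: s_def)
  have Q: "Q \<in> endos B" unfolding Q_def by (rule endo_scale[OF B P])
  have "Q p (Q p v) = sgn c *\<^sub>R v" if v: "v \<in> fib B p" for p v
  proof -
    have "Q p (Q p v) = (c / (s * s)) *\<^sub>R v"
      using endosD(1,2)[OF P] sq v by (simp add: Q_def)
    also have "c / (s * s) = sgn c"
      by (auto simp: s_def sgn_if)
    finally show ?thesis .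
  qed
  moreover have "sgn c \<in> {-1, 1, 0}" by (auto simp: sgn_if)
  ultimately have "almost_cps_structure B Q" using Q unfolding almost_cps_structure_def by blast
  moreover have "torsion br Q u v = 0" if u: "u \<in> sections B" and v: "v \<in> sections B" for u v
  proof
    fix p
    note app = app_section[OF B P]
    have aQ: "app Q w = (\<lambda>q. (1 / s) *\<^sub>R app P w q)" for w by (simp add: app_def Q_def)
    have 1: "br (\<lambda>q. (1 / s) *\<^sub>R app P u q) v p = (1 / s) *\<^sub>R br (app P u) v p"
      "br u (\<lambda>q. (1 / s) *\<^sub>R app P v q) p = (1 / s) *\<^sub>R br u (app P v) p"
      using br_scale[OF app[OF u] v, of "1 / s" 1] br_scale[OF u app[OF v], of 1 "1 / s"] by simp_all
    have m: "br (app P u) v p + br u (app P v) p - P p (br u v p) \<in> fib B p"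
      by (intro subspace_diff[OF vector_bundleD(2)[OF B]] subspace_add[OF vector_bundleD(2)[OF B]] br_mem
          endosD(1)[OF P])
    have "torsion br Q u v p = (1 / s * (1 / s)) *\<^sub>R br (app P u) (app P v) p -
       (1 / s) *\<^sub>R P p ((1 / s) *\<^sub>R (br (app P u) v p + br u (app P v) p - P p (br u v p)))"
      unfolding torsion_def aQ using br_scale[OF app[OF u] app[OF v], of "1 / s" "1 / s" p] 1
      by (simp add: app_def Q_def scaleR_add_right scaleR_diff_right)
    also have "\<dots> = (1 / s * (1 / s)) *\<^sub>R torsion br P u v p"
      unfolding endosD(2)[OF P m] by (simp add: torsion_def app_def scaleR_diff_right)
    finally show "torsion br Q u v p = 0 p" using tor[OF u v] by simp
  qed
  ultimately have "cps_structure B br Q" by (simp add: cps_structure_def)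
  moreover have "proportional B P Q"
    unfolding proportional_def Q_def using s by (intro exI[of _ s]) simp
  ultimately show ?thesis by blast
qed

theorem theorem4p9:
  fixes A :: "('m::{t2_space,second_countable_topology}, 'v::real_vector) vbundle"
    and \<mu> \<gamma> :: "('m, 'v) gfamily"
    and N :: "'m \<Rightarrow> 'v \<Rightarrow> 'v"
  assumes "vector_bundle A"
    and "lie_bialgebroid A \<mu> \<gamma>"
    and "irreducible_courant_algebroid A (\<mu> + \<gamma>)"
    and "N \<in> endos A"
    and "nijenhuis_tensor A (\<mu> + \<gamma>) (double_endo A N)"
  shows "(\<exists>P. cps_structure A (lie_bracket A \<mu>) P \<and> proportional A N P) \<and>
         (\<exists>Q. cps_structure (dual_bundle A) (dual_lie_bracket A \<gamma>) Q \<and>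
              proportional (dual_bundle A) (transpose_endo A N) Q)"
proof -
  note A = assms(1) and N = assms(4) and nij = assms(5)
  let ?E = "double_bundle A" and ?\<N> = "double_endo A N" and ?t = "transpose_endo A N"
  let ?br = "derived_bracket A (\<mu> + \<gamma>)" and ?\<phi> = "\<lambda>p x. double_endo A N p (double_endo A N p x)"
  note E = vector_bundle_double[OF A] and D = vector_bundle_dual[OF A]
  have \<mu>: "lie_algebroid A \<mu>" and \<gamma>: "dual_lie_algebroid A \<gamma>"
    using assms(2) by (auto simp: lie_bialgebroid_def)
  have \<N>: "?\<N> \<in> endos ?E"
    and skew: "\<And>p x y. x \<in> fib ?E p \<Longrightarrow> y \<in> fib ?E p \<Longrightarrow> pairing (?\<N> p x) y = - pairing x (?\<N> p y)"
    and tor: "\<And>u v. u \<in> sections ?E \<Longrightarrow> v \<in> sections ?E \<Longrightarrow> torsion ?br ?\<N> u v = 0"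
    using nij by (auto simp: nijenhuis_tensor_def Let_def eq_neg_iff_add_eq_0)
  have "pairing (?\<phi> p x) y = pairing x (?\<phi> p y)" if "x \<in> fib ?E p" "y \<in> fib ?E p" for p x y
    using skew[OF endosD(1)[OF \<N> that(1)] that(2)] skew[OF that(1) endosD(1)[OF \<N> that(2)]] by simp
  then have "proportional ?E ?\<phi> (\<lambda>p v. v)"
    using conjunct2[OF assms(3)[unfolded irreducible_courant_algebroid_def Let_def], rule_format,
        OF endo_compose[OF E \<N> \<N>]] nijenhuis_square_commutes[OF A nij]
    by simp
  then obtain c where c: "\<And>p x. x \<in> fib ?E p \<Longrightarrow> ?\<phi> p x = c *\<^sub>R x"
    unfolding proportional_def by blast
  have z: "0 \<in> fib A p" "0 \<in> dual_space (fib A p)" for p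
    using subspace_0 vector_bundleD(2)[OF A] vector_bundleD(2)[OF D] by auto
  have N0: "N p 0 = 0" for p using endosD(2)[OF N z(1), of p 0] by simp
  have t0: "?t p 0 = 0" for p by (simp add: transpose_endo_def fun_eq_iff)
  have mem: "?br u v p \<in> fib ?E p" "derived_bracket A \<Theta> u v p \<in> fib ?E p" for \<Theta> u v p
    by (rule derived_bracket_mem[OF A])+

  have "\<exists>P. cps_structure A (lie_bracket A \<mu>) P \<and> proportional A N P"
  proof (rule proportional_to_cps_structure[OF A N])
    let ?i = "\<lambda>X p. (X p, 0 :: 'v \<Rightarrow> real)"
    have sec: "?i X \<in> sections ?E" if "X \<in> sections A" for X
      using pair_section[OF A that zero_section[OF D]] .
    show "N p (N p v) = c *\<^sub>R v" if "v \<in> fib A p" for p v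
      using c[of "(v, 0)" p] that z by (simp add: double_endo_def)
    show "lie_bracket A \<mu> X Y p \<in> fib A p" for X Y p
      using mem(2)[of \<mu> "?i X" "?i Y" p] by (simp add: lie_bracket_def mem_Times_iff)
    show "lie_bracket A \<mu> (\<lambda>q. k *\<^sub>R X q) (\<lambda>q. l *\<^sub>R Y q) p = (k * l) *\<^sub>R lie_bracket A \<mu> X Y p"
      if "X \<in> sections A" "Y \<in> sections A" for X Y k l p
      using derived_bracket_scale[OF A sec[OF that(1)] sec[OF that(2)], of \<mu> k l p]
      by (simp add: lie_bracket_def)
    have br: "lie_bracket A \<mu> X Y p = fst (?br (?i X) (?i Y) p)"
      if "X \<in> sections A" "Y \<in> sections A" for X Y p
      using fst_derived_bracket_dual_lie_algebroid[OF A \<gamma> that]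
      by (simp add: lie_bracket_def derived_bracket_add[OF A])
    have appi: "app ?\<N> (?i X) = ?i (app N X)" for X
      by (simp add: app_def double_endo_def t0)
    show "torsion (lie_bracket A \<mu>) N X Y = 0" if X: "X \<in> sections A" and Y: "Y \<in> sections A" for X Y
    proof
      fix p
      note nX = app_section[OF A N X] and nY = app_section[OF A N Y]
      have "torsion (lie_bracket A \<mu>) N X Y p = fst (torsion ?br ?\<N> (?i X) (?i Y) p)"
        unfolding torsion_def appi by (simp add: app_def double_endo_def br[OF nX nY, unfolded app_def]
            br[OF nX Y, unfolded app_def] br[OF X nY, unfolded app_def] br[OF X Y])
      then show "torsion (lie_bracket A \<mu>) N X Y p = 0 p" using tor[OF sec[OF X] sec[OF Y]] by simp
    qed
  qed

  moreover have "\<exists>Q. cps_structure (dual_bundle A) (dual_lie_bracket A \<gamma>) Q \<and>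
      proportional (dual_bundle A) (\<lambda>p \<xi>. - ?t p \<xi>) Q"
  proof (rule proportional_to_cps_structure[OF D])
    \<comment> \<open>The block of \<open>\<N>\<close> on \<open>A\<^sup>*\<close> is \<open>- \<^sup>tN\<close>; the sign is absorbed by the factor of proportionality.\<close>
    let ?i = "\<lambda>\<xi> p. (0 :: 'v, \<xi> p)" and ?s = "\<lambda>p \<xi>. - ?t p \<xi>"
    show s: "?s \<in> endos (dual_bundle A)"
      using endo_scale[OF D transpose_endo_endos[OF A N], of "-1"] by simp
    have sec: "?i \<xi> \<in> sections ?E" if "\<xi> \<in> sections (dual_bundle A)" for \<xi>
      using pair_section[OF A zero_section[OF A] that] .
    show "?s p (?s p \<xi>) = c *\<^sub>R \<xi>" if "\<xi> \<in> fib (dual_bundle A) p" for p \<xi>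
      using c[of "(0, \<xi>)" p] that z by (simp add: double_endo_def)
    show "dual_lie_bracket A \<gamma> \<xi> \<eta> p \<in> fib (dual_bundle A) p" for \<xi> \<eta> p
      using mem(2)[of \<gamma> "?i \<xi>" "?i \<eta>" p] by (simp add: dual_lie_bracket_def mem_Times_iff)
    show "dual_lie_bracket A \<gamma> (\<lambda>q. k *\<^sub>R \<xi> q) (\<lambda>q. l *\<^sub>R \<eta> q) p = (k * l) *\<^sub>R dual_lie_bracket A \<gamma> \<xi> \<eta> p"
      if "\<xi> \<in> sections (dual_bundle A)" "\<eta> \<in> sections (dual_bundle A)" for \<xi> \<eta> k l p
      using derived_bracket_scale[OF A sec[OF that(1)] sec[OF that(2)], of \<gamma> k l p]
      by (simp add: dual_lie_bracket_def)
    have br: "dual_lie_bracket A \<gamma> \<xi> \<eta> p = snd (?br (?i \<xi>) (?i \<eta>) p)"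
      if "\<xi> \<in> sections (dual_bundle A)" "\<eta> \<in> sections (dual_bundle A)" for \<xi> \<eta> p
      using snd_derived_bracket_lie_algebroid[OF A \<mu> that]
      by (simp add: dual_lie_bracket_def derived_bracket_add[OF A])
    have appi: "app ?\<N> (?i \<xi>) = ?i (app ?s \<xi>)" for \<xi>
      by (simp add: app_def double_endo_def N0)
    show "torsion (dual_lie_bracket A \<gamma>) ?s \<xi> \<eta> = 0"
      if X: "\<xi> \<in> sections (dual_bundle A)" and Y: "\<eta> \<in> sections (dual_bundle A)" for \<xi> \<eta>
    proof
      fix p
      note nX = app_section[OF D s X] and nY = app_section[OF D s Y]
      have "torsion (dual_lie_bracket A \<gamma>) ?s \<xi> \<eta> p = snd (torsion ?br ?\<N> (?i \<xi>) (?i \<eta>) p)"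
        unfolding torsion_def appi by (simp add: app_def double_endo_def br[OF nX nY, unfolded app_def]
            br[OF nX Y, unfolded app_def] br[OF X nY, unfolded app_def] br[OF X Y])
      then show "torsion (dual_lie_bracket A \<gamma>) ?s \<xi> \<eta> p = 0 p" using tor[OF sec[OF X] sec[OF Y]] by simp
    qed
  qed
  then obtain Q k where Q: "cps_structure (dual_bundle A) (dual_lie_bracket A \<gamma>) Q"
    "\<And>p \<xi>. \<xi> \<in> fib (dual_bundle A) p \<Longrightarrow> - ?t p \<xi> = k *\<^sub>R Q p \<xi>"
    unfolding proportional_def by blast
  have "proportional (dual_bundle A) ?t Q"
    unfolding proportional_def using Q(2) by (intro exI[of _ "- k"]) (metis minus_minus scaleR_minus_left)
  ultimately show ?thesis using Q(1) by blast
qed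

end
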